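(* Let $K\subset\mathbb{R}^2$ be a compact convex set with boundary of class $C^2$ and support function $p$ of class $C^2$, and let $L$ be the length of $\partial K$. Let $c_k^2=a_k^2+b_k^2$, where $a_k,b_k$ are the Fourier coefficients of $p$. Then, for every continuous function $f:[0,\pi]\to\mathbb{R}$ such that $f(\omega)=O(\omega^3)$ as $\omega\to 0$, one has $$\int_{P\notin K} f(\omega)\,dP=\left(\int_0^\pi \frac{f(\omega)(1+\cos\omega)^2}{\sin^3\omega}\,d\omega\right)\frac{L^2}{2\pi}+\pi\sum_{k\ge 2}\left(\int_0^\pi\frac{f(\omega)h_k(\omega)}{\sin^3\omega}\,d\omega\right)c_k^2,$$ where on the left-hand side $\omega=\omega(P)$ is the visual angle of $K$ from $P$, and for $k\ge 2$ $$h_k(\omega)=2\cos\omega+(-1)^{k+1}\bigl(-\cos (k\omega)\,(1+\cos^2\omega)-2k\sin (k\omega)\sin\omega\cos\omega+k^2\cos (k\omega)\sin^2\omega\bigr).$$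
   Context: The support function of a compact convex set $K$ is the $2\pi$-periodic function $p(\varphi)=\sup\{x\cos\varphi+y\sin\varphi : (x,y)\in K\}$, with Fourier series $p(\varphi)=a_0+\sum_{n\ge1}(a_n\cos n\varphi+b_n\sin n\varphi)$. For $P\notin K$, the visual angle $\omega(P)\in(0,\pi)$ is the angle between the two tangent lines from $P$ to $\partial K$ (the angle at $P$ under which $K$ is seen). $dP$ denotes Lebesgue (area) measure on $\mathbb{R}^2$, and $\int_{P\notin K}$ is integration over $\mathbb{R}^2\setminus K$. *)

theory Defs
  imports "HOL-Analysis.Analysis" "HOL-Library.Landau_Symbols"
begin

definition C2_function :: "(real \<Rightarrow> 'a::real_normed_vector) \<Rightarrow> bool" where
  "C2_function g \<longleftrightarrow>
     (\<exists>g' g''. (\<forall>t. (g has_vector_derivative g' t) (at t)) \<and>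
               (\<forall>t. (g' has_vector_derivative g'' t) (at t)) \<and>
               continuous_on UNIV g'')"

(* Periodicity makes the curve close up with all derivatives; simple_path and path_image refer to
   one period, the unit interval. *)
definition C2_boundary_parametrization :: "(real \<Rightarrow> real^2) \<Rightarrow> (real^2) set \<Rightarrow> bool" where
  "C2_boundary_parametrization \<gamma> K \<longleftrightarrow>
     C2_function \<gamma> \<and>
     (\<forall>t. \<gamma> (t + 1) = \<gamma> t) \<and>
     (\<forall>t. vector_derivative \<gamma> (at t) \<noteq> 0) \<and>
     simple_path \<gamma> \<and>
     path_image \<gamma> = frontier K"

definition closed_curve_length :: "(real \<Rightarrow> real^2) \<Rightarrow> real" where
  "closed_curve_length \<gamma> = (LBINT t:{0..1}. norm (vector_derivative \<gamma> (at t)))"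

definition support_function :: "(real^2) set \<Rightarrow> real \<Rightarrow> real" where
  "support_function K \<phi> = (SUP z\<in>K. z $ 1 * cos \<phi> + z $ 2 * sin \<phi>)"

(* Normalised for n \<ge> 1 (the constant term of the series carries an extra factor 1/2). *)
definition fourier_cos_coeff :: "(real \<Rightarrow> real) \<Rightarrow> nat \<Rightarrow> real" where
  "fourier_cos_coeff p n = (1 / pi) * (LBINT \<phi>:{0..2*pi}. p \<phi> * cos (real n * \<phi>))"

definition fourier_sin_coeff :: "(real \<Rightarrow> real) \<Rightarrow> nat \<Rightarrow> real" where
  "fourier_sin_coeff p n = (1 / pi) * (LBINT \<phi>:{0..2*pi}. p \<phi> * sin (real n * \<phi>))"

definition vector_angle :: "real^2 \<Rightarrow> real^2 \<Rightarrow> real" where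
  "vector_angle u v = arccos (u \<bullet> v / (norm u * norm v))"

definition tangent_line :: "(real \<Rightarrow> real^2) \<Rightarrow> real \<Rightarrow> (real^2) set" where
  "tangent_line \<gamma> t = range (\<lambda>s. \<gamma> t + s *\<^sub>R vector_derivative \<gamma> (at t))"

(* Two lines alone determine an angle only up to supplement. The angle under which the curve is
   seen is the one between the rays from P to the two points of tangency. From an exterior point
   of a strictly convex body (a differentiable support function implies strict convexity) there
   are exactly two tangent lines, each touching the boundary in one point, so the description is
   definite. *)
definition visual_angle :: "(real \<Rightarrow> real^2) \<Rightarrow> real^2 \<Rightarrow> real" where
  "visual_angle \<gamma> P =
     (THE \<omega>. \<exists>s t. P \<in> tangent_line \<gamma> s \<and> P \<in> tangent_line \<gamma> t \<and>
        tangent_line \<gamma> s \<noteq> tangent_line \<gamma> t \<and>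
        \<omega> = vector_angle (\<gamma> s - P) (\<gamma> t - P))"

definition h_fun :: "nat \<Rightarrow> real \<Rightarrow> real" where
  "h_fun k \<omega> = 2 * cos \<omega> + (-1) ^ (k + 1) *
     (- cos (real k * \<omega>) * (1 + (cos \<omega>)\<^sup>2)
      - 2 * real k * sin (real k * \<omega>) * sin \<omega> * cos \<omega>
      + (real k)\<^sup>2 * cos (real k * \<omega>) * (sin \<omega>)\<^sup>2)"

end

theory Submission
  imports Defs
begin

text \<open>
  The exterior of the body is parametrised by pairs of tangents. If the outer normals of two tangents have the
  angles \<open>\<phi>\<close> and \<open>\<phi> + \<pi> - \<omega>\<close>, then their crossing point sees the body under the angle \<open>\<omega>\<close>, and every
  exterior point arises from exactly one pair with \<open>0 \<le> \<phi> < 2 \<pi>\<close> and \<open>0 < \<omega> < \<pi>\<close>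
  (\<open>crossing_map_inj\<close>, \<open>crossing_map_image\<close>, \<open>visual_angle_crossing\<close>). The area element is
  \<open>A B / sin\<^sup>3 \<omega> d\<phi> d\<omega>\<close>, where \<open>A\<close> and \<open>B\<close> are \<open>sin \<omega>\<close> times the lengths of the two
  tangent segments (\<open>crossing_jacobian\<close>). Both are linear in the support function:
  \<open>A = p (\<phi> + \<pi> - \<omega>) + p \<phi> cos \<omega> - p' \<phi> sin \<omega>\<close>, and similarly for \<open>B\<close>.

  The area integral is therefore the integral of \<open>f \<omega> / sin\<^sup>3 \<omega>\<close> against the integral of
  \<open>A B\<close> over \<open>\<phi>\<close> (\<open>area_integral\<close>). The latter is a quadratic expression in the Fourier coefficients
  of \<open>p\<close>, by Parseval's identity for shifted functions: the mean value of \<open>p\<close>, which is \<open>L / (2 \<pi>)\<close> by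
  Cauchy's formula, gives the term with \<open>(1 + cos \<omega>)\<^sup>2\<close>, and the \<open>k\<close>-th harmonic gives \<open>\<pi> c\<^sub>k\<^sup>2 h\<^sub>k\<close>
  (\<open>seg_product_integral_sums\<close>).

  All estimates come from a single comparison principle (\<open>sine_comparison\<close>): a function vanishing to second
  order at \<open>0\<close> is controlled by \<open>1 - cos\<close> times the bounds of \<open>g'' + g\<close>. For the support function
  \<open>p + p''\<close> is the radius of curvature, which gives \<open>0 < A, B \<le> M (1 + cos \<omega>)\<close>; positivity and sign
  information of this kind also yields the uniqueness of tangent pairs. For a pure harmonic it gives
  \<open>\<bar>h\<^sub>k\<bar> \<le> 2 (k\<^sup>2 - 1)\<^sup>2 (1 + cos \<omega>)\<^sup>2\<close>. Since \<open>f \<omega> (1 + cos \<omega>)\<^sup>2 / sin\<^sup>3 \<omega>\<close>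
  is bounded and the sum of \<open>(k\<^sup>2 - 1)\<^sup>2 c\<^sub>k\<^sup>2\<close> converges by Bessel's inequality for \<open>p + p''\<close>, the
  series may be integrated term by term.

  What remains is to pass from the given boundary curve to the support function: the curve is the
  contact point as a function of its normal angle, which runs through one full turn
  (\<open>boundary_support_parametrization\<close>).
\<close>

section \<open>Periodic functions and antiderivatives\<close>

lemma periodic_add_int:
  fixes g :: "real \<Rightarrow> 'a"
  assumes "\<And>x. g (x + T) = g x"
  shows "g (x + T * of_int n) = g x"
proof (induction n rule: int_induct[where k = 0])
  case (step1 i)
  then show ?case using assms[of "x + T * of_int i"] by (simp add: algebra_simps)
next
  case (step2 i)
  then show ?case using assms[of "x + T * of_int (i - 1)"] by (simp add: algebra_simps)
qed simp

lemma reduce_mod_period: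
  fixes T x y :: real
  assumes "T > 0"
  shows "\<exists>n::int. x \<le> y + T * of_int n \<and> y + T * of_int n < x + T"
proof
  let ?n = "- \<lfloor>(y - x) / T\<rfloor>"
  show "x \<le> y + T * of_int ?n \<and> y + T * of_int ?n < x + T"
    using floor_divide_lower[OF assms, of "y - x"] floor_divide_upper[OF assms, of "y - x"]
    by (simp add: algebra_simps)
qed

lemma periodic_derivative:
  fixes f f' :: "real \<Rightarrow> real"
  assumes d: "\<And>x. (f has_real_derivative f' x) (at x)" and per: "\<And>x. f (x + T) = f x"
  shows "f' (x + T) = f' x"
proof -
  have "((\<lambda>x. f (x + T)) has_real_derivative f' (x + T)) (at x)"
    using d[of "x + T"] by (simp add: DERIV_shift)
  then show ?thesis unfolding per using d DERIV_unique by blast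
qed

lemma continuous_antiderivative:
  fixes f :: "real \<Rightarrow> 'a::euclidean_space"
  assumes "continuous_on UNIV f"
  obtains F where "\<And>x. (F has_vector_derivative f x) (at x)"
proof -
  have "\<exists>F. \<forall>x. -\<infinity> < ereal x \<longrightarrow> ereal x < \<infinity> \<longrightarrow> (F has_vector_derivative f x) (at x)"
    by (rule einterval_antiderivative) (use assms in \<open>auto simp: continuous_on_eq_continuous_at\<close>)
  then show thesis using that by auto
qed

lemma nonzero_continuous_sign:
  fixes f :: "real \<Rightarrow> real"
  assumes "continuous_on UNIV f" "\<And>x. f x \<noteq> 0"
  shows "(\<forall>x. f x > 0) \<or> (\<forall>x. f x < 0)"
proof (rule ccontr)
  assume "\<not> ?thesis"
  then obtain a b where "f a < 0" "f b > 0" using assms(2) by (metis linorder_neqE_linordered_idom)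
  moreover have "connected (f ` UNIV)" using assms(1) connected_UNIV connected_continuous_image by blast
  ultimately have "0 \<in> f ` UNIV" unfolding connected_iff_interval by (metis less_imp_le rangeI)
  then show False using assms(2) by auto
qed

lemma integral_periodic_shift:
  fixes g :: "real \<Rightarrow> real"
  assumes c: "continuous_on UNIV g" and per: "\<And>x. g (x + T) = g x" and T: "T \<ge> 0"
  shows "integral {0..T} (\<lambda>x. g (x + d)) = integral {0..T} g"
proof -
  obtain G where G: "\<And>x. (G has_real_derivative g x) (at x)"
    using continuous_antiderivative[OF c] by (auto simp: has_real_derivative_iff_has_vector_derivative)
  have G_shift: "((\<lambda>x. G (x + e)) has_real_derivative g (x + e)) (at x)" for x e
    using G[of "x + e"] by (simp add: DERIV_shift)
  have int: "integral {0..T} (\<lambda>x. g (x + e)) = G (T + e) - G e" for e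
  proof (rule integral_unique)
    have "((\<lambda>x. g (x + e)) has_integral (G (T + e) - G (0 + e))) {0..T}"
      by (rule fundamental_theorem_of_calculus[OF T])
        (auto simp: has_real_derivative_iff_has_vector_derivative[symmetric]
          intro: has_field_derivative_at_within G_shift)
    then show "((\<lambda>x. g (x + e)) has_integral (G (T + e) - G e)) {0..T}" by simp
  qed
  have "((\<lambda>x. G (x + T) - G x) has_real_derivative 0) (at x)" for x
    using DERIV_diff[OF G_shift[of T x] G[of x]] by (simp add: per)
  then have "G (d + T) - G d = G (0 + T) - G 0"
    using DERIV_isconst_all[of "\<lambda>x. G (x + T) - G x"] by blast
  then show ?thesis using int[of d] int[of 0] by (simp add: add.commute)
qed

section \<open>Fourier coefficients\<close>

text \<open>Integration by parts over a period leaves no boundary terms: apply this to a product of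
  periodic functions.\<close>
lemma has_integral_periodic_derivative:
  fixes G g :: "real \<Rightarrow> real"
  assumes "\<And>x. (G has_real_derivative g x) (at x)" "G (2*pi) = G 0"
  shows "(g has_integral 0) {0..2*pi}"
proof -
  have "(g has_integral (G (2*pi) - G 0)) {0..2*pi}"
    by (rule fundamental_theorem_of_calculus)
       (auto simp: has_real_derivative_iff_has_vector_derivative[symmetric] intro: has_field_derivative_at_within assms)
  with assms show ?thesis by simp
qed

lemma integral_cos_2pi:
  "integral {0..2*pi} (\<lambda>x. cos (of_int n * x)) = (if n = 0 then 2 * pi else 0)"
proof (cases "n = 0")
  case False
  have "((\<lambda>x. cos (of_int n * x)) has_integral 0) {0..2*pi}"
    by (rule has_integral_periodic_derivative[where G = "\<lambda>x. sin (of_int n * x) / of_int n"])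
       (use False sin_int_2pin[of n] in \<open>auto intro!: derivative_eq_intros simp: mult.commute mult.left_commute\<close>)
  with False show ?thesis by (simp add: integral_unique)
qed simp

lemma integral_sin_2pi:
  "integral {0..2*pi} (\<lambda>x. sin (of_int n * x)) = 0"
proof (cases "n = 0")
  case False
  have "((\<lambda>x. sin (of_int n * x)) has_integral 0) {0..2*pi}"
    by (rule has_integral_periodic_derivative[where G = "\<lambda>x. - cos (of_int n * x) / of_int n"])
       (use False cos_int_2pin[of n] in \<open>auto intro!: derivative_eq_intros simp: mult.commute mult.left_commute\<close>)
  with False show ?thesis by (simp add: integral_unique)
qed simp

lemma trig_orthogonality:
  fixes k n :: nat
  assumes "k > 0"
  shows "integral {0..2*pi} (\<lambda>x. cos (real k * x) * cos (real n * x)) = (if k = n then pi else 0)"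
    and "integral {0..2*pi} (\<lambda>x. sin (real k * x) * sin (real n * x)) = (if k = n then pi else 0)"
    and "integral {0..2*pi} (\<lambda>x. cos (real k * x) * sin (real n * x)) = 0"
    and "integral {0..2*pi} (\<lambda>x. sin (real k * x) * cos (real n * x)) = 0"
proof -
  let ?C = "\<lambda>j x. cos (of_int j * x)" and ?S = "\<lambda>j x. sin (of_int j * x)"
  define d s where "d = int k - int n" and "s = int k + int n"
  have int: "?C j integrable_on {0..2*pi}" "?S j integrable_on {0..2*pi}" for j
    by (intro integrable_continuous_interval continuous_intros)+
  have s: "s \<noteq> 0" and d: "d = 0 \<longleftrightarrow> k = n" using assms by (auto simp: s_def d_def)
  have "(\<lambda>x. cos (real k * x) * cos (real n * x)) = (\<lambda>x. (?C d x + ?C s x) / 2)"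
    by (auto simp: d_def s_def cos_add cos_diff algebra_simps)
  then show "integral {0..2*pi} (\<lambda>x. cos (real k * x) * cos (real n * x)) = (if k = n then pi else 0)"
    using s d by (simp add: integral_add int integral_cos_2pi)
  have "(\<lambda>x. sin (real k * x) * sin (real n * x)) = (\<lambda>x. (?C d x - ?C s x) / 2)"
    by (auto simp: d_def s_def cos_add cos_diff algebra_simps)
  then show "integral {0..2*pi} (\<lambda>x. sin (real k * x) * sin (real n * x)) = (if k = n then pi else 0)"
    using s d by (simp add: integral_diff int integral_cos_2pi)
  have "(\<lambda>x. cos (real k * x) * sin (real n * x)) = (\<lambda>x. (?S s x - ?S d x) / 2)"
    by (auto simp: d_def s_def sin_add sin_diff algebra_simps)
  then show "integral {0..2*pi} (\<lambda>x. cos (real k * x) * sin (real n * x)) = 0"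
    by (simp add: integral_diff int integral_sin_2pi)
  have "(\<lambda>x. sin (real k * x) * cos (real n * x)) = (\<lambda>x. (?S s x + ?S d x) / 2)"
    by (auto simp: d_def s_def sin_add sin_diff algebra_simps)
  then show "integral {0..2*pi} (\<lambda>x. sin (real k * x) * cos (real n * x)) = 0"
    by (simp add: integral_add int integral_sin_2pi)
qed

lemma fourier_coeff_integral:
  assumes "continuous_on UNIV g"
  shows "integral {0..2*pi} (\<lambda>x. g x * cos (real n * x)) = pi * fourier_cos_coeff g n"
    and "integral {0..2*pi} (\<lambda>x. g x * sin (real n * x)) = pi * fourier_sin_coeff g n"
proof -
  have c: "continuous_on {0..2*pi} g" using assms continuous_on_subset by blast
  have "set_integrable lborel {0..2*pi} (\<lambda>x. g x * cos (real n * x))"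
    "set_integrable lborel {0..2*pi} (\<lambda>x. g x * sin (real n * x))"
    by (intro borel_integrable_atLeastAtMost' continuous_intros c)+
  from this[THEN set_borel_integral_eq_integral(2)]
  show "integral {0..2*pi} (\<lambda>x. g x * cos (real n * x)) = pi * fourier_cos_coeff g n"
    "integral {0..2*pi} (\<lambda>x. g x * sin (real n * x)) = pi * fourier_sin_coeff g n"
    by (simp_all add: fourier_cos_coeff_def fourier_sin_coeff_def)
qed

section \<open>Completeness and uniform convergence of Fourier series\<close>

text \<open>Two branches of the argument cover the circle: \<^term>\<open>Im (Ln z)\<close> is continuous off the negative
  axis and \<^term>\<open>Im (Ln (- z)) + pi\<close> off the positive axis, and both give the same value of a periodic
  function.\<close>
lemma periodic_factor_cis:
  fixes w :: "real \<Rightarrow> real"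
  assumes c: "continuous_on UNIV w" and per: "\<And>x. w (x + 2*pi) = w x"
  obtains F :: "complex \<Rightarrow> real" where "continuous_on (sphere 0 1) F" "\<And>x. F (cis x) = w x"
proof -
  note per_int = periodic_add_int[of w "2*pi", OF per]
  define F where "F = (\<lambda>z. w (Im (Ln z)))"
  have F: "F z = w x" if "exp (Complex r x) = z" for z r x
  proof -
    have "exp (Ln z) = exp (Complex r x)" using that by (metis exp_Ln exp_not_eq_zero)
    then obtain n :: int where "Ln z = Complex r x + of_int (2*n) * pi * \<i>"
      unfolding exp_eq by blast
    then have "Im (Ln z) = x + 2*pi * of_int n" by simp
    then show ?thesis by (simp add: F_def per_int)
  qed
  let ?A = "- \<real>\<^sub>\<le>\<^sub>0 :: complex set" and ?B = "- \<real>\<^sub>\<ge>\<^sub>0 :: complex set"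
  have "continuous_on ?A F"
    unfolding F_def by (intro continuous_on_compose2[OF c] continuous_intros) auto
  moreover have "continuous_on ?B F"
  proof -
    have neg: "- z \<notin> \<real>\<^sub>\<le>\<^sub>0" if "z \<in> ?B" for z using that by auto
    have "continuous_on ?B (\<lambda>z. w (Im (Ln (- z)) + pi))"
      by (intro continuous_on_compose2[OF c] continuous_intros) (use neg in auto)
    moreover have "F z = w (Im (Ln (- z)) + pi)" if "z \<in> ?B" for z
    proof (rule F[where r = "Re (Ln (- z))"])
      have "z \<noteq> 0" using that by auto
      have "Complex (Re (Ln (- z))) (Im (Ln (- z)) + pi) = Ln (- z) + \<i> * pi" by (simp add: complex_eq_iff)
      then show "exp (Complex (Re (Ln (- z))) (Im (Ln (- z)) + pi)) = z"
        using \<open>z \<noteq> 0\<close> by (simp add: exp_add)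
    qed
    ultimately show ?thesis by (subst continuous_on_cong[OF refl])
  qed
  ultimately have "continuous_on (?A \<union> ?B) F"
    by (intro continuous_on_open_Un) (auto simp: closed_nonpos_Reals_complex closed_nonneg_Reals_complex)
  moreover have "sphere 0 1 \<subseteq> ?A \<union> ?B"
    by (auto simp: complex_nonpos_Reals_iff complex_nonneg_Reals_iff cmod_def)
  ultimately have "continuous_on (sphere 0 1) F" by (rule continuous_on_subset)
  moreover have "F (cis x) = w x" for x
    by (rule F[where r = 0]) (simp add: cis_conv_exp Complex_eq)
  ultimately show thesis by (rule that)
qed

text \<open>The functions \<open>g\<close> for which all Fourier coefficients of \<open>w * g\<close> vanish are stable under
  multiplication by \<open>cos\<close> and \<open>sin\<close>, by the addition formulas, and contain the
  constants by assumption. Hence they contain every polynomial in \<open>cos\<close> and \<open>sin\<close>, and by Stone-Weierstrass on the unit circle such polynomials approximate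
  \<open>w\<close> itself, so that the integral of \<open>w\<^sup>2\<close> vanishes.\<close>
lemma continuous_periodic_zero_coeffs:
  fixes w :: "real \<Rightarrow> real"
  assumes c: "continuous_on UNIV w" and per: "\<And>x. w (x + 2*pi) = w x"
    and 0: "\<And>n. fourier_cos_coeff w n = 0" "\<And>n. fourier_sin_coeff w n = 0"
  shows "w x = 0"
proof -
  define W where "W = {g :: real \<Rightarrow> real. continuous_on UNIV g \<and>
     (\<forall>n::nat. integral {0..2*pi} (\<lambda>x. w x * g x * cos (real n * x)) = 0 \<and>
          integral {0..2*pi} (\<lambda>x. w x * g x * sin (real n * x)) = 0)}"
  have cw: "continuous_on S w" for S using c continuous_on_subset by blast
  have cg: "continuous_on S g" if "g \<in> W" for g S
    using that unfolding W_def by (auto intro: continuous_on_subset)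
  have coef: "integral {0..2*pi} (\<lambda>x. w x * g x * cos (of_int n * x)) = 0"
      "integral {0..2*pi} (\<lambda>x. w x * g x * sin (of_int n * x)) = 0" if "g \<in> W" for g and n :: int
  proof -
    obtain k :: nat where k: "real_of_int n = real k \<or> real_of_int n = - real k"
      by (metis int_cases2 of_int_minus of_int_of_nat_eq)
    have "integral {0..2*pi} (\<lambda>x. w x * g x * cos (real k * x)) = 0"
      "integral {0..2*pi} (\<lambda>x. w x * g x * sin (real k * x)) = 0"
      using that by (simp_all add: W_def)
    with k show "integral {0..2*pi} (\<lambda>x. w x * g x * cos (of_int n * x)) = 0"
      "integral {0..2*pi} (\<lambda>x. w x * g x * sin (of_int n * x)) = 0"
      by (elim disjE; simp)+
  qed
  have add: "(\<lambda>x. g x + h x) \<in> W" if "g \<in> W" "h \<in> W" for g h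
  proof -
    have i: "(\<lambda>x. w x * g x * cos (real n * x)) integrable_on {0..2*pi}"
         "(\<lambda>x. w x * g x * sin (real n * x)) integrable_on {0..2*pi}" if "g \<in> W" for g n
      by (intro integrable_continuous_interval continuous_intros cw cg that)+
    show ?thesis
      using that i[OF that(1)] i[OF that(2)] unfolding W_def
      by (auto simp: ring_distribs integral_add intro: continuous_intros)
  qed
  have scale: "(\<lambda>x. c * g x) \<in> W" if "g \<in> W" for g c
  proof -
    have "(\<lambda>x. w x * (c * g x) * h x) = (\<lambda>x. c * (w x * g x * h x))" for h
      by (auto simp: mult_ac)
    then show ?thesis using that unfolding W_def by (auto intro: continuous_intros)
  qed
  have cosW: "(\<lambda>x. cos x * g x) \<in> W" and sinW: "(\<lambda>x. sin x * g x) \<in> W" if g: "g \<in> W" for g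
  proof -
    let ?C = "\<lambda>j x. w x * g x * cos (of_int j * x)" and ?S = "\<lambda>j x. w x * g x * sin (of_int j * x)"
    have i: "?C j integrable_on {0..2*pi}" "?S j integrable_on {0..2*pi}" for j
      by (intro integrable_continuous_interval continuous_intros cw cg that)+
    have e: "(\<lambda>x. w x * (cos x * g x) * cos (real n * x)) = (\<lambda>x. (?C (int n + 1) x + ?C (int n - 1) x) / 2)"
       "(\<lambda>x. w x * (cos x * g x) * sin (real n * x)) = (\<lambda>x. (?S (int n + 1) x + ?S (int n - 1) x) / 2)"
       "(\<lambda>x. w x * (sin x * g x) * cos (real n * x)) = (\<lambda>x. (?S (int n + 1) x - ?S (int n - 1) x) / 2)"
       "(\<lambda>x. w x * (sin x * g x) * sin (real n * x)) = (\<lambda>x. (?C (int n - 1) x - ?C (int n + 1) x) / 2)" for n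
      by (auto simp: ring_distribs cos_add cos_diff sin_add sin_diff)
    show "(\<lambda>x. cos x * g x) \<in> W"
      unfolding W_def mem_Collect_eq e integral_divide
      by (simp add: integral_add i coef[OF g] continuous_intros cg[OF g] del: of_int_add of_int_diff)
    show "(\<lambda>x. sin x * g x) \<in> W"
      unfolding W_def mem_Collect_eq e integral_divide
      by (simp add: integral_diff i coef[OF g] continuous_intros cg[OF g] del: of_int_add of_int_diff)
  qed
  \<comment> \<open>Asking for all multipliers \<open>g\<close> at once makes the product step of the induction trivial.\<close>
  have poly: "\<forall>g\<in>W. (\<lambda>x. q (cis x) * g x) \<in> W" if "real_polynomial_function q" for q
    using that
  proof induction
    case (linear f)
    have "f (cis x) = f 1 * cos x + f \<i> * sin x" for x
    proof -
      have "cis x = cos x *\<^sub>R 1 + sin x *\<^sub>R \<i>" by (simp add: complex_eq_iff)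
      then show ?thesis using linear by (simp add: linear_simps bounded_linear.linear mult.commute)
    qed
    then have "(\<lambda>x. f (cis x) * g x) = (\<lambda>x. f 1 * (cos x * g x) + f \<i> * (sin x * g x))" for g
      by (auto simp: algebra_simps)
    then show ?case using add scale cosW sinW by auto
  next
    case (const c)
    then show ?case using scale by auto
  next
    case (add f g)
    then show ?case using \<open>\<And>h g. g \<in> W \<Longrightarrow> h \<in> W \<Longrightarrow> (\<lambda>x. g x + h x) \<in> W\<close> by (auto simp: ring_distribs)
  next
    case (mult f g)
    then show ?case by (auto simp: mult.assoc)
  qed
  have one: "(\<lambda>x. 1) \<in> W"
    unfolding W_def using fourier_coeff_integral[OF c] 0 by auto
  obtain F :: "complex \<Rightarrow> real" where F: "continuous_on (sphere 0 1) F" "\<And>x. F (cis x) = w x"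
    using periodic_factor_cis[OF c per] by blast
  define I where "I = integral {0..2*pi} (\<lambda>x. (w x)\<^sup>2)"
  define J where "J = integral {0..2*pi} (\<lambda>x. \<bar>w x\<bar>)"
  have J: "J \<ge> 0" unfolding J_def by (intro integral_nonneg integrable_continuous_interval continuous_intros cw) auto
  have "I \<le> e * J" if "e > 0" for e
  proof -
    obtain q where q: "real_polynomial_function q" "\<And>z. z \<in> sphere 0 1 \<Longrightarrow> \<bar>F z - q z\<bar> < e"
      using Stone_Weierstrass_real_polynomial_function[OF compact_sphere F(1) \<open>e > 0\<close>] by blast
    have cq: "continuous_on {0..2*pi} (\<lambda>x. q (cis x))"
      using cg[OF poly[OF q(1), rule_format, OF one]] by simp
    have qW: "integral {0..2*pi} (\<lambda>x. w x * q (cis x)) = 0"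
      using coef(1)[OF poly[OF q(1), rule_format, OF one], of 0] by simp
    have "I = integral {0..2*pi} (\<lambda>x. (w x)\<^sup>2) - integral {0..2*pi} (\<lambda>x. w x * q (cis x))"
      by (simp add: I_def qW)
    also have "\<dots> = integral {0..2*pi} (\<lambda>x. (w x)\<^sup>2 - w x * q (cis x))"
      by (intro integral_diff[symmetric] integrable_continuous_interval continuous_intros cw cq)
    also have "\<dots> \<le> integral {0..2*pi} (\<lambda>x. e * \<bar>w x\<bar>)"
    proof (intro integral_le integrable_continuous_interval continuous_intros cw cq)
      fix x
      have "\<bar>w x - q (cis x)\<bar> < e" using q(2)[of "cis x"] F(2)[of x] by simp
      then have "\<bar>w x\<bar> * \<bar>w x - q (cis x)\<bar> \<le> \<bar>w x\<bar> * e" by (intro mult_left_mono) auto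
      then show "(w x)\<^sup>2 - w x * q (cis x) \<le> e * \<bar>w x\<bar>"
        unfolding abs_mult[symmetric] by (simp add: power2_eq_square algebra_simps)
    qed
    finally show ?thesis by (simp add: J_def)
  qed
  then have "I \<le> 0"
  proof -
    assume *: "\<And>e. e > 0 \<Longrightarrow> I \<le> e * J"
    show ?thesis
    proof (rule field_le_epsilon)
      fix e :: real assume "e > 0"
      then have "I \<le> e / (J + 1) * J" using *[of "e / (J + 1)"] J \<open>e > 0\<close> by simp
      also have "\<dots> \<le> e" using J \<open>e > 0\<close> by (simp add: field_simps)
      finally show "I \<le> 0 + e" by simp
    qed
  qed
  moreover have "I \<ge> 0" unfolding I_def by (intro integral_nonneg integrable_continuous_interval continuous_intros cw) auto
  ultimately have "I = 0" by simp
  then have "((\<lambda>x. (w x)\<^sup>2) has_integral 0) (cbox 0 (2*pi))"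
    unfolding I_def by (metis box_real(2) integrable_continuous_interval integrable_integral continuous_on_power cw)
  moreover have "continuous_on (cbox 0 (2*pi)) (\<lambda>x. (w x)\<^sup>2)" by (intro continuous_intros cw)
  ultimately have z: "(w x)\<^sup>2 = 0" if "x \<in> cbox 0 (2*pi)" for x
    using that pi_gt_zero by (intro has_integral_0_cbox_imp_0[of 0 "2*pi" "\<lambda>x. (w x)\<^sup>2"]) (simp_all add: box_real not_le del: pi_gt_zero)
  have "w x = F (cis x)" by (simp add: F)
  also have "cis x = cis (Arg2pi (cis x))"
    using Arg2pi_eq[of "cis x"] by (simp add: cis_conv_exp)
  also have "F \<dots> = w (Arg2pi (cis x))" by (simp add: F)
  also have "\<dots> = 0" using z[of "Arg2pi (cis x)"] Arg2pi_ge_0 Arg2pi_lt_2pi by (simp add: less_imp_le)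
  finally show ?thesis .
qed


lemma fourier_coeff_derivative:
  fixes g g' :: "real \<Rightarrow> real"
  assumes d: "\<And>x. (g has_real_derivative g' x) (at x)" and c': "continuous_on UNIV g'"
    and per: "\<And>x. g (x + 2*pi) = g x"
  shows "fourier_cos_coeff g' n = real n * fourier_sin_coeff g n"
    and "fourier_sin_coeff g' n = - real n * fourier_cos_coeff g n"
proof -
  have c: "continuous_on UNIV g" using d by (meson DERIV_continuous_on has_field_derivative_at_within)
  have p: "g (2*pi) = g 0" using per[of 0] by simp
  have ci: "(\<lambda>x. g' x * cos (real n * x)) integrable_on {0..2*pi}" "(\<lambda>x. g' x * sin (real n * x)) integrable_on {0..2*pi}"
     "(\<lambda>x. g x * cos (real n * x)) integrable_on {0..2*pi}" "(\<lambda>x. g x * sin (real n * x)) integrable_on {0..2*pi}"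
    by (intro integrable_continuous_interval continuous_intros continuous_on_subset[OF c] continuous_on_subset[OF c'] subset_UNIV)+
  have "((\<lambda>x. g' x * cos (real n * x) - real n * (g x * sin (real n * x))) has_integral 0) {0..2*pi}"
    by (rule has_integral_periodic_derivative[where G = "\<lambda>x. g x * cos (real n * x)"])
       (use p cos_int_2pin[of "int n"] sin_int_2pin[of "int n"] in \<open>auto intro!: derivative_eq_intros d simp: mult_ac\<close>)
  then have "integral {0..2*pi} (\<lambda>x. g' x * cos (real n * x)) = real n * integral {0..2*pi} (\<lambda>x. g x * sin (real n * x))"
    using ci by (simp add: has_integral_iff integral_diff integrable_on_mult_right)
  then show "fourier_cos_coeff g' n = real n * fourier_sin_coeff g n"
    by (simp add: fourier_coeff_integral c c')
  have "((\<lambda>x. g' x * sin (real n * x) + real n * (g x * cos (real n * x))) has_integral 0) {0..2*pi}"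
    by (rule has_integral_periodic_derivative[where G = "\<lambda>x. g x * sin (real n * x)"])
       (use p cos_int_2pin[of "int n"] sin_int_2pin[of "int n"] in \<open>auto intro!: derivative_eq_intros d simp: mult_ac\<close>)
  then have "integral {0..2*pi} (\<lambda>x. g' x * sin (real n * x)) = - real n * integral {0..2*pi} (\<lambda>x. g x * cos (real n * x))"
    using ci by (simp add: has_integral_iff integral_add integrable_on_mult_right)
  then have "pi * fourier_sin_coeff g' n = pi * (- real n * fourier_cos_coeff g n)"
    by (simp add: fourier_coeff_integral c c')
  then show "fourier_sin_coeff g' n = - real n * fourier_cos_coeff g n"
    by (simp only: mult_cancel_left) simp
qed

text \<open>Subtracting one more harmonic from the remainder keeps all higher coefficients and lowers the
  square integral by exactly the contribution of that harmonic.\<close>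
lemma bessel_inequality:
  fixes g :: "real \<Rightarrow> real"
  assumes c: "continuous_on UNIV g"
  shows "pi * (\<Sum>k=1..N. (fourier_cos_coeff g k)\<^sup>2 + (fourier_sin_coeff g k)\<^sup>2)
           \<le> integral {0..2*pi} (\<lambda>x. (g x)\<^sup>2)"
proof -
  define a b where "a = fourier_cos_coeff g" and "b = fourier_sin_coeff g"
  define r where "r N x = g x - (\<Sum>k=1..N. a k * cos (real k * x) + b k * sin (real k * x))" for N x
  have cr: "continuous_on S (r N)" for S N
    unfolding r_def by (intro continuous_intros continuous_on_subset[OF c]) auto
  have int: "h integrable_on {0..2*pi}" if "continuous_on {0..2*pi} h" for h :: "real \<Rightarrow> real"
    using that by (rule integrable_continuous_interval)
  have rS: "r (Suc N) x = r N x - a (Suc N) * cos (real (Suc N) * x) - b (Suc N) * sin (real (Suc N) * x)" for N x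
    by (simp add: r_def)
  have coef: "integral {0..2*pi} (\<lambda>x. r N x * cos (real m * x)) = pi * a m \<and>
       integral {0..2*pi} (\<lambda>x. r N x * sin (real m * x)) = pi * b m" if "m > N" for m N
    using that
  proof (induction N)
    case 0
    then show ?case using fourier_coeff_integral[OF c] by (simp add: r_def a_def b_def)
  next
    case (Suc N)
    let ?K = "Suc N"
    have "integral {0..2*pi} (\<lambda>x. r ?K x * cos (real m * x)) =
       integral {0..2*pi} (\<lambda>x. r N x * cos (real m * x)
         - a ?K * (cos (real ?K * x) * cos (real m * x)) - b ?K * (sin (real ?K * x) * cos (real m * x)))"
      by (simp add: rS algebra_simps)
    also have "\<dots> = pi * a m"
      using Suc trig_orthogonality[of ?K m]
      by (simp add: integral_diff int continuous_intros cr del: of_nat_Suc)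
    finally have 1: "integral {0..2*pi} (\<lambda>x. r ?K x * cos (real m * x)) = pi * a m" .
    have "integral {0..2*pi} (\<lambda>x. r ?K x * sin (real m * x)) =
       integral {0..2*pi} (\<lambda>x. r N x * sin (real m * x)
         - a ?K * (cos (real ?K * x) * sin (real m * x)) - b ?K * (sin (real ?K * x) * sin (real m * x)))"
      by (simp add: rS algebra_simps)
    also have "\<dots> = pi * b m"
      using Suc trig_orthogonality[of ?K m]
      by (simp add: integral_diff int continuous_intros cr del: of_nat_Suc)
    finally show ?case using 1 by simp
  qed
  have sq: "integral {0..2*pi} (\<lambda>x. (r N x)\<^sup>2) = integral {0..2*pi} (\<lambda>x. (g x)\<^sup>2) - pi * (\<Sum>k=1..N. (a k)\<^sup>2 + (b k)\<^sup>2)" for N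
  proof (induction N)
    case 0 then show ?case by (simp add: r_def)
  next
    case (Suc N)
    let ?K = "Suc N"
    let ?c = "\<lambda>x. cos (real ?K * x)" and ?s = "\<lambda>x. sin (real ?K * x)"
    have "integral {0..2*pi} (\<lambda>x. (r ?K x)\<^sup>2) =
       integral {0..2*pi} (\<lambda>x. (r N x)\<^sup>2 - (2 * a ?K) * (r N x * ?c x) - (2 * b ?K) * (r N x * ?s x)
         + (a ?K)\<^sup>2 * (?c x * ?c x) + (b ?K)\<^sup>2 * (?s x * ?s x) + (2 * a ?K * b ?K) * (?c x * ?s x))"
      unfolding rS by (intro arg_cong[where f = "integral _"] ext) (simp only: power2_eq_square, algebra)
    also have "\<dots> = integral {0..2*pi} (\<lambda>x. (r N x)\<^sup>2) - 2 * a ?K * (pi * a ?K) - 2 * b ?K * (pi * b ?K)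
         + (a ?K)\<^sup>2 * pi + (b ?K)\<^sup>2 * pi"
      using coef[of N ?K] trig_orthogonality[of ?K ?K]
      by (simp add: integral_diff integral_add int continuous_intros cr del: of_nat_Suc)
    finally show ?case using Suc by (simp add: algebra_simps power2_eq_square)
  qed
  have "integral {0..2*pi} (\<lambda>x. (r N x)\<^sup>2) \<ge> 0"
    by (intro integral_nonneg int continuous_intros cr) auto
  then show ?thesis unfolding sq a_def b_def by simp
qed

lemma bessel_summable:
  fixes g :: "real \<Rightarrow> real"
  assumes c: "continuous_on UNIV g"
  shows "summable (\<lambda>k. (fourier_cos_coeff g k)\<^sup>2 + (fourier_sin_coeff g k)\<^sup>2)"
proof -
  have "summable (\<lambda>k. (fourier_cos_coeff g (Suc k))\<^sup>2 + (fourier_sin_coeff g (Suc k))\<^sup>2)"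
  proof (rule summableI_nonneg_bounded[where x = "integral {0..2*pi} (\<lambda>x. (g x)\<^sup>2) / pi"])
    fix n
    show "(\<Sum>k<n. (fourier_cos_coeff g (Suc k))\<^sup>2 + (fourier_sin_coeff g (Suc k))\<^sup>2) \<le> integral {0..2*pi} (\<lambda>x. (g x)\<^sup>2) / pi"
      using bessel_inequality[OF c, of n]
      by (simp add: sum.atLeast_Suc_atMost_Suc_shift sum.atLeast1_atMost_eq field_simps)
  qed auto
  then show ?thesis by (subst summable_Suc_iff[symmetric])
qed


lemma uniform_series_integral:
  fixes T :: "nat \<Rightarrow> real \<Rightarrow> real"
  assumes u: "uniform_limit {a..b} (\<lambda>N x. \<Sum>k<N. T k x) S sequentially"
    and cT: "\<And>k. continuous_on {a..b} (T k)" and ch: "continuous_on {a..b} h"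
  shows "(\<lambda>k. integral {a..b} (\<lambda>x. T k x * h x)) sums integral {a..b} (\<lambda>x. S x * h x)"
proof -
  have cp: "continuous_on {a..b} (\<lambda>x. \<Sum>k<N. T k x)" for N by (intro continuous_intros cT)
  have cS: "continuous_on {a..b} S" by (rule uniform_limit_theorem[OF _ u]) (auto intro!: always_eventually cp)
  have "uniform_limit {a..b} (\<lambda>N x. (\<Sum>k<N. T k x) * h x) (\<lambda>x. S x * h x) sequentially"
    by (intro uniform_lim_mult u uniform_limit_const compact_imp_bounded compact_continuous_image cS ch compact_Icc)
  then obtain I J where IJ: "\<And>n. ((\<lambda>x. (\<Sum>k<n. T k x) * h x) has_integral I n) {a..b}"
      "((\<lambda>x. S x * h x) has_integral J) {a..b}" "I \<longlonglongrightarrow> J"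
    by (rule uniform_limit_integral) (auto intro!: continuous_intros cp ch cT)
  have "I n = (\<Sum>k<n. integral {a..b} (\<lambda>x. T k x * h x))" for n
  proof -
    have "I n = integral {a..b} (\<lambda>x. \<Sum>k<n. T k x * h x)"
      using IJ(1)[of n] by (simp add: has_integral_iff sum_distrib_right)
    also have "\<dots> = (\<Sum>k<n. integral {a..b} (\<lambda>x. T k x * h x))"
      by (intro integral_sum integrable_continuous_interval continuous_intros cT ch) auto
    finally show ?thesis .
  qed
  moreover have "J = integral {a..b} (\<lambda>x. S x * h x)" using IJ(2) by (simp add: has_integral_iff)
  ultimately show ?thesis using IJ(3) unfolding sums_def by presburger
qed

definition fourier_term :: "(real \<Rightarrow> real) \<Rightarrow> nat \<Rightarrow> real \<Rightarrow> real" where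
  "fourier_term g k x = fourier_cos_coeff g k * cos (real k * x) + fourier_sin_coeff g k * sin (real k * x)"

lemma continuous_on_fourier_term [continuous_intros]: "continuous_on A (fourier_term g k)"
  unfolding fourier_term_def by (intro continuous_intros)

text \<open>The coefficients of the second derivative are bounded by Bessel's inequality, so those of \<open>p\<close>
  decay like \<open>1 / k\<^sup>2\<close> and the series converges uniformly. Its sum has the same coefficients as \<open>p\<close>,
  hence equals \<open>p\<close> by completeness.\<close>
lemma fourier_series_uniform:
  fixes p p1 p2 :: "real \<Rightarrow> real"
  assumes d1: "\<And>x. (p has_real_derivative p1 x) (at x)" and d2: "\<And>x. (p1 has_real_derivative p2 x) (at x)"
    and c2: "continuous_on UNIV p2" and per: "\<And>x. p (x + 2*pi) = p x" and per1: "\<And>x. p1 (x + 2*pi) = p1 x"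
  shows "uniform_limit UNIV (\<lambda>N x. \<Sum>k<N. fourier_term p (Suc k) x) (\<lambda>x. p x - fourier_cos_coeff p 0 / 2) sequentially"
proof -
  let ?a = "fourier_cos_coeff p" and ?b = "fourier_sin_coeff p"
  have c: "continuous_on UNIV p" and c1: "continuous_on UNIV p1"
    using d1 d2 by (meson DERIV_continuous_on has_field_derivative_at_within)+
  have coef2: "fourier_cos_coeff p2 k = - (real k)\<^sup>2 * ?a k" "fourier_sin_coeff p2 k = - (real k)\<^sup>2 * ?b k" for k
    using fourier_coeff_derivative[OF d1 c1 per, of k] fourier_coeff_derivative[OF d2 c2 per1, of k]
    by (simp_all add: power2_eq_square)
  \<comment> \<open>The summand 1 makes \<open>B \<ge> 1\<close>, so that \<open>y\<^sup>2 \<le> B\<close> implies \<open>\<bar>y\<bar> \<le> B\<close>.\<close>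
  define B where "B = 1 + integral {0..2*pi} (\<lambda>x. (p2 x)\<^sup>2) / pi"
  have B: "(fourier_cos_coeff p2 (Suc k))\<^sup>2 + (fourier_sin_coeff p2 (Suc k))\<^sup>2 \<le> B" for k
  proof -
    have "(fourier_cos_coeff p2 (Suc k))\<^sup>2 + (fourier_sin_coeff p2 (Suc k))\<^sup>2
        \<le> (\<Sum>k=1..Suc k. (fourier_cos_coeff p2 k)\<^sup>2 + (fourier_sin_coeff p2 k)\<^sup>2)"
      by (rule member_le_sum) auto
    also have "\<dots> \<le> integral {0..2*pi} (\<lambda>x. (p2 x)\<^sup>2) / pi"
      using bessel_inequality[OF c2, of "Suc k"] by (subst pos_le_divide_eq) (simp_all only: pi_gt_zero mult.commute)
    finally show ?thesis by (simp add: B_def)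
  qed
  have "B \<ge> 1" unfolding B_def
    by (simp add: integral_nonneg integrable_continuous_interval continuous_intros continuous_on_subset[OF c2])
  have B': "\<bar>y\<bar> \<le> B" if "y\<^sup>2 \<le> B" for y
  proof -
    have "B * 1 \<le> B * B" using \<open>B \<ge> 1\<close> by (intro mult_left_mono) auto
    with that have "\<bar>y\<bar>\<^sup>2 \<le> B * B" by simp
    then show ?thesis using \<open>B \<ge> 1\<close> abs_le_square_iff[of y B] by (simp add: power2_eq_square)
  qed
  have bound: "\<bar>?a (Suc k)\<bar> \<le> B / (real (Suc k))\<^sup>2" "\<bar>?b (Suc k)\<bar> \<le> B / (real (Suc k))\<^sup>2" for k
  proof -
    have "(fourier_cos_coeff p2 (Suc k))\<^sup>2 \<le> B" "(fourier_sin_coeff p2 (Suc k))\<^sup>2 \<le> B"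
      using B[of k] zero_le_power2[of "fourier_sin_coeff p2 (Suc k)"] zero_le_power2[of "fourier_cos_coeff p2 (Suc k)"] by linarith+
    from this[THEN B'] show "\<bar>?a (Suc k)\<bar> \<le> B / (real (Suc k))\<^sup>2" "\<bar>?b (Suc k)\<bar> \<le> B / (real (Suc k))\<^sup>2"
      unfolding coef2 by (simp_all add: abs_mult field_simps)
  qed
  have tb: "norm (fourier_term p (Suc k) x) \<le> 2 * B * (1 / (real (Suc k))\<^sup>2)" for k x
  proof -
    have "\<bar>fourier_term p (Suc k) x\<bar> \<le> \<bar>?a (Suc k)\<bar> * 1 + \<bar>?b (Suc k)\<bar> * 1"
      unfolding fourier_term_def
      by (rule order.trans[OF abs_triangle_ineq]) (unfold abs_mult, intro add_mono mult_left_mono, auto)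
    with bound[of k] show ?thesis by simp
  qed
  have sm: "summable (\<lambda>k. 2 * B * (1 / (real (Suc k))\<^sup>2))"
    by (intro summable_mult) (use inverse_squares_sums in \<open>auto simp: sums_iff add.commute\<close>)
  define S where "S x = (\<Sum>k. fourier_term p (Suc k) x)" for x
  have u: "uniform_limit X (\<lambda>N x. \<Sum>k<N. fourier_term p (Suc k) x) S sequentially" for X
    unfolding S_def by (rule Weierstrass_m_test[OF tb sm])
  have cS: "continuous_on UNIV S"
    by (rule uniform_limit_theorem[OF _ u]) (auto intro!: always_eventually continuous_intros)
  have csub: "continuous_on A S" "continuous_on A p" for A using cS c continuous_on_subset by blast+
  have perS: "S (x + 2*pi) = S x" for x
  proof -
    have "cos (real k * (x + 2*pi)) = cos (real k * x)" "sin (real k * (x + 2*pi)) = sin (real k * x)" for k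
      using cos.plus_of_nat[of "real k * x" k] sin.plus_of_nat[of "real k * x" k] by (simp_all add: algebra_simps)
    then show ?thesis by (simp add: S_def fourier_term_def del: of_nat_Suc)
  qed
  have Sc: "fourier_cos_coeff S n = (if n = 0 then 0 else ?a n)"
       "fourier_sin_coeff S n = (if n = 0 then 0 else ?b n)" for n
  proof -
    have int: "h integrable_on {0..2*pi}" if "continuous_on {0..2*pi} h" for h :: "real \<Rightarrow> real"
      using that by (rule integrable_continuous_interval)
    have e: "integral {0..2*pi} (\<lambda>x. fourier_term p (Suc k) x * cos (real n * x)) = (if Suc k = n then pi * ?a n else 0)"
       "integral {0..2*pi} (\<lambda>x. fourier_term p (Suc k) x * sin (real n * x)) = (if Suc k = n then pi * ?b n else 0)" for k
      unfolding fourier_term_def ring_distribs mult.assoc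
      using trig_orthogonality[of "Suc k" n]
      by (auto simp: integral_add int continuous_intros simp del: of_nat_Suc)
    have z: "(\<lambda>k. if Suc k = n then y else 0) sums (if n = 0 then 0 else y)" for y :: real
      using sums_single[of "n - 1" "\<lambda>_. y"] by (cases n) simp_all
    have "(\<lambda>k. integral {0..2*pi} (\<lambda>x. fourier_term p (Suc k) x * cos (real n * x))) sums
        integral {0..2*pi} (\<lambda>x. S x * cos (real n * x))"
      by (rule uniform_series_integral[OF u]) (intro continuous_intros)+
    then have "integral {0..2*pi} (\<lambda>x. S x * cos (real n * x)) = (if n = 0 then 0 else pi * ?a n)"
      unfolding e using z sums_unique2 by blast
    then show "fourier_cos_coeff S n = (if n = 0 then 0 else ?a n)"
      by (simp add: fourier_coeff_integral[OF cS] split: if_splits)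
    have "(\<lambda>k. integral {0..2*pi} (\<lambda>x. fourier_term p (Suc k) x * sin (real n * x))) sums
        integral {0..2*pi} (\<lambda>x. S x * sin (real n * x))"
      by (rule uniform_series_integral[OF u]) (intro continuous_intros)+
    then have "integral {0..2*pi} (\<lambda>x. S x * sin (real n * x)) = (if n = 0 then 0 else pi * ?b n)"
      unfolding e using z sums_unique2 by blast
    then show "fourier_sin_coeff S n = (if n = 0 then 0 else ?b n)"
      by (simp add: fourier_coeff_integral[OF cS] split: if_splits)
  qed
  define w where "w x = p x - ?a 0 / 2 - S x" for x
  have cw: "continuous_on A w" for A unfolding w_def by (intro continuous_intros csub)
  have "fourier_cos_coeff w n = 0 \<and> fourier_sin_coeff w n = 0" for n
  proof -
    have int: "h integrable_on {0..2*pi}" if "continuous_on {0..2*pi} h" for h :: "real \<Rightarrow> real"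
      using that by (rule integrable_continuous_interval)
    have "pi * fourier_cos_coeff w n = pi * ?a n - ?a 0 / 2 * (if n = 0 then 2*pi else 0) - pi * fourier_cos_coeff S n"
      using integral_cos_2pi[of "int n"]
      by (simp add: fourier_coeff_integral[symmetric] cw c cS w_def left_diff_distrib integral_diff int continuous_intros csub
            del: divide_const_simps)
    moreover have "pi * fourier_sin_coeff w n = pi * ?b n - pi * fourier_sin_coeff S n"
      using integral_sin_2pi[of "int n"]
      by (simp add: fourier_coeff_integral[symmetric] cw c cS w_def left_diff_distrib integral_diff int continuous_intros csub
            del: divide_const_simps)
    moreover have "?b 0 = 0" by (simp add: fourier_sin_coeff_def)
    ultimately show ?thesis by (auto simp: Sc split: if_splits)
  qed
  then have "w x = 0" for x
    by (intro continuous_periodic_zero_coeffs[OF cw]) (simp_all only: w_def per perS)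
  then have "S = (\<lambda>x. p x - ?a 0 / 2)" by (simp add: w_def fun_eq_iff)
  with u show ?thesis by simp
qed

section \<open>Correlation integrals\<close>

lemma fourier_coeff_shift:
  fixes q :: "real \<Rightarrow> real"
  assumes c: "continuous_on UNIV q" and per: "\<And>x. q (x + 2*pi) = q x"
  shows "integral {0..2*pi} (\<lambda>x. cos (real k * x) * q (x + d))
           = pi * (fourier_cos_coeff q k * cos (real k * d) + fourier_sin_coeff q k * sin (real k * d))"
    and "integral {0..2*pi} (\<lambda>x. sin (real k * x) * q (x + d))
           = pi * (fourier_sin_coeff q k * cos (real k * d) - fourier_cos_coeff q k * sin (real k * d))"
proof -
  have per_trig: "cos (real k * (x + 2*pi) - y) = cos (real k * x - y)" "sin (real k * (x + 2*pi) - y) = sin (real k * x - y)" for x y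
    using cos.plus_of_nat[of "real k * x - y" k] sin.plus_of_nat[of "real k * x - y" k] by (simp_all add: algebra_simps)
  have int: "h integrable_on {0..2*pi}" if "continuous_on {0..2*pi} h" for h :: "real \<Rightarrow> real"
    using that by (rule integrable_continuous_interval)
  have cq: "continuous_on A q" for A using c continuous_on_subset by blast
  have "integral {0..2*pi} (\<lambda>x. cos (real k * x) * q (x + d)) = integral {0..2*pi} (\<lambda>x. cos (real k * x - real k * d) * q x)"
  proof -
    have "integral {0..2*pi} (\<lambda>x. cos (real k * (x + d) - real k * d) * q (x + d)) = integral {0..2*pi} (\<lambda>x. cos (real k * x - real k * d) * q x)"
      by (rule integral_periodic_shift) (intro continuous_intros cq, simp only: per per_trig, simp)
    then show ?thesis by (simp add: ring_distribs)
  qed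
  also have "\<dots> = integral {0..2*pi} (\<lambda>x. cos (real k * d) * (q x * cos (real k * x)) + sin (real k * d) * (q x * sin (real k * x)))"
    by (simp add: cos_diff algebra_simps)
  also have "\<dots> = cos (real k * d) * integral {0..2*pi} (\<lambda>x. q x * cos (real k * x))
      + sin (real k * d) * integral {0..2*pi} (\<lambda>x. q x * sin (real k * x))"
    by (simp add: integral_add int continuous_intros cq)
  also have "\<dots> = pi * (fourier_cos_coeff q k * cos (real k * d) + fourier_sin_coeff q k * sin (real k * d))"
    unfolding fourier_coeff_integral[OF c] by (simp add: algebra_simps)
  finally show "integral {0..2*pi} (\<lambda>x. cos (real k * x) * q (x + d))
           = pi * (fourier_cos_coeff q k * cos (real k * d) + fourier_sin_coeff q k * sin (real k * d))" .
  have "integral {0..2*pi} (\<lambda>x. sin (real k * x) * q (x + d)) = integral {0..2*pi} (\<lambda>x. sin (real k * x - real k * d) * q x)"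
  proof -
    have "integral {0..2*pi} (\<lambda>x. sin (real k * (x + d) - real k * d) * q (x + d)) = integral {0..2*pi} (\<lambda>x. sin (real k * x - real k * d) * q x)"
      by (rule integral_periodic_shift) (intro continuous_intros cq, simp only: per per_trig, simp)
    then show ?thesis by (simp add: ring_distribs)
  qed
  also have "\<dots> = integral {0..2*pi} (\<lambda>x. cos (real k * d) * (q x * sin (real k * x)) - sin (real k * d) * (q x * cos (real k * x)))"
    by (simp add: sin_diff algebra_simps)
  also have "\<dots> = cos (real k * d) * integral {0..2*pi} (\<lambda>x. q x * sin (real k * x))
      - sin (real k * d) * integral {0..2*pi} (\<lambda>x. q x * cos (real k * x))"
    by (simp add: integral_diff int continuous_intros cq)
  also have "\<dots> = pi * (fourier_sin_coeff q k * cos (real k * d) - fourier_cos_coeff q k * sin (real k * d))"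
    unfolding fourier_coeff_integral[OF c] by (simp add: algebra_simps)
  finally show "integral {0..2*pi} (\<lambda>x. sin (real k * x) * q (x + d))
           = pi * (fourier_sin_coeff q k * cos (real k * d) - fourier_cos_coeff q k * sin (real k * d))" .
qed

text \<open>A shifted form of Parseval's identity. The uniformly convergent series of the smooth factor
  \<open>p\<close> is integrated term by term against \<open>q\<close>, and the shift by \<open>d\<close> rotates each pair of coefficients
  of \<open>q\<close> by the angle \<open>k d\<close>.\<close>
lemma correlation_fourier:
  fixes p p1 p2 q :: "real \<Rightarrow> real"
  assumes d1: "\<And>x. (p has_real_derivative p1 x) (at x)" and d2: "\<And>x. (p1 has_real_derivative p2 x) (at x)"
    and c2: "continuous_on UNIV p2" and per: "\<And>x. p (x + 2*pi) = p x" and per1: "\<And>x. p1 (x + 2*pi) = p1 x"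
    and cq: "continuous_on UNIV q" and perq: "\<And>x. q (x + 2*pi) = q x"
  defines "a \<equiv> fourier_cos_coeff p" and "b \<equiv> fourier_sin_coeff p"
    and "A \<equiv> fourier_cos_coeff q" and "B \<equiv> fourier_sin_coeff q"
  shows "(\<lambda>j. pi * ((a (Suc j) * A (Suc j) + b (Suc j) * B (Suc j)) * cos (real (Suc j) * d)
               + (a (Suc j) * B (Suc j) - b (Suc j) * A (Suc j)) * sin (real (Suc j) * d)))
     sums (integral {0..2*pi} (\<lambda>x. p x * q (x + d)) - pi * a 0 * A 0 / 2)"
proof -
  have c: "continuous_on UNIV p"
    using d1 by (meson DERIV_continuous_on has_field_derivative_at_within)
  have cc: "continuous_on X p" "continuous_on X (\<lambda>x. q (x + d))" for X
    by (intro continuous_on_subset[OF c] continuous_on_compose2[OF cq] continuous_intros subset_UNIV)+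
  have int: "h integrable_on {0..2*pi}" if "continuous_on {0..2*pi} h" for h :: "real \<Rightarrow> real"
    using that by (rule integrable_continuous_interval)
  have u: "uniform_limit {0..2*pi} (\<lambda>N x. \<Sum>k<N. fourier_term p (Suc k) x) (\<lambda>x. p x - fourier_cos_coeff p 0 / 2) sequentially"
    by (rule uniform_limit_on_subset[OF fourier_series_uniform[OF d1 d2 c2 per per1] subset_UNIV])
  have "(\<lambda>k. integral {0..2*pi} (\<lambda>x. fourier_term p (Suc k) x * q (x + d))) sums
      integral {0..2*pi} (\<lambda>x. (p x - a 0 / 2) * q (x + d))"
    unfolding a_def by (rule uniform_series_integral[OF u]) (intro continuous_intros cc)+
  moreover have "integral {0..2*pi} (\<lambda>x. fourier_term p (Suc j) x * q (x + d)) =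
     pi * ((a (Suc j) * A (Suc j) + b (Suc j) * B (Suc j)) * cos (real (Suc j) * d)
               + (a (Suc j) * B (Suc j) - b (Suc j) * A (Suc j)) * sin (real (Suc j) * d))" for j
  proof -
    have "integral {0..2*pi} (\<lambda>x. fourier_term p (Suc j) x * q (x + d)) =
      a (Suc j) * integral {0..2*pi} (\<lambda>x. cos (real (Suc j) * x) * q (x + d)) + b (Suc j) * integral {0..2*pi} (\<lambda>x. sin (real (Suc j) * x) * q (x + d))"
      unfolding fourier_term_def ring_distribs a_def b_def mult.assoc
      by (simp add: integral_add int continuous_intros cc del: of_nat_Suc)
    then show ?thesis
      unfolding fourier_coeff_shift[OF cq perq] A_def B_def by (simp add: algebra_simps del: of_nat_Suc)
  qed
  moreover have "integral {0..2*pi} (\<lambda>x. (p x - a 0 / 2) * q (x + d)) = integral {0..2*pi} (\<lambda>x. p x * q (x + d)) - pi * a 0 * A 0 / 2"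
    using fourier_coeff_shift(1)[OF cq perq, of 0 d]
    by (simp add: left_diff_distrib integral_diff int continuous_intros cc A_def)
  ultimately show ?thesis by simp
qed

section \<open>A comparison principle\<close>

text \<open>A function with \<open>g 0 = g' 0 = 0\<close> is the convolution of \<open>g'' + g\<close> with the sine, which is
  nonnegative on \<open>[0, \<pi>]\<close>; the auxiliary function in the proof is the difference of the two
  convolutions, for \<open>g'' + g\<close> and for the constant \<open>m\<close>, up to the limit of integration. For \<open>p\<close> itself the
  principle controls the tangent segments, and for single harmonics it bounds the kernels \<^const>\<open>h_fun\<close>.\<close>
lemma sine_comparison:
  fixes g g1 g2 :: "real \<Rightarrow> real"
  assumes d1: "\<And>s. (g has_real_derivative g1 s) (at s)" and d2: "\<And>s. (g1 has_real_derivative g2 s) (at s)"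
    and 0: "g 0 = 0" "g1 0 = 0" and d: "0 \<le> d" "d \<le> pi"
    and m: "\<And>s. m \<le> g2 s + g s"
  shows "m * (1 - cos d) \<le> g d"
proof -
  define F where "F s = g1 s * sin (d - s) + g s * cos (d - s) - m * cos (d - s)" for s
  have "F 0 \<le> F d"
  proof (rule DERIV_nonneg_imp_nondecreasing[OF d(1)])
    fix s assume s: "0 \<le> s" "s \<le> d"
    have "(F has_real_derivative (g2 s + g s - m) * sin (d - s)) (at s)"
      unfolding F_def by (auto intro!: derivative_eq_intros d1 d2 simp: algebra_simps)
    moreover have "(g2 s + g s - m) * sin (d - s) \<ge> 0"
      using m[of s] s d by (intro mult_nonneg_nonneg sin_ge_zero) auto
    ultimately show "\<exists>y. (F has_real_derivative y) (at s) \<and> 0 \<le> y" by blast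
  qed
  then show ?thesis using 0 by (simp add: F_def algebra_simps)
qed

lemma sine_comparison_abs:
  fixes g g1 g2 :: "real \<Rightarrow> real"
  assumes d1: "\<And>s. (g has_real_derivative g1 s) (at s)" and d2: "\<And>s. (g1 has_real_derivative g2 s) (at s)"
    and 0: "g 0 = 0" "g1 0 = 0" and d: "0 \<le> d" "d \<le> pi"
    and M: "\<And>s. \<bar>g2 s + g s\<bar> \<le> M"
  shows "\<bar>g d\<bar> \<le> M * (1 - cos d)"
proof -
  have "- M * (1 - cos d) \<le> g d"
    using M by (intro sine_comparison[OF d1 d2 0 d]) (smt (verit))
  moreover have "- M * (1 - cos d) \<le> - g d"
    using M 0 by (intro sine_comparison[where g = "\<lambda>s. - g s" and ?g1.0 = "\<lambda>s. - g1 s" and ?g2.0 = "\<lambda>s. - g2 s"] d)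
      (auto intro!: derivative_eq_intros d1 d2, smt (verit))
  ultimately show ?thesis by (simp add: abs_le_iff)
qed

lemma cos_nat_pi_minus: "cos (real k * (pi - x)) = (-1) ^ k * cos (real k * x)"
  and sin_nat_pi_minus: "sin (real k * (pi - x)) = (-1) ^ (k + 1) * sin (real k * x)"
  by (simp_all add: right_diff_distrib cos_diff sin_diff)

text \<open>In terms of the angle \<open>\<pi> - \<omega>\<close> between the outer normals, the sign \<open>(-1) ^ (k + 1)\<close>
  disappears.\<close>
lemma h_fun_alt:
  "h_fun k \<omega> = (1 + (cos \<omega>)\<^sup>2) * cos (real k * (pi - \<omega>)) + 2 * cos \<omega>
     - 2 * real k * sin \<omega> * cos \<omega> * sin (real k * (pi - \<omega>)) - (real k)\<^sup>2 * (sin \<omega>)\<^sup>2 * cos (real k * (pi - \<omega>))"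
  unfolding h_fun_def cos_nat_pi_minus sin_nat_pi_minus by (simp add: algebra_simps)

lemma h_fun_1: "h_fun (Suc 0) \<omega> = 0"
proof -
  define s c where "s = sin \<omega>" and "c = cos \<omega>"
  have "s\<^sup>2 + c\<^sup>2 = 1" by (simp add: s_def c_def)
  moreover have "h_fun (Suc 0) \<omega> = 2 * c + (- (c * (1 + c\<^sup>2)) - 2 * s * s * c + c * s\<^sup>2)"
    by (simp add: h_fun_def s_def c_def)
  ultimately show ?thesis by algebra
qed

text \<open>With \<open>d = \<pi> - \<omega>\<close>, \<open>x = cos (k d) - cos d\<close> and \<open>y = sin (k d) - k sin d\<close>, the kernel is the
  real part of \<open>(x + \<i> y)\<^sup>2 exp (- \<i> k d)\<close>, so its modulus is at most \<open>x\<^sup>2 + y\<^sup>2\<close>. The functions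
  \<open>x\<close> and \<open>y\<close> vanish to second order at \<open>d = 0\<close>, and the comparison principle bounds both by
  \<open>(k\<^sup>2 - 1) (1 + cos \<omega>)\<close>. The factor \<open>(1 + cos \<omega>)\<^sup>2\<close> is what makes the singularity of
  \<open>1 / sin\<^sup>3\<close> at \<open>\<pi>\<close> harmless.\<close>
lemma h_fun_bound:
  assumes "0 \<le> \<omega>" "\<omega> \<le> pi" "k > 0"
  shows "\<bar>h_fun k \<omega>\<bar> \<le> 2 * ((real k)\<^sup>2 - 1)\<^sup>2 * (1 + cos \<omega>)\<^sup>2"
proof -
  define d where "d = pi - \<omega>"
  define K where "K = real k"
  have d: "0 \<le> d" "d \<le> pi" "cos \<omega> = - cos d" "sin \<omega> = sin d" using assms by (auto simp: d_def)
  have K: "K \<ge> 1" using assms by (simp add: K_def)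
  then have K1: "K\<^sup>2 - 1 \<ge> 0" by simp
  define x y where "x = cos (K * d) - cos d" and "y = sin (K * d) - K * sin d"
  have x: "\<bar>x\<bar> \<le> (K\<^sup>2 - 1) * (1 - cos d)" unfolding x_def
  proof (rule sine_comparison_abs[where g = "\<lambda>s. cos (K * s) - cos s" and ?g1.0 = "\<lambda>s. sin s - K * sin (K * s)"
        and ?g2.0 = "\<lambda>s. cos s - K\<^sup>2 * cos (K * s)"])
    fix s
    have "cos s - K\<^sup>2 * cos (K * s) + (cos (K * s) - cos s) = - (K\<^sup>2 - 1) * cos (K * s)" by (simp add: algebra_simps)
    also have "\<bar>\<dots>\<bar> \<le> (K\<^sup>2 - 1) * 1" unfolding abs_mult abs_minus_cancel using K1 by (intro mult_mono) auto
    finally show "\<bar>cos s - K\<^sup>2 * cos (K * s) + (cos (K * s) - cos s)\<bar> \<le> K\<^sup>2 - 1" by simp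
  qed (use d in \<open>auto intro!: derivative_eq_intros simp: power2_eq_square\<close>)
  have y: "\<bar>y\<bar> \<le> (K\<^sup>2 - 1) * (1 - cos d)" unfolding y_def
  proof (rule sine_comparison_abs[where g = "\<lambda>s. sin (K * s) - K * sin s" and ?g1.0 = "\<lambda>s. K * cos (K * s) - K * cos s"
        and ?g2.0 = "\<lambda>s. K * sin s - K\<^sup>2 * sin (K * s)"])
    fix s
    have "K * sin s - K\<^sup>2 * sin (K * s) + (sin (K * s) - K * sin s) = - (K\<^sup>2 - 1) * sin (K * s)" by (simp add: algebra_simps)
    also have "\<bar>\<dots>\<bar> \<le> (K\<^sup>2 - 1) * 1" unfolding abs_mult abs_minus_cancel using K1 by (intro mult_mono) auto
    finally show "\<bar>K * sin s - K\<^sup>2 * sin (K * s) + (sin (K * s) - K * sin s)\<bar> \<le> K\<^sup>2 - 1" by simp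
  qed (use d in \<open>auto intro!: derivative_eq_intros simp: power2_eq_square\<close>)
  define c s C S where "c = cos d" and "s = sin d" and "C = cos (K * d)" and "S = sin (K * d)"
  have C: "C\<^sup>2 + S\<^sup>2 = 1" "\<bar>C\<bar> \<le> 1" "\<bar>S\<bar> \<le> 1" by (simp_all add: C_def S_def)
  have "h_fun k \<omega> = (1 + c\<^sup>2) * C - 2 * c + 2 * K * s * c * S - K\<^sup>2 * s\<^sup>2 * C"
    unfolding h_fun_alt d(3,4) d_def[symmetric] K_def[symmetric] c_def s_def C_def S_def by (simp add: algebra_simps)
  also have "\<dots> = ((C - c)\<^sup>2 - (S - K * s)\<^sup>2) * C + 2 * (C - c) * (S - K * s) * S"
    using C(1) by algebra
  finally have h: "h_fun k \<omega> = (x\<^sup>2 - y\<^sup>2) * C + 2 * x * y * S" by (simp add: x_def y_def c_def s_def C_def S_def)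
  \<comment> \<open>the modulus of a complex number, with the second square its imaginary part\<close>
  have "(h_fun k \<omega>)\<^sup>2 + ((x\<^sup>2 - y\<^sup>2) * S - 2 * x * y * C)\<^sup>2 = (x\<^sup>2 + y\<^sup>2)\<^sup>2"
    unfolding h using C(1) by algebra
  then have "(h_fun k \<omega>)\<^sup>2 \<le> (x\<^sup>2 + y\<^sup>2)\<^sup>2" by (smt (verit) zero_le_power2)
  then have "\<bar>h_fun k \<omega>\<bar> \<le> x\<^sup>2 + y\<^sup>2" by (rule abs_le_square_iff[THEN iffD2, of _ "x\<^sup>2 + y\<^sup>2", simplified])
  also have "x\<^sup>2 \<le> ((K\<^sup>2 - 1) * (1 - cos d))\<^sup>2" using x by (simp add: abs_le_square_iff[symmetric])
  also have "y\<^sup>2 \<le> ((K\<^sup>2 - 1) * (1 - cos d))\<^sup>2" using y by (simp add: abs_le_square_iff[symmetric])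
  finally show ?thesis by (simp add: d(3) K_def power_mult_distrib mult_ac)
qed

section \<open>Smooth support functions\<close>

text \<open>The sum \<open>p + p''\<close> is the radius of curvature of the boundary at the point with outer normal
  angle \<open>\<phi>\<close>; its positivity expresses strict convexity.\<close>
locale smooth_support =
  fixes p p1 p2 :: "real \<Rightarrow> real"
  assumes p_deriv: "\<And>x. (p has_real_derivative p1 x) (at x)"
    and p1_deriv: "\<And>x. (p1 has_real_derivative p2 x) (at x)"
    and p2_cont: "continuous_on UNIV p2"
    and p_per: "\<And>x. p (x + 2*pi) = p x"
    and radius_pos: "\<And>x. p x + p2 x > 0"
begin

lemma p1_per: "p1 (x + 2*pi) = p1 x"
  by (rule periodic_derivative[OF p_deriv p_per])

lemma p2_per: "p2 (x + 2*pi) = p2 x"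
  by (rule periodic_derivative[OF p1_deriv p1_per])

lemma continuous_p: "continuous_on S p" and continuous_p1: "continuous_on S p1"
  using p_deriv p1_deriv by (meson DERIV_continuous_on has_field_derivative_at_within)+

lemma continuous_p2: "continuous_on S p2"
  using p2_cont continuous_on_subset by blast

lemmas continuous_p_shift [continuous_intros] =
  continuous_on_compose2[OF continuous_p _ subset_UNIV] continuous_on_compose2[OF continuous_p1 _ subset_UNIV]
  continuous_on_compose2[OF continuous_p2 _ subset_UNIV]

lemma p_deriv_chain [derivative_intros]:
  assumes "(f has_real_derivative f') (at x within S)"
  shows "((\<lambda>x. p (f x)) has_real_derivative p1 (f x) * f') (at x within S)"
    and "((\<lambda>x. p1 (f x)) has_real_derivative p2 (f x) * f') (at x within S)"
  using DERIV_chain2[OF p_deriv assms] DERIV_chain2[OF p1_deriv assms] by auto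

lemma radius_bounds:
  obtains m M where "0 < m" "\<And>x. m \<le> p2 x + p x" "\<And>x. \<bar>p2 x + p x\<bar> \<le> M"
proof -
  let ?r = "\<lambda>x. p2 x + p x"
  have c: "continuous_on {0..2*pi} ?r" by (intro continuous_intros)
  have ne: "{0..2*pi} \<noteq> {}" by simp
  obtain x0 where x0: "x0 \<in> {0..2*pi}" "\<And>y. y \<in> {0..2*pi} \<Longrightarrow> ?r x0 \<le> ?r y"
    using continuous_attains_inf[OF compact_Icc ne c] by blast
  obtain x1 where x1: "x1 \<in> {0..2*pi}" "\<And>y. y \<in> {0..2*pi} \<Longrightarrow> ?r y \<le> ?r x1"
    using continuous_attains_sup[OF compact_Icc ne c] by blast
  have red: "\<exists>y\<in>{0..2*pi}. ?r x = ?r y" for x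
  proof -
    obtain n :: int where "0 \<le> x + 2*pi * of_int n" "x + 2*pi * of_int n < 0 + 2*pi"
      using reduce_mod_period[of "2*pi" 0 x] by auto
    moreover have "?r (x + 2*pi * of_int n) = ?r x"
      by (rule periodic_add_int[where g = ?r]) (simp add: p_per p2_per)
    ultimately show ?thesis by (intro bexI[of _ "x + 2*pi * of_int n"]) auto
  qed
  show thesis
  proof
    show "0 < ?r x0" using radius_pos[of x0] by simp
    show "?r x0 \<le> ?r x" for x using red[of x] x0 by auto
    show "\<bar>?r x\<bar> \<le> ?r x1" for x using red[of x] x1 radius_pos[of x] by (auto simp: add.commute)
  qed
qed

text \<open>The tangents at the normal angles \<open>\<phi>\<close> and \<open>\<phi> + \<pi> - \<omega>\<close> meet under the visual angle \<open>\<omega>\<close>.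
  These are \<open>sin \<omega>\<close> times the lengths of the two segments from the crossing point to the points of
  contact. Multiplied by \<open>sin \<omega>\<close> they are defined and continuous for all angles.\<close>
definition seg1 :: "real \<Rightarrow> real \<Rightarrow> real" where
  "seg1 \<phi> \<omega> = p (\<phi> + pi - \<omega>) + p \<phi> * cos \<omega> - p1 \<phi> * sin \<omega>"

definition seg2 :: "real \<Rightarrow> real \<Rightarrow> real" where
  "seg2 \<phi> \<omega> = p \<phi> + p (\<phi> + pi - \<omega>) * cos \<omega> + p1 (\<phi> + pi - \<omega>) * sin \<omega>"

text \<open>The difference between \<open>p (x + d)\<close> and the support function of the point of contact at \<open>x\<close> vanishes
  to second order at \<open>d = 0\<close>. Its sum with its second derivative is the radius of curvature at
  \<open>x + d\<close>, so the comparison principle applies.\<close>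
lemma forward_bounds:
  assumes "0 \<le> d" "d \<le> pi"
  shows "(\<And>x. m \<le> p2 x + p x) \<Longrightarrow> m * (1 - cos d) \<le> p (x + d) - p x * cos d - p1 x * sin d"
    and "(\<And>x. \<bar>p2 x + p x\<bar> \<le> M) \<Longrightarrow> \<bar>p (x + d) - p x * cos d - p1 x * sin d\<bar> \<le> M * (1 - cos d)"
proof -
  let ?g = "\<lambda>s. p (x + s) - p x * cos s - p1 x * sin s"
  let ?g1 = "\<lambda>s. p1 (x + s) + p x * sin s - p1 x * cos s"
  let ?g2 = "\<lambda>s. p2 (x + s) + p x * cos s + p1 x * sin s"
  have 1: "(?g has_real_derivative ?g1 s) (at s)" for s by (auto intro!: derivative_eq_intros)
  have 2: "(?g1 has_real_derivative ?g2 s) (at s)" for s by (auto intro!: derivative_eq_intros)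
  show "m * (1 - cos d) \<le> p (x + d) - p x * cos d - p1 x * sin d" if "\<And>x. m \<le> p2 x + p x"
    by (rule sine_comparison[OF 1 2 _ _ assms]) (use that in auto)
  show "\<bar>p (x + d) - p x * cos d - p1 x * sin d\<bar> \<le> M * (1 - cos d)" if "\<And>x. \<bar>p2 x + p x\<bar> \<le> M"
    by (rule sine_comparison_abs[OF 1 2 _ _ assms]) (use that in auto)
qed

lemma backward_bounds:
  assumes "0 \<le> d" "d \<le> pi"
  shows "(\<And>x. m \<le> p2 x + p x) \<Longrightarrow> m * (1 - cos d) \<le> p (x - d) - p x * cos d + p1 x * sin d"
    and "(\<And>x. \<bar>p2 x + p x\<bar> \<le> M) \<Longrightarrow> \<bar>p (x - d) - p x * cos d + p1 x * sin d\<bar> \<le> M * (1 - cos d)"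
proof -
  let ?g = "\<lambda>s. p (x - s) - p x * cos s + p1 x * sin s"
  let ?g1 = "\<lambda>s. - p1 (x - s) + p x * sin s + p1 x * cos s"
  let ?g2 = "\<lambda>s. p2 (x - s) + p x * cos s - p1 x * sin s"
  have 1: "(?g has_real_derivative ?g1 s) (at s)" for s by (auto intro!: derivative_eq_intros)
  have 2: "(?g1 has_real_derivative ?g2 s) (at s)" for s by (auto intro!: derivative_eq_intros)
  show "m * (1 - cos d) \<le> p (x - d) - p x * cos d + p1 x * sin d" if "\<And>x. m \<le> p2 x + p x"
    by (rule sine_comparison[OF 1 2 _ _ assms]) (use that in auto)
  show "\<bar>p (x - d) - p x * cos d + p1 x * sin d\<bar> \<le> M * (1 - cos d)" if "\<And>x. \<bar>p2 x + p x\<bar> \<le> M"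
    by (rule sine_comparison_abs[OF 1 2 _ _ assms]) (use that in auto)
qed

lemma seg_forward: "seg1 \<phi> \<omega> = p (\<phi> + (pi - \<omega>)) - p \<phi> * cos (pi - \<omega>) - p1 \<phi> * sin (pi - \<omega>)"
  and seg_backward: "seg2 \<phi> \<omega> = p ((\<phi> + pi - \<omega>) - (pi - \<omega>)) - p (\<phi> + pi - \<omega>) * cos (pi - \<omega>) + p1 (\<phi> + pi - \<omega>) * sin (pi - \<omega>)"
  by (simp_all add: seg1_def seg2_def algebra_simps)

lemma seg_pos:
  assumes "0 \<le> \<omega>" "\<omega> < pi"
  shows "seg1 \<phi> \<omega> > 0" "seg2 \<phi> \<omega> > 0"
proof -
  obtain m where m: "0 < m" "\<And>x. m \<le> p2 x + p x" using radius_bounds by metis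
  have "1 + cos \<omega> > 0" using cos_monotone_0_pi[of \<omega> pi] assms by simp
  then have "m * (1 - cos (pi - \<omega>)) > 0" using m by simp
  moreover have "m * (1 - cos (pi - \<omega>)) \<le> seg1 \<phi> \<omega>" "m * (1 - cos (pi - \<omega>)) \<le> seg2 \<phi> \<omega>"
    unfolding seg_forward seg_backward using assms m(2)
    by (intro forward_bounds(1) backward_bounds(1); simp)+
  ultimately show "seg1 \<phi> \<omega> > 0" "seg2 \<phi> \<omega> > 0" by linarith+
qed

lemma seg_bound:
  obtains M where "\<And>\<phi> \<omega>. 0 \<le> \<omega> \<Longrightarrow> \<omega> \<le> pi \<Longrightarrow> \<bar>seg1 \<phi> \<omega>\<bar> \<le> M * (1 + cos \<omega>)"
    "\<And>\<phi> \<omega>. 0 \<le> \<omega> \<Longrightarrow> \<omega> \<le> pi \<Longrightarrow> \<bar>seg2 \<phi> \<omega>\<bar> \<le> M * (1 + cos \<omega>)"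
proof -
  obtain M where M: "\<And>x. \<bar>p2 x + p x\<bar> \<le> M" using radius_bounds by metis
  have "\<bar>seg1 \<phi> \<omega>\<bar> \<le> M * (1 - cos (pi - \<omega>))" "\<bar>seg2 \<phi> \<omega>\<bar> \<le> M * (1 - cos (pi - \<omega>))"
    if "0 \<le> \<omega>" "\<omega> \<le> pi" for \<phi> \<omega>
    unfolding seg_forward seg_backward using that M
    by (intro forward_bounds(2) backward_bounds(2); simp)+
  then show thesis by (intro that[of M]) simp_all
qed

section \<open>The product of the tangent segments, averaged over all directions\<close>

text \<open>Up to the derivative of a periodic function, which integrates to zero, the product of the two
  segments is a combination of the correlation products of \<open>p\<close> with \<open>p\<close>, \<open>p'\<close> and \<open>p''\<close> at
  the shifts \<open>0\<close> and \<open>\<pi> - \<omega>\<close>. Each of these has a Fourier expansion, and adding the expansions up produces the kernels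
  \<^const>\<open>h_fun\<close>. The first harmonic, which corresponds to translations of the body, contributes nothing
  because \<^term>\<open>h_fun 1\<close> vanishes.\<close>
lemma seg_product_integral_sums:
  defines "L \<equiv> integral {0..2*pi} p"
  shows "(\<lambda>j. pi * ((fourier_cos_coeff p (j + 2))\<^sup>2 + (fourier_sin_coeff p (j + 2))\<^sup>2) * h_fun (j + 2) \<omega>)
    sums (integral {0..2*pi} (\<lambda>\<phi>. seg1 \<phi> \<omega> * seg2 \<phi> \<omega>) - L\<^sup>2 / (2*pi) * (1 + cos \<omega>)\<^sup>2)"
proof -
  define d where "d = pi - \<omega>"
  define c s where "c = cos \<omega>" and "s = sin \<omega>"
  define a b where "a = fourier_cos_coeff p" and "b = fourier_sin_coeff p"
  define R where "R q e = integral {0..2*pi} (\<lambda>x. p x * q (x + e))" for q e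
  have cP: "continuous_on UNIV p" "continuous_on UNIV p1" "continuous_on UNIV p2"
    by (fact continuous_p continuous_p1 continuous_p2)+
  note corr = correlation_fourier[OF p_deriv p1_deriv p2_cont p_per p1_per, folded R_def a_def b_def]
  have co1: "fourier_cos_coeff p1 k = real k * b k" "fourier_sin_coeff p1 k = - real k * a k" for k
    using fourier_coeff_derivative[OF p_deriv cP(2) p_per] by (simp_all add: a_def b_def)
  have co2: "fourier_cos_coeff p2 k = - (real k)\<^sup>2 * a k" "fourier_sin_coeff p2 k = - (real k)\<^sup>2 * b k" for k
    using fourier_coeff_derivative[OF p1_deriv cP(3) p1_per] by (simp_all add: co1 power2_eq_square)
  define C where "C k = (a k)\<^sup>2 + (b k)\<^sup>2" for k
  have S0: "(\<lambda>j. pi * (C (Suc j) * cos (real (Suc j) * e))) sums (R p e - pi * (a 0)\<^sup>2 / 2)" for e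
    using corr[OF cP(1) p_per, of e, folded a_def b_def] by (simp add: C_def power2_eq_square mult_ac)
  have S1: "(\<lambda>j. pi * (- real (Suc j) * C (Suc j) * sin (real (Suc j) * d))) sums R p1 d"
    using corr[OF cP(2) p1_per, of d] unfolding co1 C_def by (simp add: algebra_simps power2_eq_square)
  have S2: "(\<lambda>j. pi * (- (real (Suc j))\<^sup>2 * C (Suc j) * cos (real (Suc j) * d))) sums R p2 d"
    using corr[OF cP(3) p2_per, of d] unfolding co2 C_def by (simp add: algebra_simps power2_eq_square)
  have AB: "integral {0..2*pi} (\<lambda>\<phi>. seg1 \<phi> \<omega> * seg2 \<phi> \<omega>) = (1 + c\<^sup>2) * R p d + 2 * c * R p 0 + 2 * s * c * R p1 d + s\<^sup>2 * R p2 d"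
  proof -
    \<comment> \<open>the periodic function whose derivative collects the terms with vanishing integral\<close>
    define W where "W x = s / 2 * ((p (x + d))\<^sup>2 - (p x)\<^sup>2) - s * c * (p x * p (x + d)) - s\<^sup>2 * (p x * p1 (x + d))" for x
    define W' where "W' x = s * (p (x + d) * p1 (x + d) - p x * p1 x) - s * c * (p1 x * p (x + d) + p x * p1 (x + d))
        - s\<^sup>2 * (p1 x * p1 (x + d) + p x * p2 (x + d))" for x
    have "(W' has_integral 0) {0..2*pi}"
    proof (rule has_integral_periodic_derivative[where G = W])
      show "(W has_real_derivative W' x) (at x)" for x
        unfolding W_def W'_def by (auto intro!: derivative_eq_intros simp: algebra_simps)
      show "W (2*pi) = W 0"
        using p_per[of 0] p_per[of d] p1_per[of d] by (simp add: W_def add.commute)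
    qed
    moreover have "((\<lambda>x. p x * q (x + e)) has_integral R q e) {0..2*pi}" if "q \<in> {p, p1, p2}" for q e
      unfolding R_def by (rule integrable_integral, rule integrable_continuous_interval)
        (use that in \<open>auto intro!: continuous_intros\<close>)
    note this[of p d, simplified] this[of p 0, simplified] this[of p1 d, simplified] this[of p2 d, simplified]
    moreover have "((\<lambda>x. p (x + d) * p (x + d)) has_integral R p 0) {0..2*pi}"
    proof -
      have "(\<lambda>x. p (x + d) * p (x + d)) integrable_on {0..2*pi}"
        by (intro integrable_continuous_interval continuous_intros)
      moreover have "integral {0..2*pi} (\<lambda>x. p (x + d) * p (x + d)) = R p 0"
        using integral_periodic_shift[of "\<lambda>x. p x * p x" "2*pi" d] by (simp add: R_def p_per continuous_intros)
      ultimately show ?thesis by (simp add: has_integral_iff)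
    qed
    ultimately have "((\<lambda>x. (1 + c\<^sup>2) * (p x * p (x + d)) + (c * (p (x + d) * p (x + d)) + c * (p x * p x))
        + 2 * s * c * (p x * p1 (x + d)) + s\<^sup>2 * (p x * p2 (x + d)) + W' x) has_integral
      ((1 + c\<^sup>2) * R p d + (c * R p 0 + c * R p 0) + 2 * s * c * R p1 d + s\<^sup>2 * R p2 d + 0)) {0..2*pi}"
      by (intro has_integral_add has_integral_mult_right)
    also have "(\<lambda>x. (1 + c\<^sup>2) * (p x * p (x + d)) + (c * (p (x + d) * p (x + d)) + c * (p x * p x))
        + 2 * s * c * (p x * p1 (x + d)) + s\<^sup>2 * (p x * p2 (x + d)) + W' x) = (\<lambda>\<phi>. seg1 \<phi> \<omega> * seg2 \<phi> \<omega>)"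
    proof
      fix x
      have e: "x + pi - \<omega> = x + d" by (simp add: d_def)
      show "(1 + c\<^sup>2) * (p x * p (x + d)) + (c * (p (x + d) * p (x + d)) + c * (p x * p x))
        + 2 * s * c * (p x * p1 (x + d)) + s\<^sup>2 * (p x * p2 (x + d)) + W' x = seg1 x \<omega> * seg2 x \<omega>"
        unfolding seg1_def seg2_def W'_def e c_def[symmetric] s_def[symmetric]
        by (simp add: algebra_simps power2_eq_square)
    qed
    finally show ?thesis by (simp add: has_integral_iff)
  qed
  have L: "L = pi * a 0"
    using fourier_coeff_integral(1)[OF cP(1), of 0] by (simp add: L_def a_def)
  let ?t = "\<lambda>j. (1 + c\<^sup>2) * (pi * (C (Suc j) * cos (real (Suc j) * d))) + 2 * c * (pi * (C (Suc j) * cos (real (Suc j) * 0)))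
     + 2 * s * c * (pi * (- real (Suc j) * C (Suc j) * sin (real (Suc j) * d))) + s\<^sup>2 * (pi * (- (real (Suc j))\<^sup>2 * C (Suc j) * cos (real (Suc j) * d)))"
  have "?t sums ((1 + c\<^sup>2) * (R p d - pi * (a 0)\<^sup>2 / 2) + 2 * c * (R p 0 - pi * (a 0)\<^sup>2 / 2) + 2 * s * c * R p1 d + s\<^sup>2 * R p2 d)"
    by (intro sums_add sums_mult S0 S1 S2)
  also have "?t = (\<lambda>j. pi * C (Suc j) * h_fun (Suc j) \<omega>)"
    unfolding h_fun_alt d_def[symmetric] c_def[symmetric] s_def[symmetric] by (simp add: algebra_simps)
  also have "(1 + c\<^sup>2) * (R p d - pi * (a 0)\<^sup>2 / 2) + 2 * c * (R p 0 - pi * (a 0)\<^sup>2 / 2) + 2 * s * c * R p1 d + s\<^sup>2 * R p2 d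
     = integral {0..2*pi} (\<lambda>\<phi>. seg1 \<phi> \<omega> * seg2 \<phi> \<omega>) - L\<^sup>2 / (2*pi) * (1 + c)\<^sup>2"
    unfolding AB L by (simp add: field_simps power2_eq_square)
  finally have "(\<lambda>j. pi * C (Suc j) * h_fun (Suc j) \<omega>) sums (integral {0..2*pi} (\<lambda>\<phi>. seg1 \<phi> \<omega> * seg2 \<phi> \<omega>) - L\<^sup>2 / (2*pi) * (1 + c)\<^sup>2)" .
  then have "(\<lambda>j. pi * C (Suc (Suc j)) * h_fun (Suc (Suc j)) \<omega>) sums (integral {0..2*pi} (\<lambda>\<phi>. seg1 \<phi> \<omega> * seg2 \<phi> \<omega>) - L\<^sup>2 / (2*pi) * (1 + c)\<^sup>2)"
    by (subst sums_Suc_iff[of "\<lambda>j. pi * C (Suc j) * h_fun (Suc j) \<omega>"]) (simp add: h_fun_1)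
  then show ?thesis by (simp add: C_def a_def b_def c_def)
qed

text \<open>Bessel's inequality for the radius of curvature, whose coefficients are \<open>1 - k\<^sup>2\<close> times
  those of \<open>p\<close>.\<close>
lemma coeff_summable:
  "summable (\<lambda>k. ((real k)\<^sup>2 - 1)\<^sup>2 * ((fourier_cos_coeff p k)\<^sup>2 + (fourier_sin_coeff p k)\<^sup>2))"
proof -
  have c: "continuous_on UNIV (\<lambda>x. p x + p2 x)" by (intro continuous_intros)
  have int: "h integrable_on {0..2*pi}" if "continuous_on {0..2*pi} h" for h :: "real \<Rightarrow> real"
    using that by (rule integrable_continuous_interval)
  have cP: "continuous_on UNIV p" "continuous_on UNIV p1" "continuous_on UNIV p2"
    by (fact continuous_p continuous_p1 continuous_p2)+
  have "pi * fourier_cos_coeff (\<lambda>x. p x + p2 x) k = pi * fourier_cos_coeff p k + pi * fourier_cos_coeff p2 k"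
    "pi * fourier_sin_coeff (\<lambda>x. p x + p2 x) k = pi * fourier_sin_coeff p k + pi * fourier_sin_coeff p2 k" for k
    by (simp_all add: fourier_coeff_integral[symmetric] c cP distrib_right integral_add int continuous_intros)
  then have sum: "pi * fourier_cos_coeff (\<lambda>x. p x + p2 x) k = pi * (fourier_cos_coeff p k + fourier_cos_coeff p2 k)"
    "pi * fourier_sin_coeff (\<lambda>x. p x + p2 x) k = pi * (fourier_sin_coeff p k + fourier_sin_coeff p2 k)" for k
    by (simp_all only: distrib_left)
  have "fourier_cos_coeff p2 k = - (real k)\<^sup>2 * fourier_cos_coeff p k"
    "fourier_sin_coeff p2 k = - (real k)\<^sup>2 * fourier_sin_coeff p k" for k
    using fourier_coeff_derivative[OF p_deriv cP(2) p_per, of k] fourier_coeff_derivative[OF p1_deriv cP(3) p1_per, of k]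
    by (simp_all add: power2_eq_square)
  with sum have "fourier_cos_coeff (\<lambda>x. p x + p2 x) k = (1 - (real k)\<^sup>2) * fourier_cos_coeff p k"
    "fourier_sin_coeff (\<lambda>x. p x + p2 x) k = (1 - (real k)\<^sup>2) * fourier_sin_coeff p k" for k
    by (simp_all add: left_diff_distrib)
  with bessel_summable[OF c] show ?thesis
    by (simp add: power_mult_distrib distrib_left power2_commute[of 1])
qed

end

section \<open>Zeros of a support function that takes negative values\<close>

text \<open>Applied to the support function of the body translated by \<open>- P\<close>, the zeros are the normal angles of
  the tangents through \<open>P\<close>. A zero at which the function is nondecreasing is followed by half a period of
  positive values, and one at which it is nonincreasing is preceded by half a period of positive values. So in
  each period there is at most one zero of each kind, and this determines the pair of tangents.\<close>

context smooth_support
begin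

lemma positive_after_zero:
  assumes "p x = 0" "p1 x \<ge> 0" "0 < d" "d \<le> pi"
  shows "p (x + d) > 0"
proof -
  obtain m where m: "0 < m" "\<And>x. m \<le> p2 x + p x" using radius_bounds by metis
  have "cos d < 1" using cos_monotone_0_pi[of 0 d] assms by simp
  then have "0 < m * (1 - cos d)" using m by simp
  also have "m * (1 - cos d) \<le> p (x + d) - p x * cos d - p1 x * sin d"
    using assms m by (intro forward_bounds(1)) auto
  finally have "0 < p (x + d) - p1 x * sin d" using assms by simp
  moreover have "p1 x * sin d \<ge> 0" using assms by (intro mult_nonneg_nonneg sin_ge_zero) auto
  ultimately show ?thesis by linarith
qed

lemma positive_before_zero:
  assumes "p x = 0" "p1 x \<le> 0" "0 < d" "d \<le> pi"
  shows "p (x - d) > 0"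
proof -
  obtain m where m: "0 < m" "\<And>x. m \<le> p2 x + p x" using radius_bounds by metis
  have "cos d < 1" using cos_monotone_0_pi[of 0 d] assms by simp
  then have "0 < m * (1 - cos d)" using m by simp
  also have "m * (1 - cos d) \<le> p (x - d) - p x * cos d + p1 x * sin d"
    using assms m by (intro backward_bounds(1)) auto
  finally have "0 < p (x - d) + p1 x * sin d" using assms by simp
  moreover have "p1 x * sin d \<le> 0" using assms by (intro mult_nonpos_nonneg sin_ge_zero) auto
  ultimately show ?thesis by linarith
qed

lemma width_pos: "p x + p (x + pi) > 0"
proof -
  obtain m where m: "0 < m" "\<And>x. m \<le> p2 x + p x" using radius_bounds by metis
  then have "m * (1 - cos pi) \<le> p (x + pi) - p x * cos pi - p1 x * sin pi"
    by (intro forward_bounds(1)) auto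
  with m show ?thesis by simp
qed

lemma p_per_int: "p (x + 2*pi * of_int n) = p x" and p1_per_int: "p1 (x + 2*pi * of_int n) = p1 x"
  by (intro periodic_add_int p_per p1_per)+

definition zero_pair :: "real \<Rightarrow> real \<Rightarrow> bool" where
  "zero_pair x d \<longleftrightarrow> 0 < d \<and> d < pi \<and> p x = 0 \<and> p (x + d) = 0"

lemma zero_pair_slopes:
  assumes "zero_pair x d"
  shows "p1 x < 0" "p1 (x + d) > 0"
  using assms positive_after_zero[of x d] positive_before_zero[of "x + d" d]
  unfolding zero_pair_def by force+

lemma zero_pair_neg:
  assumes "zero_pair x d"
  shows "\<exists>y. p y < 0"
proof -
  obtain e where "e > 0" "\<And>h. 0 < h \<Longrightarrow> h < e \<Longrightarrow> p (x + h) < p x"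
    using DERIV_neg_dec_right[OF p_deriv zero_pair_slopes(1)[OF assms]] by blast
  then have "p (x + e/2) < p x" by simp
  then show ?thesis using assms by (auto simp: zero_pair_def)
qed

lemma zero_pair_unique:
  assumes xd: "zero_pair x d" and ye: "zero_pair y e"
  shows "\<exists>n::int. y + 2*pi * of_int n = x" "e = d"
proof -
  obtain n :: int where n: "x \<le> y + 2*pi * of_int n" "y + 2*pi * of_int n < x + 2*pi"
    using reduce_mod_period[of "2*pi" x y] by auto
  let ?y = "y + 2*pi * of_int n"
  have z: "p x = 0" "p ?y = 0" "p1 x < 0" "p1 ?y < 0" "p (x + 2*pi) = 0" "p1 (x + 2*pi) < 0"
    using xd ye zero_pair_slopes(1)[OF xd] zero_pair_slopes(1)[OF ye] p_per[of x] p1_per[of x]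
    unfolding p_per_int p1_per_int by (auto simp: zero_pair_def)
  have eq: "?y = x"
  proof (rule ccontr)
    assume "?y \<noteq> x"
    then consider "x < ?y" "?y \<le> x + pi" | "x + pi < ?y" using n by linarith
    then show False
    proof cases
      case 1 then show False using positive_before_zero[of ?y "?y - x"] z by simp
    next
      case 2 then show False using positive_before_zero[of "x + 2*pi" "x + 2*pi - ?y"] z n by simp
    qed
  qed
  then show "\<exists>n::int. y + 2*pi * of_int n = x" by blast
  have "zero_pair ?y e" using ye p_per_int[of y n] p_per_int[of "y + e" n]
    by (simp add: zero_pair_def algebra_simps)
  then have xe: "zero_pair x e" by (simp add: eq)
  have "\<not> d < e" if "zero_pair x d" "zero_pair x e" for d e
    using positive_after_zero[of "x + d" "e - d"] zero_pair_slopes(2)[OF that(1)] that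
    by (auto simp: zero_pair_def)
  from this[OF xd xe] this[OF xe xd] show "e = d" by simp
qed

lemma zero_classification:
  assumes xd: "zero_pair x d" and y: "p y = 0"
  shows "\<exists>n::int. y = x + 2*pi * of_int n \<or> y = x + d + 2*pi * of_int n"
proof -
  obtain n :: int where n: "x \<le> y + 2*pi * of_int n" "y + 2*pi * of_int n < x + 2*pi"
    using reduce_mod_period[of "2*pi" x y] by auto
  let ?y = "y + 2*pi * of_int n"
  have py: "p ?y = 0" using y by (simp add: p_per_int)
  have "?y = x \<or> ?y = x + d"
  proof (rule ccontr)
    assume *: "\<not> (?y = x \<or> ?y = x + d)"
    show False
    proof (cases "?y < x + pi")
      case True
      then have "zero_pair x (?y - x)" using n * xd py by (auto simp: zero_pair_def)
      from zero_pair_unique(2)[OF xd this] * show False by simp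
    next
      case False
      then show False
        using positive_before_zero[of "x + 2*pi" "x + 2*pi - ?y"] n py xd zero_pair_slopes(1)[OF xd]
        by (simp add: p_per p1_per zero_pair_def)
    qed
  qed
  then have "y = x + 2*pi * of_int (-n) \<or> y = x + d + 2*pi * of_int (-n)" by auto
  then show ?thesis by blast
qed

lemma zero_pair_exists:
  assumes "p y < 0"
  shows "\<exists>x d. zero_pair x d"
proof -
  have pos: "p (y + pi) > 0" "p (y - pi) > 0"
    using width_pos[of y] width_pos[of "y - pi"] assms by auto
  have "\<exists>x\<ge>y - pi. x \<le> y \<and> p x = 0"
    by (rule IVT2'[of p y 0 "y - pi"]) (use pos assms continuous_p in auto)
  then obtain x where x: "y - pi \<le> x" "x \<le> y" "p x = 0" by blast
  have "\<exists>x\<ge>y. x \<le> y + pi \<and> p x = 0"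
    by (rule IVT'[of p y 0 "y + pi"]) (use pos assms continuous_p in auto)
  then obtain z where z: "y \<le> z" "z \<le> y + pi" "p z = 0" by blast
  have ne: "x \<noteq> y" "z \<noteq> y" "z < y + pi" "y - pi < x" using x z assms pos by (auto simp: order_less_le)
  have "p1 z \<ge> 0"
    using positive_before_zero[of z "z - y"] assms z ne by force
  moreover have "p (x + 2*pi) = 0" using x by (simp add: p_per)
  ultimately have "z < x + pi"
    using positive_after_zero[of z "x + 2*pi - z"] z x ne by force
  then have "zero_pair x (z - x)" using x z ne by (auto simp: zero_pair_def)
  then show ?thesis by blast
qed

end

section \<open>Rotating frames in the plane\<close>

definition edir :: "real \<Rightarrow> real^2" where "edir \<phi> = vector [cos \<phi>, sin \<phi>]"
definition eperp :: "real \<Rightarrow> real^2" where "eperp \<phi> = vector [- sin \<phi>, cos \<phi>]"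

lemma inner_2: "(x::real^2) \<bullet> y = x $ 1 * y $ 1 + x $ 2 * y $ 2"
  by (simp add: inner_vec_def sum_2)

lemma edir_nth [simp]: "edir \<phi> $ 1 = cos \<phi>" "edir \<phi> $ 2 = sin \<phi>"
  and eperp_nth [simp]: "eperp \<phi> $ 1 = - sin \<phi>" "eperp \<phi> $ 2 = cos \<phi>"
  by (simp_all add: edir_def eperp_def)

lemma frame_inner:
  "edir \<phi> \<bullet> edir \<psi> = cos (\<psi> - \<phi>)" "eperp \<phi> \<bullet> eperp \<psi> = cos (\<psi> - \<phi>)"
  "eperp \<phi> \<bullet> edir \<psi> = sin (\<psi> - \<phi>)" "edir \<psi> \<bullet> eperp \<phi> = sin (\<psi> - \<phi>)"
  by (simp_all add: inner_2 cos_diff sin_diff algebra_simps)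

lemma frame_self_inner [simp]: "edir \<phi> \<bullet> edir \<phi> = 1" "eperp \<phi> \<bullet> eperp \<phi> = 1"
  "eperp \<phi> \<bullet> edir \<phi> = 0" "edir \<phi> \<bullet> eperp \<phi> = 0"
  by (simp_all add: frame_inner)

lemma frame_norm [simp]: "norm (edir \<phi>) = 1" "norm (eperp \<phi>) = 1"
  by (simp_all add: norm_eq_sqrt_inner)

lemma frame_expansion: "x = (x \<bullet> edir \<phi>) *\<^sub>R edir \<phi> + (x \<bullet> eperp \<phi>) *\<^sub>R eperp \<phi>"
proof -
  have "(sin \<phi>)\<^sup>2 + (cos \<phi>)\<^sup>2 = 1" by simp
  then have "x $ 1 = (x $ 1 * cos \<phi> + x $ 2 * sin \<phi>) * cos \<phi> + (x $ 1 * - sin \<phi> + x $ 2 * cos \<phi>) * - sin \<phi>"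
    "x $ 2 = (x $ 1 * cos \<phi> + x $ 2 * sin \<phi>) * sin \<phi> + (x $ 1 * - sin \<phi> + x $ 2 * cos \<phi>) * cos \<phi>"
    by algebra+
  then show ?thesis by (simp add: vec_eq_iff forall_2 inner_2)
qed

lemma edir_inner_deriv [derivative_intros]:
  assumes "(f has_real_derivative f') (at x within S)"
  shows "((\<lambda>x. P \<bullet> edir (f x)) has_real_derivative (P \<bullet> eperp (f x)) * f') (at x within S)"
    and "((\<lambda>x. P \<bullet> eperp (f x)) has_real_derivative - (P \<bullet> edir (f x)) * f') (at x within S)"
  unfolding inner_2 using assms by (auto intro!: derivative_eq_intros simp: algebra_simps)

lemma edir_per [simp]: "edir (\<phi> + 2*pi) = edir \<phi>" "eperp (\<phi> + 2*pi) = eperp \<phi>"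
  by (simp_all add: vec_eq_iff forall_2)

context smooth_support
begin

section \<open>Pairs of tangents through an exterior point\<close>

text \<open>The signed distance of \<open>P\<close> from the support line with outer normal angle \<open>\<phi>\<close>, positive on the side of
  the body.\<close>
definition gap :: "real^2 \<Rightarrow> real \<Rightarrow> real" where
  "gap P \<phi> = p \<phi> - P \<bullet> edir \<phi>"

text \<open>Translating the body adds a first harmonic to the support function and keeps the radius of curvature,
  so all results on \<open>p\<close> transfer to the gap of an arbitrary point.\<close>
lemma gap_smooth_support:
  "smooth_support (gap P) (\<lambda>\<phi>. p1 \<phi> - P \<bullet> eperp \<phi>) (\<lambda>\<phi>. p2 \<phi> + P \<bullet> edir \<phi>)"
proof
  show "(gap P has_real_derivative p1 x - P \<bullet> eperp x) (at x)" for x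
    unfolding gap_def by (auto intro!: derivative_eq_intros p_deriv)
  show "((\<lambda>\<phi>. p1 \<phi> - P \<bullet> eperp \<phi>) has_real_derivative p2 x + P \<bullet> edir x) (at x)" for x
    by (auto intro!: derivative_eq_intros p1_deriv)
  show "continuous_on UNIV (\<lambda>\<phi>. p2 \<phi> + P \<bullet> edir \<phi>)"
    unfolding inner_2 edir_nth by (intro continuous_intros)
  show "gap P (x + 2*pi) = gap P x" for x by (simp add: gap_def p_per)
  show "0 < gap P x + (p2 x + P \<bullet> edir x)" for x using radius_pos[of x] by (simp add: gap_def)
qed

abbreviation tangent_pair :: "real^2 \<Rightarrow> real \<Rightarrow> real \<Rightarrow> bool" where
  "tangent_pair P \<equiv> smooth_support.zero_pair (gap P)"

lemmas tangent_pair_def = smooth_support.zero_pair_def[OF gap_smooth_support]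
lemmas tangent_pair_unique = smooth_support.zero_pair_unique[OF gap_smooth_support]
lemmas tangent_pair_exists = smooth_support.zero_pair_exists[OF gap_smooth_support]
lemmas tangent_pair_neg = smooth_support.zero_pair_neg[OF gap_smooth_support]
lemmas tangent_classification = smooth_support.zero_classification[OF gap_smooth_support]

definition body :: "(real^2) set" where
  "body = {P. \<forall>\<phi>. P \<bullet> edir \<phi> \<le> p \<phi>}"

text \<open>The coordinate, along the tangent with normal angle \<open>\<phi>\<close>, of its crossing point with the tangent of normal
  angle \<open>\<phi> + \<pi> - \<omega>\<close>.\<close>
definition reach :: "real \<Rightarrow> real \<Rightarrow> real" where
  "reach \<phi> \<omega> = (p (\<phi> + pi - \<omega>) + p \<phi> * cos \<omega>) / sin \<omega>"

definition crossing :: "real \<Rightarrow> real \<Rightarrow> real^2" where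
  "crossing \<phi> \<omega> = p \<phi> *\<^sub>R edir \<phi> + reach \<phi> \<omega> *\<^sub>R eperp \<phi>"

lemma tangent_pair_iff_crossing:
  assumes "0 < \<omega>" "\<omega> < pi"
  shows "tangent_pair P \<phi> (pi - \<omega>) \<longleftrightarrow> P = crossing \<phi> \<omega>"
proof -
  have s: "sin \<omega> > 0" using assms by (simp add: sin_gt_zero)
  define x y where "x = P \<bullet> edir \<phi>" and "y = P \<bullet> eperp \<phi>"
  have P: "P = x *\<^sub>R edir \<phi> + y *\<^sub>R eperp \<phi>" unfolding x_def y_def by (rule frame_expansion)
  have in2: "P \<bullet> edir (\<phi> + pi - \<omega>) = - x * cos \<omega> + y * sin \<omega>"
    unfolding P by (simp add: inner_add_left frame_inner algebra_simps sin_diff cos_diff)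
  have "tangent_pair P \<phi> (pi - \<omega>) \<longleftrightarrow> x = p \<phi> \<and> y = reach \<phi> \<omega>"
    using assms s in2 unfolding tangent_pair_def gap_def reach_def x_def[symmetric] add_diff_eq
    by (auto simp: field_simps)
  also have "\<dots> \<longleftrightarrow> P = crossing \<phi> \<omega>"
  proof
    assume "P = crossing \<phi> \<omega>"
    then show "x = p \<phi> \<and> y = reach \<phi> \<omega>" by (simp add: x_def y_def crossing_def inner_add_left)
  qed (simp add: P crossing_def)
  finally show ?thesis .
qed

lemma crossing_notin_body:
  assumes "0 < \<omega>" "\<omega> < pi"
  shows "crossing \<phi> \<omega> \<notin> body"
proof -
  have "tangent_pair (crossing \<phi> \<omega>) \<phi> (pi - \<omega>)" using tangent_pair_iff_crossing[OF assms] by simp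
  then obtain y where "gap (crossing \<phi> \<omega>) y < 0" using tangent_pair_neg by blast
  then show ?thesis by (auto simp: body_def gap_def not_le[symmetric])
qed

lemma notin_body_crossing:
  assumes "P \<notin> body"
  obtains \<phi> \<omega> where "0 < \<omega>" "\<omega> < pi" "P = crossing \<phi> \<omega>"
proof -
  from assms obtain y where "gap P y < 0" by (auto simp: body_def gap_def not_le)
  then obtain \<phi> d where "tangent_pair P \<phi> d" using tangent_pair_exists by blast
  moreover from this have "0 < pi - d" "pi - d < pi" by (auto simp: tangent_pair_def)
  ultimately show thesis using that[of "pi - d" \<phi>] tangent_pair_iff_crossing[of "pi - d"] by simp
qed

lemma crossing_eqD:
  assumes "crossing \<phi> \<omega> = crossing \<phi>' \<omega>'" "0 < \<omega>" "\<omega> < pi" "0 < \<omega>'" "\<omega>' < pi"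
  shows "\<omega> = \<omega>'" "\<exists>n::int. \<phi>' + 2*pi * of_int n = \<phi>"
  using tangent_pair_unique[of "crossing \<phi> \<omega>" \<phi> "pi - \<omega>" \<phi>' "pi - \<omega>'"]
    tangent_pair_iff_crossing[of \<omega> "crossing \<phi> \<omega>" \<phi>] tangent_pair_iff_crossing[of \<omega>' "crossing \<phi> \<omega>" \<phi>'] assms by auto

lemma crossing_per_int: "crossing (\<phi> + 2*pi * of_int n) \<omega> = crossing \<phi> \<omega>"
proof (rule periodic_add_int)
  have "\<phi> + 2*pi + pi - \<omega> = (\<phi> + pi - \<omega>) + 2*pi" for \<phi> by simp
  then show "crossing (\<phi> + 2*pi) \<omega> = crossing \<phi> \<omega>" for \<phi>
    unfolding crossing_def reach_def by (simp only: p_per edir_per)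
qed

text \<open>The boundary point with outer normal angle \<open>\<phi>\<close>: the derivative of the support function is its
  tangential coordinate.\<close>
definition contact :: "real \<Rightarrow> real^2" where
  "contact \<phi> = p \<phi> *\<^sub>R edir \<phi> + p1 \<phi> *\<^sub>R eperp \<phi>"

lemma contact_per_int: "contact (\<phi> + 2*pi * of_int n) = contact \<phi>"
  by (rule periodic_add_int) (simp add: contact_def p_per p1_per)

lemma crossing_from_contact:
  assumes "0 < \<omega>" "\<omega> < pi"
  shows "contact \<phi> - crossing \<phi> \<omega> = - (seg1 \<phi> \<omega> / sin \<omega>) *\<^sub>R eperp \<phi>"
    and "contact (\<phi> + pi - \<omega>) - crossing \<phi> \<omega> = (seg2 \<phi> \<omega> / sin \<omega>) *\<^sub>R eperp (\<phi> + pi - \<omega>)"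
proof -
  have s: "sin \<omega> > 0" using assms by (simp add: sin_gt_zero)
  have e: "seg1 \<phi> \<omega> / sin \<omega> = reach \<phi> \<omega> - p1 \<phi>"
    using s by (simp add: seg1_def reach_def field_simps)
  show "contact \<phi> - crossing \<phi> \<omega> = - (seg1 \<phi> \<omega> / sin \<omega>) *\<^sub>R eperp \<phi>"
    unfolding e by (simp add: contact_def crossing_def algebra_simps)
  let ?\<psi> = "\<phi> + pi - \<omega>"
  have in2: "crossing \<phi> \<omega> \<bullet> edir ?\<psi> = p ?\<psi>"
    using tangent_pair_iff_crossing[OF assms, of "crossing \<phi> \<omega>" \<phi>] by (simp add: tangent_pair_def gap_def add_diff_eq)
  have "crossing \<phi> \<omega> \<bullet> eperp ?\<psi> = - p \<phi> * sin \<omega> - reach \<phi> \<omega> * cos \<omega>"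
    unfolding crossing_def by (simp add: inner_add_left frame_inner algebra_simps sin_diff cos_diff)
  moreover have "p1 ?\<psi> - (- p \<phi> * sin \<omega> - reach \<phi> \<omega> * cos \<omega>) = seg2 \<phi> \<omega> / sin \<omega>"
  proof -
    have "sin \<omega> * sin \<omega> = 1 - cos \<omega> * cos \<omega>" using sin_squared_eq[of \<omega>] by (simp add: power2_eq_square)
    then have "p \<phi> * sin \<omega> * sin \<omega> = p \<phi> * (1 - cos \<omega> * cos \<omega>)" by (simp add: mult.assoc)
    then show ?thesis using s by (simp add: seg2_def reach_def field_simps)
  qed
  ultimately show "contact ?\<psi> - crossing \<phi> \<omega> = (seg2 \<phi> \<omega> / sin \<omega>) *\<^sub>R eperp ?\<psi>"
    by (subst frame_expansion[of "crossing \<phi> \<omega>" ?\<psi>]) (simp add: contact_def in2 scaleR_diff_left[symmetric])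
qed

text \<open>Seen from the crossing point, the points of contact lie in the directions \<open>- eperp \<phi>\<close> and
  \<open>eperp (\<phi> + \<pi> - \<omega>)\<close>, because both segment lengths are positive.\<close>
lemma vector_angle_crossing:
  assumes "0 < \<omega>" "\<omega> < pi"
  shows "vector_angle (contact \<phi> - crossing \<phi> \<omega>) (contact (\<phi> + pi - \<omega>) - crossing \<phi> \<omega>) = \<omega>"
    and "vector_angle (contact (\<phi> + pi - \<omega>) - crossing \<phi> \<omega>) (contact \<phi> - crossing \<phi> \<omega>) = \<omega>"
proof -
  define a b where "a = seg1 \<phi> \<omega> / sin \<omega>" and "b = seg2 \<phi> \<omega> / sin \<omega>"
  have "sin \<omega> > 0" using assms by (simp add: sin_gt_zero)
  then have ab: "a > 0" "b > 0" using seg_pos[of \<omega> \<phi>] assms by (simp_all add: a_def b_def)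
  have "cos (pi - \<omega>) = - cos \<omega>" by simp
  then show "vector_angle (contact \<phi> - crossing \<phi> \<omega>) (contact (\<phi> + pi - \<omega>) - crossing \<phi> \<omega>) = \<omega>"
    unfolding vector_angle_def crossing_from_contact[OF assms] a_def[symmetric] b_def[symmetric]
    using ab assms by (simp add: frame_inner arccos_cos)
  then show "vector_angle (contact (\<phi> + pi - \<omega>) - crossing \<phi> \<omega>) (contact \<phi> - crossing \<phi> \<omega>) = \<omega>"
    unfolding vector_angle_def by (simp add: inner_commute mult.commute)
qed

end

section \<open>Supporting half-planes and lines\<close>

lemma edir_surj:
  fixes a :: "real^2"
  assumes "norm a = 1"
  obtains \<phi> where "a = edir \<phi>"
proof -
  have "(a $ 1)\<^sup>2 + (a $ 2)\<^sup>2 = 1" using assms by (simp add: norm_eq_sqrt_inner inner_2 power2_eq_square)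
  then obtain t where "a $ 1 = cos t" "a $ 2 = sin t" using sincos_total_2pi by metis
  then have "a = edir t" by (simp add: vec_eq_iff forall_2)
  then show thesis by (rule that)
qed

lemma support_function_props:
  fixes K :: "(real^2) set"
  assumes K: "compact K" "K \<noteq> {}"
  shows "x \<in> K \<Longrightarrow> x \<bullet> edir \<phi> \<le> support_function K \<phi>"
    and "\<exists>x\<in>K. x \<bullet> edir \<phi> = support_function K \<phi>"
proof -
  have sf: "support_function K \<phi> = (SUP z\<in>K. z \<bullet> edir \<phi>)"
    by (simp add: support_function_def inner_2)
  have c: "continuous_on K (\<lambda>z. z \<bullet> edir \<phi>)" by (intro continuous_intros)
  obtain z where z: "z \<in> K" "\<And>y. y \<in> K \<Longrightarrow> y \<bullet> edir \<phi> \<le> z \<bullet> edir \<phi>"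
    using continuous_attains_sup[OF K c] by blast
  then have "support_function K \<phi> = z \<bullet> edir \<phi>"
    unfolding sf by (intro cSup_eq_maximum) auto
  then show "x \<in> K \<Longrightarrow> x \<bullet> edir \<phi> \<le> support_function K \<phi>" "\<exists>x\<in>K. x \<bullet> edir \<phi> = support_function K \<phi>"
    using z by auto
qed

lemma convex_body_eq_support_halfspaces:
  fixes K :: "(real^2) set"
  assumes K: "compact K" "K \<noteq> {}" "convex K"
  shows "K = {x. \<forall>\<phi>. x \<bullet> edir \<phi> \<le> support_function K \<phi>}"
proof
  show "K \<subseteq> {x. \<forall>\<phi>. x \<bullet> edir \<phi> \<le> support_function K \<phi>}"
    using support_function_props(1)[OF K(1,2)] by auto
  show "{x. \<forall>\<phi>. x \<bullet> edir \<phi> \<le> support_function K \<phi>} \<subseteq> K"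
  proof (rule ccontr)
    assume "\<not> ?thesis"
    then obtain z where z: "\<And>\<phi>. z \<bullet> edir \<phi> \<le> support_function K \<phi>" "z \<notin> K" by auto
    obtain a b where ab: "a \<bullet> z < b" "\<And>x. x \<in> K \<Longrightarrow> a \<bullet> x > b"
      using separating_hyperplane_closed_point[OF K(3) compact_imp_closed[OF K(1)] z(2)] by blast
    have "a \<noteq> 0" using ab K(2) by force
    then obtain \<phi> where \<phi>: "(-1 / norm a) *\<^sub>R a = edir \<phi>" using edir_surj[of "(-1 / norm a) *\<^sub>R a"] by auto
    obtain x where x: "x \<in> K" "x \<bullet> edir \<phi> = support_function K \<phi>" using support_function_props(2)[OF K(1,2)] by blast
    have "a \<bullet> z < a \<bullet> x" using ab x(1) by force
    then have "x \<bullet> edir \<phi> < z \<bullet> edir \<phi>"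
      unfolding \<phi>[symmetric] using \<open>a \<noteq> 0\<close> by (simp add: inner_commute divide_strict_right_mono)
    with z(1)[of \<phi>] x(2) show False by simp
  qed
qed

text \<open>If no half-plane supported the point, its distance from the support lines would have a positive minimum
  over all directions, and a disc of that radius about the point would lie in the body.\<close>
lemma frontier_support_direction:
  fixes K :: "(real^2) set"
  assumes K: "compact K" "K \<noteq> {}" "convex K" and z: "z \<in> frontier K"
    and c: "continuous_on UNIV (support_function K)"
  obtains \<phi> where "z \<bullet> edir \<phi> = support_function K \<phi>"
proof -
  have "closed K" using K compact_imp_closed by blast
  then have zK: "z \<in> K" using z frontier_subset_closed by blast
  let ?g = "\<lambda>\<phi>. support_function K \<phi> - z \<bullet> edir \<phi>"
  have cg: "continuous_on {0..2*pi} ?g"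
    unfolding inner_2 edir_nth by (intro continuous_intros continuous_on_subset[OF c]) auto
  obtain \<phi>0 where \<phi>0: "\<phi>0 \<in> {0..2*pi}" "\<And>\<phi>. \<phi> \<in> {0..2*pi} \<Longrightarrow> ?g \<phi>0 \<le> ?g \<phi>"
    using continuous_attains_inf[OF compact_Icc _ cg] by fastforce
  have "?g \<phi>0 = 0"
  proof (rule ccontr)
    assume "?g \<phi>0 \<noteq> 0"
    then have pos: "?g \<phi>0 > 0" using support_function_props(1)[OF K(1,2) zK, of \<phi>0] by simp
    have "ball z (?g \<phi>0) \<subseteq> K"
    proof
      fix x assume x: "x \<in> ball z (?g \<phi>0)"
      have "x \<bullet> edir \<phi> \<le> support_function K \<phi>" for \<phi>
      proof -
        have "(cos \<phi>)\<^sup>2 + (sin \<phi>)\<^sup>2 = 1" by simp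
        then obtain t where t: "0 \<le> t" "t < 2*pi" "cos \<phi> = cos t" "sin \<phi> = sin t" using sincos_total_2pi by metis
        have e: "edir \<phi> = edir t" "support_function K \<phi> = support_function K t"
          using t by (simp_all add: edir_def support_function_def)
        have "(x - z) \<bullet> edir t \<le> norm (x - z) * norm (edir t)" by (rule norm_cauchy_schwarz)
        also have "\<dots> \<le> ?g \<phi>0" using x by (simp add: dist_norm norm_minus_commute)
        also have "\<dots> \<le> ?g t" using \<phi>0(2)[of t] t by simp
        finally show ?thesis unfolding e by (simp add: inner_diff_left)
      qed
      then show "x \<in> K" using convex_body_eq_support_halfspaces[OF K] by auto
    qed
    then have "z \<in> interior K" using pos by (metis centre_in_ball interiorI open_ball)
    then show False using z by (simp add: frontier_def)
  qed
  then show thesis using that[of \<phi>0] by simp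
qed

lemma edir_add_pi: "edir (\<phi> + pi) = - edir \<phi>"
  by (simp add: vec_eq_iff forall_2)

text \<open>A closed curve in a line turns back where its coordinate along the line is largest, and there its
  velocity vanishes.\<close>
lemma regular_closed_curve_not_in_line:
  fixes g g' :: "real \<Rightarrow> real^2"
  assumes d: "\<And>t. (g has_vector_derivative g' t) (at t)" and nz: "\<And>t. g' t \<noteq> 0" and per: "\<And>t. g (t + 1) = g t"
  shows "\<not> (\<forall>t. g t \<bullet> edir \<phi> = b)"
proof
  assume l: "\<forall>t. g t \<bullet> edir \<phi> = b"
  have dd: "((\<lambda>t. g t \<bullet> a) has_real_derivative g' t \<bullet> a) (at t)" for a t
    unfolding has_real_derivative_iff_has_vector_derivative
    by (rule bounded_linear.has_vector_derivative[OF bounded_linear_inner_left d])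
  have 1: "g' t \<bullet> edir \<phi> = 0" for t
    using DERIV_unique[OF dd[of "edir \<phi>" t]] l by (metis (mono_tags, lifting) DERIV_const DERIV_cong_ev always_eventually)
  let ?h = "\<lambda>t. g t \<bullet> eperp \<phi>"
  have ch: "continuous_on S ?h" for S
    using dd by (meson DERIV_continuous_on has_field_derivative_at_within)
  obtain t0 where t0: "t0 \<in> {0..1}" "\<And>t. t \<in> {0..1} \<Longrightarrow> ?h t \<le> ?h t0"
    using continuous_attains_sup[of "{0..1::real}" ?h] ch by fastforce
  have "?h t \<le> ?h t0" for t
  proof -
    obtain n :: int where n: "0 \<le> t + 1 * of_int n" "t + 1 * of_int n < 0 + 1"
      using reduce_mod_period[of 1 0 t] by auto
    have "?h t = ?h (t + 1 * of_int n)" by (simp only: periodic_add_int[of g 1, OF per])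
    also have "\<dots> \<le> ?h t0" using n by (intro t0(2)) auto
    finally show ?thesis .
  qed
  then have "g' t0 \<bullet> eperp \<phi> = 0" by (intro DERIV_local_max[OF dd, of 1]) auto
  with 1[of t0] have "g' t0 = 0" by (metis frame_expansion scaleR_zero_left add_0)
  with nz show False by blast
qed

section \<open>The boundary curve in terms of its normal angle\<close>

text \<open>The logarithmic derivative of \<open>v\<close>, read as a complex-valued function, has an antiderivative on the
  line; up to a constant, its imaginary part is a differentiable choice of the argument.\<close>
lemma polar_lift:
  fixes v v' :: "real \<Rightarrow> real^2"
  assumes d: "\<And>t. (v has_vector_derivative v' t) (at t)" and c: "continuous_on UNIV v'"
    and nz: "\<And>t. v t \<noteq> 0"
  obtains \<Theta> \<Theta>' where "\<And>t. (\<Theta> has_real_derivative \<Theta>' t) (at t)" "continuous_on UNIV \<Theta>'"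
    "\<And>t. v t = norm (v t) *\<^sub>R edir (\<Theta> t)"
proof -
  define \<iota> :: "real^2 \<Rightarrow> complex" where "\<iota> z = of_real (z $ 1) + \<i> * of_real (z $ 2)" for z
  have lin: "bounded_linear \<iota>" unfolding \<iota>_def
    by (intro bounded_linear_add bounded_linear_mult_right[THEN bounded_linear_compose] bounded_linear_of_real[THEN bounded_linear_compose] bounded_linear_vec_nth)
  have norm: "cmod (\<iota> z) = norm z" for z
    by (simp add: \<iota>_def cmod_def norm_eq_sqrt_inner inner_2 power2_eq_square)
  define w w' where "w t = \<iota> (v t)" and "w' t = \<iota> (v' t)" for t
  have dw: "(w has_vector_derivative w' t) (at t)" for t
    unfolding w_def w'_def by (rule bounded_linear.has_vector_derivative[OF lin d])
  have cv: "continuous_on UNIV v"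
    using d by (meson continuous_at_imp_continuous_on has_vector_derivative_continuous)
  have cw: "continuous_on UNIV w" "continuous_on UNIV w'"
    unfolding w_def w'_def by (intro bounded_linear.continuous_on[OF lin] cv c)+
  have nzw: "w t \<noteq> 0" for t using nz[of t] norm[of "v t"] by (auto simp: w_def)
  have cq: "continuous_on UNIV (\<lambda>t. w' t / w t)" by (intro continuous_intros cw) (simp add: nzw)
  then obtain W where W: "\<And>t. (W has_vector_derivative w' t / w t) (at t)"
    by (rule continuous_antiderivative) blast
  have dE: "((\<lambda>t. exp (- W t)) has_vector_derivative - (w' t / w t) * exp (- W t)) (at t)" for t
    using field_vector_diff_chain_at[OF has_vector_derivative_minus[OF W] DERIV_exp] by (simp add: o_def)
  have "((\<lambda>t. w t * exp (- W t)) has_vector_derivative 0) (at t)" for t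
    using has_vector_derivative_mult[OF dw[of t] dE[of t]] nzw[of t] by simp
  then obtain k where k: "\<And>t. w t * exp (- W t) = k"
    using has_vector_derivative_zero_constant[of UNIV "\<lambda>t. w t * exp (- W t)"] by auto
  have wk: "w t = k * exp (W t)" for t
    using k[of t, symmetric] by (simp add: exp_minus)
  define \<Theta> where "\<Theta> t = Arg k + Im (W t)" for t
  show thesis
  proof
    show "(\<Theta> has_real_derivative Im (w' t / w t)) (at t)" for t
      unfolding \<Theta>_def has_real_derivative_iff_has_vector_derivative
      using has_vector_derivative_add[OF has_vector_derivative_const bounded_linear.has_vector_derivative[OF bounded_linear_Im W]]
      by simp
    show "continuous_on UNIV (\<lambda>t. Im (w' t / w t))" by (intro continuous_intros cq)
    show "v t = norm (v t) *\<^sub>R edir (\<Theta> t)" for t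
    proof -
      have "k = cmod k * cis (Arg k)" by (simp add: rcis_cmod_Arg flip: rcis_def)
      then have "w t = cmod k * exp (Re (W t)) * cis (\<Theta> t)"
        unfolding wk[of t] exp_eq_polar[of "W t"] \<Theta>_def by (simp add: cis_mult[symmetric] algebra_simps)
      then have "w t = cmod (w t) * cis (\<Theta> t)" by (simp add: norm_mult)
      then have "\<iota> (v t) = norm (v t) * cis (\<Theta> t)" unfolding norm[symmetric] w_def .
      then show ?thesis by (simp add: \<iota>_def complex_eq_iff vec_eq_iff forall_2)
    qed
  qed
qed

text \<open>The outer normal is the tangent direction turned by a right angle to one of the two sides. At each
  parameter one of the sides gives a supporting line, and never both, since the body has positive width.
  So the difference of the two gaps is a continuous function without zeros, and the same side \<open>\<sigma>\<close> works
  for the whole curve.\<close>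
lemma outer_normal_angle:
  fixes K :: "(real^2) set" and \<gamma> g' g'' :: "real \<Rightarrow> real^2" and p p1 :: "real \<Rightarrow> real"
  assumes K: "compact K" "convex K" and \<gamma>fr: "\<And>t. \<gamma> t \<in> frontier K"
    and g: "\<And>t. (\<gamma> has_vector_derivative g' t) (at t)" "\<And>t. (g' has_vector_derivative g'' t) (at t)"
      "continuous_on UNIV g''"
    and nz: "\<And>t. g' t \<noteq> 0"
    and p: "p = support_function K" and pd: "\<And>x. (p has_real_derivative p1 x) (at x)"
    and width: "\<And>\<phi>. p \<phi> + p (\<phi> + pi) > 0"
  obtains \<theta> \<Theta>' \<sigma> where "\<And>t. (\<theta> has_real_derivative \<Theta>' t) (at t)" "continuous_on UNIV \<Theta>'"
    "\<sigma> = 1 \<or> \<sigma> = -1" "\<And>t. g' t = (\<sigma> * norm (g' t)) *\<^sub>R eperp (\<theta> t)"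
    "\<And>t. \<gamma> t \<bullet> edir (\<theta> t) = p (\<theta> t)" "\<And>t. \<gamma> t \<bullet> eperp (\<theta> t) = p1 (\<theta> t)"
proof -
  have "closed K" using K compact_imp_closed by blast
  have \<gamma>K: "\<gamma> t \<in> K" for t using \<gamma>fr[of t] \<open>closed K\<close> frontier_subset_closed by blast
  then have Kne: "K \<noteq> {}" by auto
  note supp = support_function_props[OF K(1) Kne, folded p]
  have pc: "continuous_on S p" for S
    using pd by (meson DERIV_continuous_on has_field_derivative_at_within)
  have g0cont: "continuous_on UNIV \<gamma>"
    using g(1) by (meson continuous_at_imp_continuous_on has_vector_derivative_continuous)
  have dd: "((\<lambda>t. \<gamma> t \<bullet> a) has_real_derivative g' t \<bullet> a) (at t)" for a t
    unfolding has_real_derivative_iff_has_vector_derivative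
    by (rule bounded_linear.has_vector_derivative[OF bounded_linear_inner_left g(1)])
  obtain \<Theta> \<Theta>' where \<Theta>: "\<And>t. (\<Theta> has_real_derivative \<Theta>' t) (at t)" "continuous_on UNIV \<Theta>'"
    "\<And>t. g' t = norm (g' t) *\<^sub>R edir (\<Theta> t)"
    using polar_lift[OF g(2,3) nz] by blast
  have \<Theta>c: "continuous_on UNIV \<Theta>" using \<Theta>(1) by (meson DERIV_continuous_on has_field_derivative_at_within)
  \<comment> \<open>the gap of the curve point for the normal obtained by turning the tangent to side \<open>\<sigma>\<close>\<close>
  define F where "F \<sigma> t = p (\<Theta> t - \<sigma> * pi/2) - \<gamma> t \<bullet> edir (\<Theta> t - \<sigma> * pi/2)" for \<sigma> t
  have Fc: "continuous_on UNIV (F \<sigma>)" for \<sigma>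
    unfolding F_def inner_2 edir_nth
    by (intro continuous_intros continuous_on_compose2[OF pc[of UNIV]] \<Theta>c g0cont) auto
  have F_nonneg: "F \<sigma> t \<ge> 0" for \<sigma> t using supp(1)[OF \<gamma>K] by (simp add: F_def)
  have F_or: "F 1 t = 0 \<or> F (-1) t = 0" for t
  proof -
    obtain \<phi> where \<phi>: "\<gamma> t \<bullet> edir \<phi> = p \<phi>"
      using frontier_support_direction[OF K(1) Kne K(2) \<gamma>fr] pc[of UNIV] p by metis
    have "g' t \<bullet> edir \<phi> = 0"
      by (rule DERIV_local_max[OF dd[of "edir \<phi>" t], of 1]) (use \<phi> supp(1)[OF \<gamma>K] in auto)
    then have "cos (\<phi> - \<Theta> t) = 0" using nz[of t]
      by (subst (asm) \<Theta>(3)) (simp add: frame_inner)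
    then obtain n :: int where n: "\<phi> - \<Theta> t = of_int n * pi + pi / 2" unfolding cos_zero_iff_int2 by blast
    show ?thesis
    proof (cases "even n")
      case True
      then obtain m where m: "n = 2 * m" by blast
      have e: "\<phi> = (\<Theta> t - (-1) * pi/2) + 2 * pi * of_int m" using n m by (simp add: algebra_simps)
      have "edir \<phi> = edir (\<Theta> t - (-1) * pi/2)" "p \<phi> = p (\<Theta> t - (-1) * pi/2)"
        unfolding e using sin_int_2pin[of m] cos_int_2pin[of m]
        by (simp_all add: p support_function_def edir_def sin_add[of _ "2 * pi * of_int m"] cos_add[of _ "2 * pi * of_int m"])
      then have "F (-1) t = 0" using \<phi> by (simp add: F_def)
      then show ?thesis ..
    next
      case False
      then obtain m where m: "n = 2 * m + 1" using oddE by blast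
      have e: "\<phi> = (\<Theta> t - 1 * pi/2) + 2 * pi * of_int (m + 1)" using n m by (simp add: algebra_simps)
      have "edir \<phi> = edir (\<Theta> t - 1 * pi/2)" "p \<phi> = p (\<Theta> t - 1 * pi/2)"
        unfolding e using sin_int_2pin[of "m+1"] cos_int_2pin[of "m+1"]
        by (simp_all add: p support_function_def edir_def sin_add[of _ "2 * pi * of_int (m+1)"] cos_add[of _ "2 * pi * of_int (m+1)"]
            del: of_int_add)
      then have "F 1 t = 0" using \<phi> by (simp add: F_def)
      then show ?thesis ..
    qed
  qed
  have F_not_both: "F 1 t - F (-1) t \<noteq> 0" for t
  proof
    assume "F 1 t - F (-1) t = 0"
    with F_or[of t] have z: "F 1 t = 0" "F (-1) t = 0" by auto
    let ?\<phi> = "\<Theta> t - pi / 2"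
    have e: "\<Theta> t + pi / 2 = ?\<phi> + pi" by simp
    have "p (\<Theta> t + pi / 2) = \<gamma> t \<bullet> edir (\<Theta> t + pi / 2)" "p ?\<phi> = \<gamma> t \<bullet> edir ?\<phi>"
      using z by (simp_all add: F_def)
    then have "p ?\<phi> + p (?\<phi> + pi) = 0" unfolding e edir_add_pi by simp
    with width[of ?\<phi>] show False by simp
  qed
  have "continuous_on UNIV (\<lambda>t. F 1 t - F (-1) t)" by (intro continuous_intros Fc)
  from nonzero_continuous_sign[OF this F_not_both]
  obtain \<sigma> :: real where \<sigma>: "\<sigma> = 1 \<or> \<sigma> = -1" "\<And>t. F \<sigma> t = 0"
    using F_or F_nonneg by (metis diff_gt_0_iff_gt diff_less_0_iff_less not_less)
  define \<theta> where "\<theta> t = \<Theta> t - \<sigma> * pi / 2" for t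
  have d\<theta>: "(\<theta> has_real_derivative \<Theta>' t) (at t)" for t
    unfolding \<theta>_def by (auto intro!: derivative_eq_intros \<Theta>(1))
  have g'\<theta>: "g' t = (\<sigma> * norm (g' t)) *\<^sub>R eperp (\<theta> t)" for t
  proof -
    have "edir (\<Theta> t) = \<sigma> *\<^sub>R eperp (\<theta> t)"
      using \<sigma>(1) by (auto simp: \<theta>_def vec_eq_iff forall_2 sin_add cos_add sin_diff cos_diff)
    with \<Theta>(3)[of t] show ?thesis by (metis mult.commute scaleR_scaleR)
  qed
  have \<gamma>edir: "\<gamma> t \<bullet> edir (\<theta> t) = p (\<theta> t)" for t using \<sigma>(2)[of t] by (simp add: F_def \<theta>_def)
  \<comment> \<open>at the outer normal the gap of the curve point attains its minimum zero\<close>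
  have \<gamma>eperp: "\<gamma> t \<bullet> eperp (\<theta> t) = p1 (\<theta> t)" for t
  proof -
    have "((\<lambda>\<phi>. p \<phi> - \<gamma> t \<bullet> edir \<phi>) has_real_derivative p1 (\<theta> t) - \<gamma> t \<bullet> eperp (\<theta> t)) (at (\<theta> t))"
      by (auto intro!: derivative_eq_intros pd)
    then have "p1 (\<theta> t) - \<gamma> t \<bullet> eperp (\<theta> t) = 0"
      by (rule DERIV_local_min[where d = 1]) (use \<gamma>edir supp(1)[OF \<gamma>K] in auto)
    then show ?thesis by simp
  qed
  show thesis by (rule that[OF d\<theta> \<Theta>(2) \<sigma>(1) g'\<theta> \<gamma>edir \<gamma>eperp])
qed

text \<open>By the previous lemma the curve is the contact point at its normal angle \<open>\<theta>\<close>. Differentiating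
  this relation shows that the speed is, up to sign, the radius of curvature times the angular velocity,
  so neither vanishes. Hence \<open>\<theta>\<close> is strictly monotone, and because the curve is simple it makes exactly one turn. The
  change of variables \<open>\<phi> = \<theta> t\<close> then turns the length into the integral of \<open>p + p''\<close> over a period,
  which is that of \<open>p\<close> (Cauchy's formula).\<close>
lemma boundary_support_parametrization:
  fixes K :: "(real^2) set" and \<gamma> :: "real \<Rightarrow> real^2" and p :: "real \<Rightarrow> real"
  assumes K: "compact K" "convex K" and \<gamma>: "C2_boundary_parametrization \<gamma> K"
    and p: "p = support_function K" "C2_function p"
  obtains p1 p2 \<theta> where "smooth_support p p1 p2" "K = smooth_support.body p"
    "\<And>t. \<gamma> t = smooth_support.contact p p1 (\<theta> t)"
    "\<And>t. tangent_line \<gamma> t = {x. smooth_support.gap p x (\<theta> t) = 0}"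
    "\<And>\<phi>. \<exists>t. \<exists>n::int. \<theta> t = \<phi> + 2*pi * of_int n"
    "closed_curve_length \<gamma> = integral {0..2*pi} p"
proof -
  obtain g' g'' where g: "\<And>t. (\<gamma> has_vector_derivative g' t) (at t)" "\<And>t. (g' has_vector_derivative g'' t) (at t)"
     "continuous_on UNIV g''"
    using \<gamma> unfolding C2_boundary_parametrization_def C2_function_def by blast
  have vd: "vector_derivative \<gamma> (at t) = g' t" for t using g(1) by (rule vector_derivative_at)
  have per: "\<gamma> (t + 1) = \<gamma> t" and nz: "g' t \<noteq> 0" for t
    using \<gamma> unfolding C2_boundary_parametrization_def vd by auto
  have loop: "loop_free \<gamma>" and fr: "path_image \<gamma> = frontier K"
    using \<gamma> unfolding C2_boundary_parametrization_def simple_path_def by auto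
  have "closed K" using K compact_imp_closed by blast
  have \<gamma>01: "\<gamma> t \<in> frontier K" if "t \<in> {0..1}" for t using that fr by (auto simp: path_image_def)
  have \<gamma>fr: "\<gamma> t \<in> frontier K" for t
  proof -
    obtain n :: int where n: "0 \<le> t + 1 * of_int n" "t + 1 * of_int n < 0 + 1"
      using reduce_mod_period[of 1 0 t] by auto
    have "\<gamma> t = \<gamma> (t + 1 * of_int n)" by (simp only: periodic_add_int[of \<gamma> 1, OF per])
    also have "\<dots> \<in> frontier K" using n by (intro \<gamma>01) auto
    finally show ?thesis .
  qed
  have \<gamma>K: "\<gamma> t \<in> K" for t using \<gamma>fr[of t] \<open>closed K\<close> frontier_subset_closed by blast
  then have Kne: "K \<noteq> {}" by auto
  note supp = support_function_props[OF K(1) Kne, folded p(1)]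
  have Kp: "K = {x. \<forall>\<phi>. x \<bullet> edir \<phi> \<le> p \<phi>}"
    using convex_body_eq_support_halfspaces[OF K(1) Kne K(2)] p(1) by simp
  obtain p1 p2 where pd: "\<And>x. (p has_real_derivative p1 x) (at x)" "\<And>x. (p1 has_real_derivative p2 x) (at x)"
     "continuous_on UNIV p2"
    using p(2) unfolding C2_function_def has_real_derivative_iff_has_vector_derivative by blast
  have pper: "p (x + 2*pi) = p x" for x unfolding p(1) support_function_def by simp
  have p1per: "p1 (x + 2*pi) = p1 x" and p2per: "p2 (x + 2*pi) = p2 x" for x
    using periodic_derivative[OF pd(1) pper] periodic_derivative[OF pd(2)] by blast+
  have pc: "continuous_on S p" "continuous_on S p1" for S
    using pd(1,2) by (meson DERIV_continuous_on has_field_derivative_at_within)+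
  have g'cont: "continuous_on UNIV g'"
    using g(2) by (meson continuous_at_imp_continuous_on has_vector_derivative_continuous)
  have dd: "((\<lambda>t. \<gamma> t \<bullet> a) has_real_derivative g' t \<bullet> a) (at t)" for a t
    unfolding has_real_derivative_iff_has_vector_derivative
    by (rule bounded_linear.has_vector_derivative[OF bounded_linear_inner_left g(1)])
  \<comment> \<open>zero width in some direction would confine the curve to a line\<close>
  have width: "p \<phi> + p (\<phi> + pi) > 0" for \<phi>
  proof (rule ccontr)
    assume "\<not> ?thesis"
    then have w: "p \<phi> + p (\<phi> + pi) \<le> 0" by simp
    have "\<gamma> t \<bullet> edir \<phi> = p \<phi>" for t
    proof -
      have "\<gamma> t \<bullet> edir \<phi> \<le> p \<phi>" "\<gamma> t \<bullet> edir (\<phi> + pi) \<le> p (\<phi> + pi)" by (intro supp(1) \<gamma>K)+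
      then show ?thesis using w unfolding edir_add_pi by (simp add: inner_minus_right)
    qed
    then show False using regular_closed_curve_not_in_line[OF g(1) nz per] by blast
  qed
  obtain \<theta> \<Theta>' \<sigma> where d\<theta>: "\<And>t. (\<theta> has_real_derivative \<Theta>' t) (at t)"
    and \<Theta>'c: "continuous_on UNIV \<Theta>'" and \<sigma>: "\<sigma> = 1 \<or> \<sigma> = -1"
    and g'\<theta>: "\<And>t. g' t = (\<sigma> * norm (g' t)) *\<^sub>R eperp (\<theta> t)"
    and \<gamma>edir: "\<And>t. \<gamma> t \<bullet> edir (\<theta> t) = p (\<theta> t)" and \<gamma>eperp: "\<And>t. \<gamma> t \<bullet> eperp (\<theta> t) = p1 (\<theta> t)"
    using outer_normal_angle[OF K \<gamma>fr g nz p(1) pd(1) width] by blast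
  have \<theta>c: "continuous_on S \<theta>" for S using d\<theta> by (meson DERIV_continuous_on has_field_derivative_at_within)
  define z where "z \<phi> = p \<phi> *\<^sub>R edir \<phi> + p1 \<phi> *\<^sub>R eperp \<phi>" for \<phi>
  have \<gamma>z: "\<gamma> t = z (\<theta> t)" for t
    using frame_expansion[of "\<gamma> t" "\<theta> t"] by (simp add: z_def \<gamma>edir \<gamma>eperp)
  define \<rho> where "\<rho> \<phi> = p \<phi> + p2 \<phi>" for \<phi>
  have speed: "\<sigma> * norm (g' t) = \<rho> (\<theta> t) * \<Theta>' t" for t
  proof -
    have "((\<lambda>s. z (\<theta> s) \<bullet> a) has_real_derivative (\<rho> (\<theta> t) * \<Theta>' t) * (a \<bullet> eperp (\<theta> t))) (at t)" for a
      unfolding z_def \<rho>_def inner_add_left inner_scaleR_left inner_commute[of _ a]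
      by (auto intro!: derivative_eq_intros d\<theta> DERIV_chain2[OF pd(1) d\<theta>] DERIV_chain2[OF pd(2) d\<theta>] simp: algebra_simps)
    from DERIV_unique[OF this[of "eperp (\<theta> t)", folded \<gamma>z] dd]
    have "g' t \<bullet> eperp (\<theta> t) = \<rho> (\<theta> t) * \<Theta>' t" by simp
    moreover have "g' t \<bullet> eperp (\<theta> t) = \<sigma> * norm (g' t)" by (subst g'\<theta>) simp
    ultimately show ?thesis by simp
  qed
  have nzz: "\<rho> (\<theta> t) \<noteq> 0" "\<Theta>' t \<noteq> 0" for t
    using speed[of t] nz[of t] \<sigma> by auto
  obtain \<tau> :: real where \<tau>: "\<tau> = 1 \<or> \<tau> = -1" "\<And>t. \<tau> * \<Theta>' t > 0"
    using nonzero_continuous_sign[OF \<Theta>'c nzz(2)] by (metis mult_1 mult_minus1 neg_0_less_iff_less)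
  have mono: "\<tau> * \<theta> s < \<tau> * \<theta> t" if "s < t" for s t
    by (rule DERIV_pos_imp_increasing[OF that]) (use \<tau>(2) DERIV_cmult[OF d\<theta>] in blast)
  have turn: "\<theta> 1 = \<theta> 0 + 2 * pi * \<tau>"
  proof -
    have "g' 1 = g' 0"
    proof -
      have "((\<lambda>t. \<gamma> (t + 1)) has_vector_derivative g' 1) (at 0)"
        using g(1)[of 1] vector_diff_chain_at[of "\<lambda>t. t + 1" 1 0 \<gamma> "g' 1"]
        by (simp add: o_def has_vector_derivative_add_const)
      then show ?thesis unfolding per using g(1) vector_derivative_unique_at by blast
    qed
    then have "eperp (\<theta> 1) = eperp (\<theta> 0)"
      using g'\<theta>[of 1] g'\<theta>[of 0] nz[of 0] \<sigma> by (metis mult_eq_0_iff norm_eq_zero scaleR_cancel_left one_neq_zero zero_neq_neg_one)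
    then have "sin (\<theta> 1) = sin (\<theta> 0)" "cos (\<theta> 1) = cos (\<theta> 0)" by (metis eperp_nth neg_equal_iff_equal)+
    then obtain n :: int where n: "\<theta> 1 = \<theta> 0 + 2 * pi * of_int n"
      by (metis sin_cos_eq_iff)
    have "\<tau> * of_int n > 0" using mono[of 0 1] n \<tau>(1) by (auto simp: algebra_simps zero_less_mult_iff mult_less_0_iff)
    \<comment> \<open>with two or more turns the curve would pass its initial point again before time 1\<close>
    moreover have "\<tau> * of_int n < 2"
    proof (rule ccontr)
      assume big: "\<not> \<tau> * of_int n < 2"
      have "\<exists>t\<ge>0. t \<le> 1 \<and> \<tau> * \<theta> t = \<tau> * \<theta> 0 + 2*pi"
      proof (rule IVT')
        show "\<tau> * \<theta> 0 + 2*pi \<le> \<tau> * \<theta> 1"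
          using big mult_left_mono[of 2 "\<tau> * of_int n" "2*pi"] by (simp add: n algebra_simps)
        show "continuous_on {0..1} (\<lambda>t. \<tau> * \<theta> t)" by (intro continuous_intros \<theta>c)
      qed auto
      then obtain t where t: "0 \<le> t" "t \<le> 1" "\<tau> * \<theta> t = \<tau> * \<theta> 0 + 2*pi" by blast
      have "2*pi < \<tau> * of_int n * (2*pi)" using big pi_gt_zero by (smt (verit) mult_less_cancel_right1)
      then have "t \<noteq> 1" "t \<noteq> 0" using t(3) n by (auto simp: algebra_simps)
      moreover have "\<gamma> t = \<gamma> 0"
      proof -
        have "\<theta> t = \<theta> 0 + 2 * pi \<or> \<theta> 0 = \<theta> t + 2 * pi" using t(3) \<tau>(1) by auto
        moreover have "z (x + 2*pi) = z x" for x by (simp add: z_def pper p1per)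
        ultimately show ?thesis unfolding \<gamma>z by metis
      qed
      ultimately show False using loop t(1,2) unfolding loop_free_def by force
    qed
    ultimately have "of_int n = \<tau>" using \<tau>(1) by (auto simp flip: of_int_minus)
    then show ?thesis using n by simp
  qed
  have surj: "\<exists>t. \<exists>n::int. \<theta> t = \<phi> + 2*pi * of_int n" for \<phi>
  proof -
    obtain n :: int where n: "\<tau> * \<theta> 0 \<le> \<tau> * \<phi> + 2*pi * of_int n" "\<tau> * \<phi> + 2*pi * of_int n < \<tau> * \<theta> 0 + 2*pi"
      using reduce_mod_period[of "2*pi" "\<tau> * \<theta> 0" "\<tau> * \<phi>"] by auto
    have "\<exists>t\<ge>0. t \<le> 1 \<and> \<tau> * \<theta> t = \<tau> * \<phi> + 2*pi * of_int n"
    proof (rule IVT')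
      show "\<tau> * \<phi> + 2*pi * of_int n \<le> \<tau> * \<theta> 1" using n(2) \<tau>(1) turn by (auto simp: algebra_simps)
      show "continuous_on {0..1} (\<lambda>t. \<tau> * \<theta> t)" by (intro continuous_intros \<theta>c)
    qed (use n in auto)
    then obtain t where "\<tau> * \<theta> t = \<tau> * \<phi> + 2*pi * of_int n" by blast
    then have "\<theta> t = \<phi> + 2*pi * of_int n \<or> \<theta> t = \<phi> + 2*pi * of_int (-n)" using \<tau>(1) by auto
    then show ?thesis by blast
  qed
  have \<rho>per: "\<rho> (x + 2*pi * of_int n) = \<rho> x" for x and n :: int
    by (rule periodic_add_int) (simp add: \<rho>_def pper p2per)
  have \<rho>nz: "\<rho> x \<noteq> 0" for x using surj[of x] nzz(1) \<rho>per by metis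
  have \<rho>c: "continuous_on UNIV \<rho>" unfolding \<rho>_def by (intro continuous_intros pc pd)
  \<comment> \<open>A negative radius of curvature would, by comparison, make a width nonpositive.\<close>
  have \<rho>pos: "\<rho> x > 0" for x
  proof (rule ccontr)
    assume "\<not> \<rho> x > 0"
    with nonzero_continuous_sign[OF \<rho>c \<rho>nz] have neg: "\<rho> y < 0" for y by blast
    have neg': "p2 y \<le> - p y" for y using neg[of y] by (simp add: \<rho>_def)
    let ?g = "\<lambda>s. - (p (0 + s) - p 0 * cos s - p1 0 * sin s)"
    let ?g1 = "\<lambda>s. - (p1 (0 + s) + p 0 * sin s - p1 0 * cos s)"
    let ?g2 = "\<lambda>s. - (p2 (0 + s) + p 0 * cos s + p1 0 * sin s)"
    have "0 * (1 - cos pi) \<le> ?g pi"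
      by (rule sine_comparison[where g = ?g and ?g1.0 = ?g1 and ?g2.0 = ?g2])
        (use neg' in \<open>auto intro!: derivative_eq_intros pd simp: algebra_simps\<close>)
    with width[of 0] show False by simp
  qed
  interpret S: smooth_support p p1 p2
    by unfold_locales (use pd pper \<rho>pos in \<open>auto simp: \<rho>_def\<close>)
  have tl: "tangent_line \<gamma> t = {x. S.gap x (\<theta> t) = 0}" for t
  proof -
    let ?c = "\<sigma> * norm (g' t)"
    have c: "?c \<noteq> 0" using nz[of t] \<sigma> by auto
    have e: "\<gamma> t + s *\<^sub>R g' t = p (\<theta> t) *\<^sub>R edir (\<theta> t) + (p1 (\<theta> t) + s * ?c) *\<^sub>R eperp (\<theta> t)" for s
      by (subst g'\<theta>) (simp add: \<gamma>z z_def algebra_simps)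
    show ?thesis
    proof (intro equalityI subsetI)
      fix x assume "x \<in> tangent_line \<gamma> t"
      then obtain s where "x = \<gamma> t + s *\<^sub>R g' t" by (auto simp: tangent_line_def vd)
      then show "x \<in> {x. S.gap x (\<theta> t) = 0}" unfolding e by (simp add: S.gap_def inner_add_left)
    next
      fix x assume "x \<in> {x. S.gap x (\<theta> t) = 0}"
      then have "x \<bullet> edir (\<theta> t) = p (\<theta> t)" by (simp add: S.gap_def)
      then have "x = \<gamma> t + ((x \<bullet> eperp (\<theta> t) - p1 (\<theta> t)) / ?c) *\<^sub>R g' t"
        unfolding e using c by (subst frame_expansion[of x "\<theta> t"]) simp
      then show "x \<in> tangent_line \<gamma> t" unfolding tangent_line_def vd by blast
    qed
  qed
  have L: "closed_curve_length \<gamma> = integral {0..2*pi} p"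
  proof -
    obtain Q where Q: "\<And>x. (Q has_vector_derivative p x) (at x)"
      using continuous_antiderivative[OF pc(1)] by blast
    define G where "G x = Q x + p1 x" for x
    have dG: "(G has_real_derivative \<rho> x) (at x)" for x
      unfolding G_def \<rho>_def by (intro DERIV_add pd) (use Q in \<open>simp add: has_real_derivative_iff_has_vector_derivative\<close>)
    have sp: "norm (g' t) = \<tau> * (\<rho> (\<theta> t) * \<Theta>' t)" for t
    proof -
      have "norm (g' t) = \<bar>\<rho> (\<theta> t) * \<Theta>' t\<bar>" unfolding speed[symmetric] using \<sigma> by auto
      also have "\<dots> = \<rho> (\<theta> t) * \<bar>\<Theta>' t\<bar>" using \<rho>pos[of "\<theta> t"] by (simp add: abs_mult)
      also have "\<bar>\<Theta>' t\<bar> = \<tau> * \<Theta>' t" using \<tau>(1) \<tau>(2)[of t] by auto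
      finally show ?thesis by simp
    qed
    have "((\<lambda>t. norm (g' t)) has_integral (\<tau> * G (\<theta> 1) - \<tau> * G (\<theta> 0))) {0..1}"
      by (rule fundamental_theorem_of_calculus)
        (auto simp: sp has_real_derivative_iff_has_vector_derivative[symmetric]
          intro!: DERIV_cmult has_field_derivative_at_within[OF DERIV_chain2[OF dG d\<theta>]])
    then have "closed_curve_length \<gamma> = \<tau> * G (\<theta> 1) - \<tau> * G (\<theta> 0)"
      unfolding closed_curve_length_def vd
      by (subst set_borel_integral_eq_integral(2)[OF borel_integrable_atLeastAtMost'])
        (auto intro!: continuous_intros continuous_on_subset[OF g'cont] simp: has_integral_iff)
    also have "\<dots> = integral {0..2*pi} p"
    proof -
      have "G (x + 2*pi) - G x = integral {0..2*pi} p" for x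
      proof -
        have "(p has_integral (Q (x + 2*pi) - Q x)) {x..x+2*pi}"
          by (rule fundamental_theorem_of_calculus) (auto intro: has_vector_derivative_at_within Q)
        moreover have "integral {x..x+2*pi} p = integral {0..2*pi} (\<lambda>y. p (y + x))"
          using integral_shift_real_ivl[where a = x and b = "x+2*pi" and c = x and f = p] by simp
        ultimately show ?thesis
          using integral_periodic_shift[OF pc(1) pper, of x] by (simp add: G_def S.p1_per has_integral_iff)
      qed
      from this[of "\<theta> 0"] this[of "\<theta> 1"] show ?thesis using turn \<tau>(1) by auto
    qed
    finally show ?thesis .
  qed
  show thesis
  proof (rule that[of p1 p2 \<theta>])
    show "smooth_support p p1 p2" by (rule S.smooth_support_axioms)
    show "K = S.body" using Kp by (simp add: S.body_def)
    show "\<gamma> t = S.contact (\<theta> t)" for t by (simp add: S.contact_def \<gamma>z z_def)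
  qed (use tl surj L in auto)
qed

section \<open>Change of variables between tangent pairs and exterior points\<close>

lemma has_derivative_vec2:
  fixes f :: "'a::real_normed_vector \<Rightarrow> real^2"
  assumes "((\<lambda>v. f v $ 1) has_derivative (\<lambda>h. f' h $ 1)) (at x within S)"
    and "((\<lambda>v. f v $ 2) has_derivative (\<lambda>h. f' h $ 2)) (at x within S)"
  shows "(f has_derivative f') (at x within S)"
proof (subst has_derivative_componentwise_within, rule ballI)
  fix i :: "real^2" assume "i \<in> Basis"
  then obtain j where "i = axis j 1" by (auto simp: Basis_vec_def)
  then show "((\<lambda>x. f x \<bullet> i) has_derivative (\<lambda>x. f' x \<bullet> i)) (at x within S)"
    using assms exhaust_2[of j] by (auto simp: inner_axis)
qed

lemma continuous_on_swap_vec2: "continuous_on A (\<lambda>z::real \<times> real. vector [snd z, fst z] :: real^2)"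
proof (rule continuous_on_vec_lambda[where f = "\<lambda>i z. (vector [snd z, fst z] :: real^2) $ i", simplified])
  fix i :: 2 show "continuous_on A (\<lambda>z::real \<times> real. (vector [snd z, fst z] :: real^2) $ i)"
    using exhaust_2[of i] continuous_on_fst[OF continuous_on_id, of A] continuous_on_snd[OF continuous_on_id, of A] by auto
qed

text \<open>The components are swapped so that iterated integration has the visual angle, the second parameter,
  as its outer variable.\<close>
lemma lborel_vec2_distr:
  "(lborel :: (real^2) measure) = distr (lborel :: (real \<times> real) measure) borel (\<lambda>z. vector [snd z, fst z])"
proof (rule lborel_eqI)
  let ?T = "\<lambda>z::real \<times> real. vector [snd z, fst z] :: real^2"
  have meas[measurable]: "?T \<in> borel_measurable borel"
    by (rule borel_measurable_continuous_onI[OF continuous_on_swap_vec2])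
  fix l u :: "real^2" assume le: "\<And>b. b \<in> Basis \<Longrightarrow> l \<bullet> b \<le> u \<bullet> b"
  have le': "l $ i \<le> u $ i" for i using le[of "axis i 1"] by (simp add: inner_axis)
  have pre: "?T -` box l u = {l $ 2<..<u $ 2} \<times> {l $ 1<..<u $ 1}"
    by (auto simp: mem_box_cart forall_2)
  have "emeasure (distr lborel borel ?T) (box l u) = emeasure lborel (?T -` box l u)"
    by (simp add: emeasure_distr)
  also have "\<dots> = emeasure (lborel \<Otimes>\<^sub>M lborel) ({l $ 2<..<u $ 2} \<times> {l $ 1<..<u $ 1})"
    by (simp add: pre lborel_prod)
  also have "\<dots> = ennreal (u $ 2 - l $ 2) * ennreal (u $ 1 - l $ 1)"
    using le' by (simp add: lborel.emeasure_pair_measure_Times)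
  also have "\<dots> = ennreal (\<Prod>i\<in>UNIV. (u - l) $ i)"
    using le' by (simp add: UNIV_2 ennreal_mult' mult.commute)
  also have "(\<Prod>i\<in>UNIV. (u - l) $ i) = (\<Prod>b\<in>Basis. (u - l) \<bullet> b)"
  proof -
    have inj: "inj (\<lambda>i::2. axis i (1::real))" by (auto simp: inj_on_def axis_eq_axis)
    have B: "(Basis :: (real^2) set) = range (\<lambda>i. axis i 1)" by (auto simp: Basis_vec_def)
    have "(\<Prod>b\<in>Basis. (u - l) \<bullet> b) = (\<Prod>i\<in>UNIV. (u - l) \<bullet> axis i 1)"
      unfolding B by (subst prod.reindex[OF inj]) (simp add: o_def)
    then show ?thesis by (simp add: inner_axis)
  qed
  finally show "emeasure (distr lborel borel ?T) (box l u) = ennreal (\<Prod>b\<in>Basis. (u - l) \<bullet> b)" .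
qed simp

text \<open>The change of variables theorem for real-valued integrands, by viewing the reals as
  \<^typ>\<open>real^1\<close>.\<close>
lemma real_change_of_variables:
  fixes f :: "real^'m::{finite,wellorder} \<Rightarrow> real" and g :: "real^'m::_ \<Rightarrow> real^'m::_"
  assumes S: "S \<in> sets lebesgue"
    and der_g: "\<And>x. x \<in> S \<Longrightarrow> (g has_derivative g' x) (at x within S)"
    and inj: "inj_on g S"
    and int: "(\<lambda>x. \<bar>det (matrix (g' x))\<bar> * f (g x)) absolutely_integrable_on S"
  shows "f absolutely_integrable_on (g ` S)"
    and "integral (g ` S) f = integral S (\<lambda>x. \<bar>det (matrix (g' x))\<bar> * f (g x))"
proof -
  have "(\<lambda>x. \<bar>det (matrix (g' x))\<bar> *\<^sub>R (vec (f (g x)) :: real^1)) absolutely_integrable_on S"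
    unfolding absolutely_integrable_on_1_iff using int by simp
  then have "(\<lambda>x. vec (f x) :: real^1) absolutely_integrable_on (g ` S) \<and>
      integral (g ` S) (\<lambda>x. vec (f x) :: real^1) = integral S (\<lambda>x. \<bar>det (matrix (g' x))\<bar> *\<^sub>R vec (f (g x)))"
    using has_absolute_integral_change_of_variables[OF S der_g inj, where f = "\<lambda>x. vec (f x) :: real^1"] by blast
  then show "f absolutely_integrable_on (g ` S)"
    "integral (g ` S) f = integral S (\<lambda>x. \<bar>det (matrix (g' x))\<bar> * f (g x))"
    unfolding absolutely_integrable_on_1_iff integral_on_1_eq by (simp_all add: vec_eq_iff)
qed

context smooth_support
begin

text \<open>The parameters are the normal angle of the first tangent and the visual angle.\<close>
definition crossing_map :: "real^2 \<Rightarrow> real^2" where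
  "crossing_map v = crossing (v $ 1) (v $ 2)"

definition crossing_deriv :: "real^2 \<Rightarrow> real^2 \<Rightarrow> real^2" where
  "crossing_deriv v h =
     (let \<phi> = v $ 1; \<omega> = v $ 2; r1 = (p1 (\<phi> + pi - \<omega>) + p1 \<phi> * cos \<omega>) / sin \<omega>; r2 = - seg2 \<phi> \<omega> / (sin \<omega>)\<^sup>2
      in h $ 1 *\<^sub>R ((p1 \<phi> - reach \<phi> \<omega>) *\<^sub>R edir \<phi> + (p \<phi> + r1) *\<^sub>R eperp \<phi>) + (h $ 2 * r2) *\<^sub>R eperp \<phi>)"

lemma crossing_has_derivative:
  assumes "0 < v $ 2" "v $ 2 < pi"
  shows "(crossing_map has_derivative crossing_deriv v) (at v within S)"
proof -
  have s: "sin (v $ 2) > 0" using assms by (simp add: sin_gt_zero)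
  have 1: "((\<lambda>v. v $ i) has_derivative (\<lambda>h. h $ i)) (at v within S)" for i :: 2
    by (rule bounded_linear_imp_has_derivative[OF bounded_linear_vec_nth])
  have P: "((\<lambda>v. p (v $ 1)) has_derivative (\<lambda>h. h $ 1 * p1 (v $ 1))) (at v within S)"
    by (rule DERIV_compose_FDERIV[OF p_deriv 1])
  have P2: "((\<lambda>v. p (v $ 1 + pi - v $ 2)) has_derivative (\<lambda>h. (h $ 1 - h $ 2) * p1 (v $ 1 + pi - v $ 2))) (at v within S)"
    by (rule DERIV_compose_FDERIV[OF p_deriv]) (auto intro!: derivative_eq_intros 1)
  have C: "((\<lambda>v. cos (v $ i)) has_derivative (\<lambda>h. h $ i * - sin (v $ i))) (at v within S)"
    and Sn: "((\<lambda>v. sin (v $ i)) has_derivative (\<lambda>h. h $ i * cos (v $ i))) (at v within S)" for i :: 2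
    by (rule DERIV_compose_FDERIV[OF _ 1], simp)+
  define r1 r2 where "r1 = (p1 (v $ 1 + pi - v $ 2) + p1 (v $ 1) * cos (v $ 2)) / sin (v $ 2)"
    and "r2 = - seg2 (v $ 1) (v $ 2) / (sin (v $ 2))\<^sup>2"
  have R: "((\<lambda>v. reach (v $ 1) (v $ 2)) has_derivative (\<lambda>h. h $ 1 * r1 + h $ 2 * r2)) (at v within S)"
  proof -
    let ?N = "p (v $ 1 + pi - v $ 2) + p (v $ 1) * cos (v $ 2)"
    let ?N' = "\<lambda>h. (h $ 1 - h $ 2) * p1 (v $ 1 + pi - v $ 2) + (p (v $ 1) * (h $ 2 * - sin (v $ 2)) + h $ 1 * p1 (v $ 1) * cos (v $ 2))"
    have "((\<lambda>v. reach (v $ 1) (v $ 2)) has_derivative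
       (\<lambda>h. (?N' h * sin (v $ 2) - ?N * (h $ 2 * cos (v $ 2))) / (sin (v $ 2) * sin (v $ 2)))) (at v within S)"
      unfolding reach_def
      by (rule has_derivative_divide'[OF has_derivative_add[OF P2 has_derivative_mult[OF P C]] Sn]) (use s in simp)
    moreover have "(?N' h * sin (v $ 2) - ?N * (h $ 2 * cos (v $ 2))) / (sin (v $ 2) * sin (v $ 2)) = h $ 1 * r1 + h $ 2 * r2" for h :: "real^2"
    proof -
      define c' s' where "c' = cos (v $ 2)" and "s' = sin (v $ 2)"
      have cs: "c' * c' + s' * s' = 1" using sin_cos_squared_add3[of "v $ 2"] by (simp add: c'_def s'_def)
      have s': "s' \<noteq> 0" using s by (simp add: s'_def)
      let ?a = "p (v $ 1 + pi - v $ 2)" and ?b = "p (v $ 1)" and ?a1 = "p1 (v $ 1 + pi - v $ 2)" and ?b1 = "p1 (v $ 1)"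
      have "((h $ 1 - h $ 2) * ?a1 + (?b * (h $ 2 * - s') + h $ 1 * ?b1 * c')) * s' - (?a + ?b * c') * (h $ 2 * c')
          = h $ 1 * (?a1 + ?b1 * c') * s' - h $ 2 * (?b + ?a * c' + ?a1 * s')"
        using cs by algebra
      then show ?thesis
        unfolding r1_def r2_def seg2_def c'_def[symmetric] s'_def[symmetric]
        using s' by (simp add: divide_simps power2_eq_square) (simp add: algebra_simps)
    qed
    ultimately show ?thesis by simp
  qed
  have D: "crossing_deriv v h = h $ 1 *\<^sub>R ((p1 (v $ 1) - reach (v $ 1) (v $ 2)) *\<^sub>R edir (v $ 1) + (p (v $ 1) + r1) *\<^sub>R eperp (v $ 1)) + (h $ 2 * r2) *\<^sub>R eperp (v $ 1)" for h
    by (simp add: crossing_deriv_def r1_def r2_def Let_def)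
  show ?thesis
  proof (rule has_derivative_vec2)
    show "((\<lambda>v. crossing_map v $ 1) has_derivative (\<lambda>h. crossing_deriv v h $ 1)) (at v within S)"
      unfolding crossing_map_def crossing_def D
      by (rule has_derivative_eq_rhs, simp, rule has_derivative_diff[OF has_derivative_mult[OF P C] has_derivative_mult[OF R Sn]])
        (auto simp: fun_eq_iff algebra_simps)
    show "((\<lambda>v. crossing_map v $ 2) has_derivative (\<lambda>h. crossing_deriv v h $ 2)) (at v within S)"
      unfolding crossing_map_def crossing_def D
      by (rule has_derivative_eq_rhs, simp, rule has_derivative_add[OF has_derivative_mult[OF P Sn] has_derivative_mult[OF R C]])
        (auto simp: fun_eq_iff algebra_simps)
  qed
qed

text \<open>Moving \<open>\<omega>\<close> slides the crossing point along the first tangent, so the determinant is the speed of this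
  motion times the normal component of the derivative in \<open>\<phi>\<close>. In terms of the segment lengths \<open>T\<^sub>1\<close> and \<open>T\<^sub>2\<close> this is the classical area element
  \<open>T\<^sub>1 T\<^sub>2 / sin \<omega> d\<phi> d\<omega>\<close> of Crofton.\<close>
lemma crossing_jacobian:
  assumes "0 < v $ 2" "v $ 2 < pi"
  shows "\<bar>det (matrix (crossing_deriv v))\<bar> = seg1 (v $ 1) (v $ 2) * seg2 (v $ 1) (v $ 2) / sin (v $ 2) ^ 3"
proof -
  have s: "sin (v $ 2) > 0" using assms by (simp add: sin_gt_zero)
  define c' s' where "c' = cos (v $ 1)" and "s' = sin (v $ 1)"
  have cs: "c' * c' + s' * s' = 1" using sin_cos_squared_add3[of "v $ 1"] by (simp add: c'_def s'_def)
  define r1 r2 where "r1 = (p1 (v $ 1 + pi - v $ 2) + p1 (v $ 1) * cos (v $ 2)) / sin (v $ 2)"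
    and "r2 = - seg2 (v $ 1) (v $ 2) / (sin (v $ 2))\<^sup>2"
  have D: "crossing_deriv v h = h $ 1 *\<^sub>R ((p1 (v $ 1) - reach (v $ 1) (v $ 2)) *\<^sub>R edir (v $ 1) + (p (v $ 1) + r1) *\<^sub>R eperp (v $ 1)) + (h $ 2 * r2) *\<^sub>R eperp (v $ 1)" for h
    by (simp add: crossing_deriv_def r1_def r2_def Let_def)
  have ax: "axis (1::2) (1::real) $ 1 = 1" "axis (1::2) (1::real) $ 2 = 0" "axis (2::2) (1::real) $ 1 = 0" "axis (2::2) (1::real) $ 2 = 1"
    by (simp_all add: axis_def)
  have "det (matrix (crossing_deriv v)) = (p1 (v $ 1) - reach (v $ 1) (v $ 2)) * r2"
    unfolding det_2 matrix_def D
    by (simp add: ax c'_def[symmetric] s'_def[symmetric]) (use cs in algebra)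
  also have "p1 (v $ 1) - reach (v $ 1) (v $ 2) = - seg1 (v $ 1) (v $ 2) / sin (v $ 2)"
    using s by (simp add: reach_def seg1_def field_simps)
  also have "- seg1 (v $ 1) (v $ 2) / sin (v $ 2) * r2 = seg1 (v $ 1) (v $ 2) * seg2 (v $ 1) (v $ 2) / sin (v $ 2) ^ 3"
    by (simp add: r2_def power2_eq_square power3_eq_cube)
  finally have e: "det (matrix (crossing_deriv v)) = seg1 (v $ 1) (v $ 2) * seg2 (v $ 1) (v $ 2) / sin (v $ 2) ^ 3" .
  have "\<dots> > 0" using seg_pos[of "v $ 2" "v $ 1"] assms s by simp
  then show ?thesis unfolding e by (rule abs_of_pos)
qed

definition params :: "(real^2) set" where
  "params = {v. 0 \<le> v $ 1 \<and> v $ 1 < 2*pi \<and> 0 < v $ 2 \<and> v $ 2 < pi}"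

lemma crossing_map_inj: 
  assumes "\<And>v. v \<in> A \<Longrightarrow> a \<le> v $ 1 \<and> v $ 1 < a + 2*pi \<and> 0 < v $ 2 \<and> v $ 2 < pi"
  shows "inj_on crossing_map A"
proof (rule inj_onI)
  fix v w assume vw: "v \<in> A" "w \<in> A" "crossing_map v = crossing_map w"
  from assms[OF vw(1)] assms[OF vw(2)] vw(3)
  have 2: "v $ 2 = w $ 2" and "\<exists>n::int. w $ 1 + 2*pi * of_int n = v $ 1"
    unfolding crossing_map_def by (auto dest: crossing_eqD)
  then obtain n :: int where n: "w $ 1 + 2*pi * of_int n = v $ 1" by blast
  then have less: "2*pi * of_int n < 2*pi * 1" "2*pi * (-1) < 2*pi * of_int n"
    using assms[OF vw(1)] assms[OF vw(2)] by linarith+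
  have "real_of_int n < 1" "-1 < real_of_int n"
    by (rule mult_less_cancel_left_pos[THEN iffD1, OF _ less(1)] mult_less_cancel_left_pos[THEN iffD1, OF _ less(2)], simp)+
  then have "n = 0" by simp
  with n 2 show "v = w" by (simp add: vec_eq_iff forall_2)
qed

lemma crossing_map_image: "crossing_map ` params = - body"
proof
  show "crossing_map ` params \<subseteq> - body"
    using crossing_notin_body by (auto simp: crossing_map_def params_def)
  show "- body \<subseteq> crossing_map ` params"
  proof
    fix P assume "P \<in> - body"
    then obtain \<phi> \<omega> where *: "0 < \<omega>" "\<omega> < pi" "P = crossing \<phi> \<omega>"
      by (metis ComplD notin_body_crossing)
    obtain n :: int where n: "0 \<le> \<phi> + 2*pi * of_int n" "\<phi> + 2*pi * of_int n < 0 + 2*pi"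
      using reduce_mod_period[of "2*pi" 0 \<phi>] by auto
    let ?v = "vector [\<phi> + 2*pi * of_int n, \<omega>] :: real^2"
    have "?v \<in> params" using * n by (simp add: params_def)
    moreover have "crossing_map ?v = P" using * by (simp add: crossing_map_def crossing_per_int)
    ultimately show "P \<in> crossing_map ` params" by blast
  qed
qed

text \<open>The preimage of an open set of angles is the image of an open set of parameters under the crossing map.
  That map is injective as long as \<open>\<phi>\<close> stays in an open interval of length \<open>2 \<pi>\<close>, so invariance of
  domain applies; two such intervals cover all tangent directions.\<close>
lemma continuous_on_visual:
  fixes ang :: "real^2 \<Rightarrow> real"
  assumes ang: "\<And>\<phi> \<omega>. 0 < \<omega> \<Longrightarrow> \<omega> < pi \<Longrightarrow> ang (crossing \<phi> \<omega>) = \<omega>"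
  shows "continuous_on (- body) ang"
  unfolding continuous_on_open_invariant
proof (intro allI impI)
  fix B :: "real set" assume "open B"
  define V where "V a = {v::real^2. a < v $ 1 \<and> v $ 1 < a + 2*pi \<and> v $ 2 \<in> B \<inter> {0<..<pi}}" for a
  have oV: "open (V a)" for a
  proof -
    have "V a = (\<lambda>v. v $ 1) -` {a<..<a+2*pi} \<inter> (\<lambda>v. v $ 2) -` (B \<inter> {0<..<pi})"
      by (auto simp: V_def)
    then show ?thesis
      using \<open>open B\<close> by (simp only:) (intro open_Int open_vimage continuous_intros open_greaterThanLessThan)
  qed
  have "open (crossing_map ` V a)" for a
  proof (rule invariance_of_domain[OF _ oV])
    show "continuous_on (V a) crossing_map"
      by (rule has_derivative_continuous_on[where f' = crossing_deriv]) (auto simp: V_def intro: crossing_has_derivative)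
    show "inj_on crossing_map (V a)" by (rule crossing_map_inj[where a = a]) (auto simp: V_def)
  qed
  then have "open (crossing_map ` V 0 \<union> crossing_map ` V pi)" by blast
  moreover have "(crossing_map ` V 0 \<union> crossing_map ` V pi) \<inter> - body = ang -` B \<inter> - body"
  proof (intro equalityI subsetI)
    fix P assume "P \<in> (crossing_map ` V 0 \<union> crossing_map ` V pi) \<inter> - body"
    then show "P \<in> ang -` B \<inter> - body" by (auto simp: V_def crossing_map_def ang)
  next
    fix P assume P: "P \<in> ang -` B \<inter> - body"
    then obtain v where v: "v \<in> params" "P = crossing_map v" using crossing_map_image by blast
    then have B: "v $ 2 \<in> B" using P by (auto simp: crossing_map_def params_def ang)
    show "P \<in> (crossing_map ` V 0 \<union> crossing_map ` V pi) \<inter> - body"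
    proof (cases "v $ 1 = 0")
      case True
      let ?w = "vector [2*pi, v $ 2] :: real^2"
      have "?w \<in> V pi" using v B by (simp add: V_def params_def)
      moreover have "crossing_map ?w = P"
        using crossing_per_int[of 0 1 "v $ 2"] v True by (simp add: crossing_map_def)
      ultimately show ?thesis using P by blast
    next
      case False
      then have "v \<in> V 0" using v B by (auto simp: V_def params_def)
      then show ?thesis using P v by blast
    qed
  qed
  ultimately show "\<exists>A. open A \<and> A \<inter> - body = ang -` B \<inter> - body" by blast
qed

lemma closed_body: "closed body"
proof -
  have "body = (\<Inter>\<phi>. {x. x \<bullet> edir \<phi> \<le> p \<phi>})" by (auto simp: body_def)
  then show ?thesis by (auto intro!: closed_INT closed_Collect_le continuous_intros)
qed

text \<open>Both segments are bounded by a multiple of \<open>1 + cos \<omega>\<close>, so the bound on \<open>f (1 + cos)\<^sup>2 / sin\<^sup>3\<close>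
  makes the transformed integrand bounded on a bounded rectangle; this gives integrability and justifies
  Fubini's theorem.\<close>
lemma area_integral:
  fixes ang :: "real^2 \<Rightarrow> real" and f :: "real \<Rightarrow> real"
  assumes ang: "\<And>\<phi> \<omega>. 0 < \<omega> \<Longrightarrow> \<omega> < pi \<Longrightarrow> ang (crossing \<phi> \<omega>) = \<omega>"
    and f: "continuous_on {0<..<pi} f"
    and bnd: "\<And>\<omega>. 0 < \<omega> \<Longrightarrow> \<omega> < pi \<Longrightarrow> \<bar>f \<omega> * (1 + cos \<omega>)\<^sup>2 / sin \<omega> ^ 3\<bar> \<le> C"
  shows "set_integrable lborel (- body) (\<lambda>P. f (ang P))"
    and "(LBINT P:- body. f (ang P)) =
       (LBINT \<omega>:{0<..<pi}. f \<omega> / sin \<omega> ^ 3 * integral {0..2*pi} (\<lambda>\<phi>. seg1 \<phi> \<omega> * seg2 \<phi> \<omega>))"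
proof -
  obtain M where M: "\<And>\<phi> \<omega>. 0 \<le> \<omega> \<Longrightarrow> \<omega> \<le> pi \<Longrightarrow> \<bar>seg1 \<phi> \<omega>\<bar> \<le> M * (1 + cos \<omega>)"
    "\<And>\<phi> \<omega>. 0 \<le> \<omega> \<Longrightarrow> \<omega> \<le> pi \<Longrightarrow> \<bar>seg2 \<phi> \<omega>\<bar> \<le> M * (1 + cos \<omega>)" using seg_bound by metis
  define H where "H \<omega> \<phi> = f \<omega> * seg1 \<phi> \<omega> * seg2 \<phi> \<omega> / sin \<omega> ^ 3" for \<omega> \<phi>
  define R where "R = {0<..<pi} \<times> {0..<2*pi}"
  let ?T = "\<lambda>z::real \<times> real. vector [snd z, fst z] :: real^2"
  have RT: "indicator params (?T z) = (indicator R z :: real)" for z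
    by (auto simp: R_def params_def indicator_def mem_Times_iff)
  have Rb[measurable]: "R \<in> sets borel" unfolding R_def borel_prod[symmetric] by measurable
  have Hc: "continuous_on R (\<lambda>z. H (fst z) (snd z))"
  proof -
    have fc: "continuous_on R (\<lambda>z. f (fst z))"
      by (rule continuous_on_compose2[OF f]) (auto simp: R_def intro: continuous_intros)
    have "sin (fst z) ^ 3 \<noteq> 0" if "z \<in> R" for z using that sin_gt_zero[of "fst z"] by (auto simp: R_def)
    then show ?thesis unfolding H_def seg1_def seg2_def by (intro continuous_intros fc) auto
  qed
  have Hm: "(\<lambda>z. indicator R z *\<^sub>R H (fst z) (snd z)) \<in> borel_measurable borel"
    by (rule borel_measurable_continuous_on_indicator[OF Rb Hc])
  have Hb: "\<bar>H \<omega> \<phi>\<bar> \<le> M\<^sup>2 * C" if "0 < \<omega>" "\<omega> < pi" for \<omega> \<phi>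
  proof -
    have "\<bar>seg1 \<phi> \<omega> * seg2 \<phi> \<omega>\<bar> \<le> (M * (1 + cos \<omega>)) * (M * (1 + cos \<omega>))"
      unfolding abs_mult using M[of \<omega> \<phi>] that by (intro mult_mono) auto
    then have "\<bar>f \<omega> / sin \<omega> ^ 3\<bar> * \<bar>seg1 \<phi> \<omega> * seg2 \<phi> \<omega>\<bar> \<le> \<bar>f \<omega> / sin \<omega> ^ 3\<bar> * ((M * (1 + cos \<omega>)) * (M * (1 + cos \<omega>)))"
      by (intro mult_left_mono) auto
    also have "\<dots> = M\<^sup>2 * \<bar>f \<omega> * (1 + cos \<omega>)\<^sup>2 / sin \<omega> ^ 3\<bar>"
      by (simp add: abs_mult power2_eq_square)
    also have "\<dots> \<le> M\<^sup>2 * C" using bnd[OF that] by (intro mult_left_mono) auto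
    finally show ?thesis by (simp add: H_def abs_mult mult_ac)
  qed
  have Hi: "integrable lborel (\<lambda>z. indicator R z *\<^sub>R H (fst z) (snd z))"
  proof (rule integrableI_bounded_set[where A = R and B = "M\<^sup>2 * C"])
    have "emeasure (lborel \<Otimes>\<^sub>M lborel) R < \<infinity>"
      unfolding R_def by (subst lborel.emeasure_pair_measure_Times) (auto simp: ennreal_mult_less_top)
    then show "emeasure lborel R < \<infinity>" by (simp add: lborel_prod)
    show "AE z in lborel. z \<in> R \<longrightarrow> norm (indicator R z *\<^sub>R H (fst z) (snd z)) \<le> M\<^sup>2 * C"
      using Hb by (auto simp: R_def)
  qed (use Hm in auto)
  have fub: "(\<integral>z. indicator R z *\<^sub>R H (fst z) (snd z) \<partial>lborel) =
      (LBINT \<omega>:{0<..<pi}. f \<omega> / sin \<omega> ^ 3 * integral {0..2*pi} (\<lambda>\<phi>. seg1 \<phi> \<omega> * seg2 \<phi> \<omega>))"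
  proof -
    have "(\<integral>z. indicator R z *\<^sub>R H (fst z) (snd z) \<partial>lborel) =
       (\<integral>\<omega>. (\<integral>\<phi>. indicator R (\<omega>, \<phi>) *\<^sub>R H \<omega> \<phi> \<partial>lborel) \<partial>lborel)"
      using lborel_pair.integral_fst'[of "\<lambda>z. indicator R z *\<^sub>R H (fst z) (snd z)"] Hi by (simp add: lborel_prod)
    also have "\<dots> = (LBINT \<omega>:{0<..<pi}. f \<omega> / sin \<omega> ^ 3 * integral {0..2*pi} (\<lambda>\<phi>. seg1 \<phi> \<omega> * seg2 \<phi> \<omega>))"
      unfolding set_lebesgue_integral_def
    proof (rule Bochner_Integration.integral_cong[OF refl])
      fix \<omega> :: real
      have "(\<integral>\<phi>. indicator R (\<omega>, \<phi>) *\<^sub>R H \<omega> \<phi> \<partial>lborel) =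
         (\<integral>\<phi>. indicator {0<..<pi} \<omega> * (f \<omega> / sin \<omega> ^ 3) * (indicator {0..<2*pi} \<phi> * (seg1 \<phi> \<omega> * seg2 \<phi> \<omega>)) \<partial>lborel)"
        by (intro Bochner_Integration.integral_cong) (auto simp: R_def H_def indicator_def)
      also have "\<dots> = indicator {0<..<pi} \<omega> * (f \<omega> / sin \<omega> ^ 3) * (\<integral>\<phi>. indicator {0..<2*pi} \<phi> * (seg1 \<phi> \<omega> * seg2 \<phi> \<omega>) \<partial>lborel)"
        by (rule integral_mult_right_zero)
      also have "(\<integral>\<phi>. indicator {0..<2*pi} \<phi> * (seg1 \<phi> \<omega> * seg2 \<phi> \<omega>) \<partial>lborel) = (LBINT \<phi>:{0..2*pi}. seg1 \<phi> \<omega> * seg2 \<phi> \<omega>)"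
        unfolding set_lebesgue_integral_def
      proof (rule integral_cong_AE)
        have c: "continuous_on UNIV (\<lambda>\<phi>. seg1 \<phi> \<omega> * seg2 \<phi> \<omega>)" unfolding seg1_def seg2_def by (intro continuous_intros)
        then have [measurable]: "(\<lambda>\<phi>. seg1 \<phi> \<omega> * seg2 \<phi> \<omega>) \<in> borel_measurable borel" by (rule borel_measurable_continuous_onI)
        show "(\<lambda>\<phi>. indicator {0..<2*pi} \<phi> * (seg1 \<phi> \<omega> * seg2 \<phi> \<omega>)) \<in> borel_measurable lborel"
          "(\<lambda>\<phi>. indicator {0..2*pi} \<phi> *\<^sub>R (seg1 \<phi> \<omega> * seg2 \<phi> \<omega>)) \<in> borel_measurable lborel" by measurable
        show "AE \<phi> in lborel. indicator {0..<2*pi} \<phi> * (seg1 \<phi> \<omega> * seg2 \<phi> \<omega>) = indicator {0..2*pi} \<phi> *\<^sub>R (seg1 \<phi> \<omega> * seg2 \<phi> \<omega>)"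
          using AE_lborel_singleton[of "2*pi"] by eventually_elim (auto simp: indicator_def)
      qed
      also have "\<dots> = integral {0..2*pi} (\<lambda>\<phi>. seg1 \<phi> \<omega> * seg2 \<phi> \<omega>)"
        by (rule set_borel_integral_eq_integral(2)[OF borel_integrable_atLeastAtMost'])
          (auto simp: seg1_def seg2_def intro!: continuous_intros)
      finally show "(\<integral>\<phi>. indicator R (\<omega>, \<phi>) *\<^sub>R H \<omega> \<phi> \<partial>lborel) =
          indicator {0<..<pi} \<omega> *\<^sub>R (f \<omega> / sin \<omega> ^ 3 * integral {0..2*pi} (\<lambda>\<phi>. seg1 \<phi> \<omega> * seg2 \<phi> \<omega>))" by simp
    qed
    finally show ?thesis .
  qed
  \<comment> \<open>the same integral over parameter vectors, where the change of variables takes place\<close>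
  define G where "G v = H (v $ 2) (v $ 1)" for v :: "real^2"
  have pB[measurable]: "params \<in> sets borel" unfolding params_def by measurable
  have Gm: "(\<lambda>v. indicator params v *\<^sub>R G v) \<in> borel_measurable borel"
  proof -
    have "(\<lambda>v::real^2. (v $ 2, v $ 1)) \<in> borel_measurable borel" by measurable
    from measurable_compose[OF this Hm] show ?thesis
      by (rule subst[where P = "\<lambda>f. f \<in> borel_measurable borel", rotated]) (auto simp: G_def R_def params_def indicator_def)
  qed
  have T: "?T \<in> measurable lborel borel"
    by (simp add: borel_measurable_continuous_onI[OF continuous_on_swap_vec2])
  have Gi: "set_integrable lborel params G"
    unfolding set_integrable_def
    by (subst lborel_vec2_distr, subst integrable_distr_eq[OF T Gm]) (use Hi in \<open>simp add: RT G_def\<close>)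
  have GI: "(LBINT v:params. G v) = (\<integral>z. indicator R z *\<^sub>R H (fst z) (snd z) \<partial>lborel)"
    unfolding set_lebesgue_integral_def
    by (subst lborel_vec2_distr, subst integral_distr[OF T Gm]) (simp add: RT G_def)
  have jac: "\<bar>det (matrix (crossing_deriv v))\<bar> * f (ang (crossing_map v)) = G v" if "v \<in> params" for v
    using that by (simp add: params_def crossing_jacobian crossing_map_def ang G_def H_def mult_ac)
  have abs: "(\<lambda>v. \<bar>det (matrix (crossing_deriv v))\<bar> * f (ang (crossing_map v))) absolutely_integrable_on params"
  proof -
    have "G absolutely_integrable_on params"
      using Gi Gm unfolding set_integrable_def by (simp add: integrable_completion)
    then show ?thesis by (rule absolutely_integrable_spike[where S = "{}"]) (use jac in auto)
  qed
  have params_leb: "params \<in> sets lebesgue" by (simp add: pB sets_completionI_sets)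
  have der: "(crossing_map has_derivative crossing_deriv v) (at v within params)" if "v \<in> params" for v
    using that by (intro crossing_has_derivative) (auto simp: params_def)
  have inj: "inj_on crossing_map params" by (rule crossing_map_inj[where a = 0]) (auto simp: params_def)
  note cv = real_change_of_variables[OF params_leb der inj, of "\<lambda>P. f (ang P)", OF _ abs, unfolded crossing_map_image]
  have fm: "(\<lambda>P. indicator (- body) P *\<^sub>R f (ang P)) \<in> borel_measurable borel"
  proof (rule borel_measurable_continuous_on_indicator)
    show "- body \<in> sets borel" using closed_body by auto
    have "ang P \<in> {0<..<pi}" if "P \<in> - body" for P
      using that ang by (auto elim: notin_body_crossing)
    then show "continuous_on (- body) (\<lambda>P. f (ang P))"
      by (intro continuous_on_compose2[OF f continuous_on_visual[OF ang]]) auto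
  qed
  show I: "set_integrable lborel (- body) (\<lambda>P. f (ang P))"
    using cv(1) fm unfolding set_integrable_def by (simp add: integrable_completion)
  have "(LBINT P:- body. f (ang P)) = integral (- body) (\<lambda>P. f (ang P))"
    by (rule set_borel_integral_eq_integral(2)[OF I])
  also have "\<dots> = integral params G"
    by (subst cv(2)) (auto intro: Henstock_Kurzweil_Integration.integral_cong jac)
  also have "\<dots> = (LBINT v:params. G v)"
    by (rule set_borel_integral_eq_integral(2)[OF Gi, symmetric])
  finally show "(LBINT P:- body. f (ang P)) =
       (LBINT \<omega>:{0<..<pi}. f \<omega> / sin \<omega> ^ 3 * integral {0..2*pi} (\<lambda>\<phi>. seg1 \<phi> \<omega> * seg2 \<phi> \<omega>))"
    unfolding GI fub .
qed

end

section \<open>The weight of the main term\<close>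

lemma bounded_continuous_set_integrable:
  fixes g :: "real \<Rightarrow> real"
  assumes "continuous_on {a<..<b} g" "\<And>x. a < x \<Longrightarrow> x < b \<Longrightarrow> \<bar>g x\<bar> \<le> C"
  shows "set_integrable lborel {a<..<b} g"
  unfolding set_integrable_def
proof (rule integrableI_bounded_set[where A = "{a<..<b}" and B = C])
  show "(\<lambda>x. indicator {a<..<b} x *\<^sub>R g x) \<in> borel_measurable lborel"
    using borel_measurable_continuous_on_indicator[OF _ assms(1)] by simp
  show "emeasure lborel {a<..<b} < \<infinity>"
    by (cases "a \<le> b") auto
qed (use assms(2) in auto)

text \<open>In half angles the singularity at \<open>\<pi>\<close> disappears, which leaves only the one at \<open>0\<close>.\<close>
lemma weight_half_angle:
  assumes "0 < \<omega>" "\<omega> < pi"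
  shows "(1 + cos \<omega>)\<^sup>2 / sin \<omega> ^ 3 = cos (\<omega> / 2) / (2 * sin (\<omega> / 2) ^ 3)"
proof -
  define c s where "c = cos (\<omega> / 2)" and "s = sin (\<omega> / 2)"
  have "c > 0" "s > 0" using assms by (auto simp: c_def s_def intro!: cos_gt_zero_pi sin_gt_zero)
  moreover have "1 + cos \<omega> = 2 * c\<^sup>2" using cos_double_cos[of "\<omega> / 2"] by (simp add: c_def)
  moreover have "sin \<omega> = 2 * s * c" using sin_double[of "\<omega> / 2"] by (simp add: c_def s_def)
  ultimately show ?thesis unfolding c_def[symmetric] s_def[symmetric]
    by (simp add: field_simps power2_eq_square power3_eq_cube)
qed

lemma sin_half_lower:
  fixes \<omega> :: real
  assumes "0 < \<omega>" "\<omega> \<le> 1"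
  shows "\<omega> / 4 \<le> sin (\<omega> / 2)"
proof -
  let ?x = "\<omega> / 2"
  have "sin 0 - 0 * cos 0 \<le> sin ?x - ?x * cos ?x"
  proof (rule DERIV_nonneg_imp_nondecreasing[where f = "\<lambda>x. sin x - x * cos x"])
    fix x assume x: "0 \<le> x" "x \<le> ?x"
    then have "x * sin x \<ge> 0" using assms pi_gt3 by (intro mult_nonneg_nonneg sin_ge_zero) auto
    moreover have "((\<lambda>x. sin x - x * cos x) has_real_derivative x * sin x) (at x)"
      by (auto intro!: derivative_eq_intros)
    ultimately show "\<exists>y. ((\<lambda>x. sin x - x * cos x) has_real_derivative y) (at x) \<and> 0 \<le> y" by blast
  qed (use assms in simp)
  moreover have "cos (pi / 3) \<le> cos ?x" using assms pi_gt3 by (intro cos_monotone_0_pi_le) auto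
  then have "?x * (1 / 2) \<le> ?x * cos ?x" using assms by (intro mult_left_mono) (auto simp: cos_60)
  ultimately show ?thesis by simp
qed

lemma weight_bounded:
  fixes f :: "real \<Rightarrow> real"
  assumes cont: "continuous_on {0..pi} f" and O: "f \<in> O[at_right 0](\<lambda>\<omega>. \<omega> ^ 3)"
  obtains C where "\<And>\<omega>. 0 < \<omega> \<Longrightarrow> \<omega> < pi \<Longrightarrow> \<bar>f \<omega> * (1 + cos \<omega>)\<^sup>2 / sin \<omega> ^ 3\<bar> \<le> C"
proof -
  obtain c where c: "c > 0" "eventually (\<lambda>\<omega>. norm (f \<omega>) \<le> c * norm (\<omega> ^ 3)) (at_right 0)"
    using landau_o.bigE[OF O] by blast
  then obtain d0 where d0: "d0 > 0" "\<And>\<omega>. 0 < \<omega> \<Longrightarrow> \<omega> < d0 \<Longrightarrow> norm (f \<omega>) \<le> c * norm (\<omega> ^ 3)"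
    unfolding eventually_at_right_field by auto
  define d where "d = min d0 1"
  have d: "0 < d" "d \<le> 1" using d0(1) by (auto simp: d_def)
  obtain F where F: "\<And>\<omega>. \<omega> \<in> {0..pi} \<Longrightarrow> \<bar>f \<omega>\<bar> \<le> F"
  proof -
    have "bounded (f ` {0..pi})" by (intro compact_imp_bounded compact_continuous_image cont compact_Icc)
    then show thesis using that unfolding bounded_iff by fastforce
  qed
  have sd: "sin (d / 2) > 0" using d pi_gt3 by (intro sin_gt_zero) auto
  \<comment> \<open>Below \<open>d\<close> the bound comes from \<open>\<omega> / 4 \<le> sin (\<omega> / 2)\<close>, above \<open>d\<close> from the boundedness of \<open>f\<close>.\<close>
  show thesis
  proof (rule that[of "max (32 * c) (F / (2 * sin (d / 2) ^ 3))"])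
    fix \<omega> :: real assume \<omega>: "0 < \<omega>" "\<omega> < pi"
    define s where "s = sin (\<omega> / 2)"
    have s: "s > 0" using \<omega> by (auto simp: s_def intro!: sin_gt_zero)
    have "\<bar>f \<omega> * (1 + cos \<omega>)\<^sup>2 / sin \<omega> ^ 3\<bar> = \<bar>f \<omega>\<bar> * (\<bar>cos (\<omega> / 2)\<bar> / (2 * s ^ 3))"
      unfolding times_divide_eq_right[symmetric] weight_half_angle[OF \<omega>] s_def[symmetric] abs_mult
      using s by (simp add: abs_mult)
    also have "\<dots> \<le> \<bar>f \<omega>\<bar> * (1 / (2 * s ^ 3))" using s by (intro mult_left_mono divide_right_mono) auto
    finally have b: "\<bar>f \<omega> * (1 + cos \<omega>)\<^sup>2 / sin \<omega> ^ 3\<bar> \<le> \<bar>f \<omega>\<bar> * (1 / (2 * s ^ 3))" .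
    show "\<bar>f \<omega> * (1 + cos \<omega>)\<^sup>2 / sin \<omega> ^ 3\<bar> \<le> max (32 * c) (F / (2 * sin (d / 2) ^ 3))"
    proof (cases "\<omega> < d")
      case True
      have "\<omega> / 4 \<le> s" unfolding s_def using True d \<omega> by (intro sin_half_lower) auto
      then have "(\<omega> / 4) ^ 3 \<le> s ^ 3" using \<omega> by (intro power_mono) auto
      then have "\<omega> ^ 3 \<le> 64 * s ^ 3" by (simp add: power_divide)
      moreover have "\<bar>f \<omega>\<bar> \<le> c * \<omega> ^ 3" using d0(2)[of \<omega>] True \<omega> by (simp add: d_def)
      ultimately have "\<bar>f \<omega>\<bar> \<le> c * (64 * s ^ 3)" using c(1) mult_left_mono[of "\<omega> ^ 3" "64 * s ^ 3" c] by linarith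
      then have "\<bar>f \<omega>\<bar> * (1 / (2 * s ^ 3)) \<le> 32 * c" using s by (simp add: field_simps)
      with b show ?thesis by linarith
    next
      case False
      have "sin (d / 2) \<le> s" unfolding s_def using False d \<omega> by (intro sin_monotone_2pi_le) auto
      then have "sin (d / 2) ^ 3 \<le> s ^ 3" using sd by (intro power_mono) auto
      then have "\<bar>f \<omega>\<bar> * (1 / (2 * s ^ 3)) \<le> F * (1 / (2 * sin (d / 2) ^ 3))"
        using F[of \<omega>] \<omega> s sd by (intro mult_mono divide_left_mono) auto
      with b show ?thesis by simp
    qed
  qed
qed

section \<open>Identification of the visual angle and termwise integration\<close>

context smooth_support
begin

lemma gap_per_int: "gap P (\<phi> + 2*pi * of_int n) = gap P \<phi>"
  by (rule periodic_add_int) (simp add: gap_def p_per)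

text \<open>The tangents through a crossing point are those of its tangent pair, each in one of the two roles, and the
  angle between the rays is symmetric in the roles; so the definite description has a unique witness.\<close>
lemma visual_angle_crossing:
  assumes con: "\<And>t. \<gamma> t = contact (\<theta> t)" and tl: "\<And>t. tangent_line \<gamma> t = {x. gap x (\<theta> t) = 0}"
    and surj: "\<And>\<phi>. \<exists>t. \<exists>n::int. \<theta> t = \<phi> + 2*pi * of_int n"
    and \<omega>: "0 < \<omega>" "\<omega> < pi"
  shows "visual_angle \<gamma> (crossing \<phi> \<omega>) = \<omega>"
proof -
  let ?P = "crossing \<phi> \<omega>" and ?\<psi> = "\<phi> + pi - \<omega>"
  have pair: "tangent_pair ?P \<phi> (pi - \<omega>)" using tangent_pair_iff_crossing[OF \<omega>] by simp
  then have z: "gap ?P \<phi> = 0" "gap ?P ?\<psi> = 0" by (auto simp: tangent_pair_def add_diff_eq)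
  have sn: "sin \<omega> > 0" using \<omega> by (simp add: sin_gt_zero)
  have ne: "gap (contact ?\<psi>) \<phi> \<noteq> 0"
  proof -
    have "contact ?\<psi> = ?P + (seg2 \<phi> \<omega> / sin \<omega>) *\<^sub>R eperp ?\<psi>"
      using crossing_from_contact(2)[OF \<omega>, of \<phi>] by (simp add: algebra_simps)
    then have "gap (contact ?\<psi>) \<phi> = gap ?P \<phi> - seg2 \<phi> \<omega> / sin \<omega> * sin (\<phi> - ?\<psi>)"
      by (simp add: gap_def inner_add_left frame_inner)
    moreover have "sin (\<phi> - ?\<psi>) = - sin \<omega>" by (simp add: sin_diff)
    ultimately show ?thesis using z sn seg_pos(2)[of \<omega> \<phi>] \<omega> by simp
  qed
  show ?thesis
    unfolding visual_angle_def
  proof (rule the_equality)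
    obtain s t and n m :: int where st: "\<theta> s = \<phi> + 2*pi * of_int n" "\<theta> t = ?\<psi> + 2*pi * of_int m"
      using surj by metis
    have "gap (contact ?\<psi>) ?\<psi> = 0" by (simp add: gap_def contact_def inner_add_left)
    then have "contact ?\<psi> \<in> tangent_line \<gamma> t" "contact ?\<psi> \<notin> tangent_line \<gamma> s"
      using ne by (simp_all add: tl st gap_per_int)
    then have "tangent_line \<gamma> s \<noteq> tangent_line \<gamma> t" by blast
    moreover have "?P \<in> tangent_line \<gamma> s" "?P \<in> tangent_line \<gamma> t" using z by (simp_all add: tl st gap_per_int)
    moreover have "\<omega> = vector_angle (\<gamma> s - ?P) (\<gamma> t - ?P)"
      unfolding con st contact_per_int using vector_angle_crossing(1)[OF \<omega>] by simp
    ultimately show "\<exists>s t. ?P \<in> tangent_line \<gamma> s \<and> ?P \<in> tangent_line \<gamma> t \<and>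
        tangent_line \<gamma> s \<noteq> tangent_line \<gamma> t \<and> \<omega> = vector_angle (\<gamma> s - ?P) (\<gamma> t - ?P)" by blast
  next
    fix \<alpha> assume "\<exists>s t. ?P \<in> tangent_line \<gamma> s \<and> ?P \<in> tangent_line \<gamma> t \<and>
        tangent_line \<gamma> s \<noteq> tangent_line \<gamma> t \<and> \<alpha> = vector_angle (\<gamma> s - ?P) (\<gamma> t - ?P)"
    then obtain s t where st: "gap ?P (\<theta> s) = 0" "gap ?P (\<theta> t) = 0" "tangent_line \<gamma> s \<noteq> tangent_line \<gamma> t"
      and \<alpha>: "\<alpha> = vector_angle (\<gamma> s - ?P) (\<gamma> t - ?P)" unfolding tl by auto
    obtain n m :: int where n: "\<theta> s = \<phi> + 2*pi * of_int n \<or> \<theta> s = ?\<psi> + 2*pi * of_int n"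
      and m: "\<theta> t = \<phi> + 2*pi * of_int m \<or> \<theta> t = ?\<psi> + 2*pi * of_int m"
      using tangent_classification[OF pair st(1)] tangent_classification[OF pair st(2)] by (auto simp: add_diff_eq)
    have same: "tangent_line \<gamma> s = tangent_line \<gamma> t" if "\<theta> s = x + 2*pi * of_int n" "\<theta> t = x + 2*pi * of_int m" for x
      by (simp add: tl that gap_per_int)
    from n m same[of \<phi>] same[of ?\<psi>] st(3)
    have "(\<gamma> s = contact \<phi> \<and> \<gamma> t = contact ?\<psi>) \<or> (\<gamma> s = contact ?\<psi> \<and> \<gamma> t = contact \<phi>)"
      unfolding con by (metis contact_per_int)
    then show "\<alpha> = \<omega>" unfolding \<alpha> using vector_angle_crossing[OF \<omega>] by auto
  qed
qed

text \<open>The series for the averaged segment product is integrated term by term against \<open>f / sin\<^sup>3\<close>. By the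
  kernel bound the \<open>k\<close>-th term is at most a constant times \<open>(k\<^sup>2 - 1)\<^sup>2\<close> times the squared coefficients,
  and these are summable.\<close>
lemma weighted_series:
  fixes f :: "real \<Rightarrow> real"
  defines "J \<equiv> \<lambda>k. (LBINT \<omega>:{0<..<pi}. f \<omega> * h_fun k \<omega> / sin \<omega> ^ 3)"
    and "C \<equiv> \<lambda>k. (fourier_cos_coeff p k)\<^sup>2 + (fourier_sin_coeff p k)\<^sup>2"
    and "L \<equiv> integral {0..2*pi} p"
  assumes f: "continuous_on {0<..<pi} f"
    and bnd: "\<And>\<omega>. 0 < \<omega> \<Longrightarrow> \<omega> < pi \<Longrightarrow> \<bar>f \<omega> * (1 + cos \<omega>)\<^sup>2 / sin \<omega> ^ 3\<bar> \<le> B"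
  shows "set_integrable lborel {0<..<pi} (\<lambda>\<omega>. f \<omega> * (1 + cos \<omega>)\<^sup>2 / sin \<omega> ^ 3)"
    and "k > 0 \<Longrightarrow> set_integrable lborel {0<..<pi} (\<lambda>\<omega>. f \<omega> * h_fun k \<omega> / sin \<omega> ^ 3)"
    and "(\<lambda>j. pi * C (j + 2) * J (j + 2)) sums
      ((LBINT \<omega>:{0<..<pi}. f \<omega> / sin \<omega> ^ 3 * integral {0..2*pi} (\<lambda>\<phi>. seg1 \<phi> \<omega> * seg2 \<phi> \<omega>))
        - (LBINT \<omega>:{0<..<pi}. f \<omega> * (1 + cos \<omega>)\<^sup>2 / sin \<omega> ^ 3) * (L\<^sup>2 / (2*pi)))"
proof -
  let ?w = "\<lambda>\<omega>. f \<omega> * (1 + cos \<omega>)\<^sup>2 / sin \<omega> ^ 3" and ?q = "\<lambda>k \<omega>. f \<omega> * h_fun k \<omega> / sin \<omega> ^ 3"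
  have s: "sin \<omega> ^ 3 \<noteq> 0" if "\<omega> \<in> {0<..<pi}" for \<omega> using that sin_gt_zero[of \<omega>] by auto
  have "continuous_on {0<..<pi} ?w" by (intro continuous_intros f) (use s in auto)
  then show wi: "set_integrable lborel {0<..<pi} ?w"
    using bnd by (rule bounded_continuous_set_integrable)
  have qb: "\<bar>?q k \<omega>\<bar> \<le> 2 * ((real k)\<^sup>2 - 1)\<^sup>2 * B" if "0 < \<omega>" "\<omega> < pi" "k > 0" for k \<omega>
  proof -
    have "\<bar>?q k \<omega>\<bar> = \<bar>f \<omega> / sin \<omega> ^ 3\<bar> * \<bar>h_fun k \<omega>\<bar>" by (simp add: abs_mult)
    also have "\<dots> \<le> \<bar>f \<omega> / sin \<omega> ^ 3\<bar> * (2 * ((real k)\<^sup>2 - 1)\<^sup>2 * (1 + cos \<omega>)\<^sup>2)"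
      using that by (intro mult_left_mono h_fun_bound) auto
    also have "\<dots> = 2 * ((real k)\<^sup>2 - 1)\<^sup>2 * \<bar>?w \<omega>\<bar>" by (simp add: abs_mult)
    also have "\<dots> \<le> 2 * ((real k)\<^sup>2 - 1)\<^sup>2 * B" using bnd that by (intro mult_left_mono) auto
    finally show ?thesis .
  qed
  have "continuous_on {0<..<pi} (?q k)" for k unfolding h_fun_def by (intro continuous_intros f) (use s in auto)
  then show qi: "set_integrable lborel {0<..<pi} (?q k)" if "k > 0" for k
    using qb[OF _ _ that] by (rule bounded_continuous_set_integrable)
  have "B \<ge> 0" using bnd[of 1] pi_gt3 by (smt (verit) abs_ge_zero)
  have C0: "C k \<ge> 0" for k by (simp add: C_def)
  have sC: "summable (\<lambda>j. ((real (j + 2))\<^sup>2 - 1)\<^sup>2 * C (j + 2))"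
    using coeff_summable unfolding C_def by (rule summable_ignore_initial_segment)
  define T where "T j \<omega> = indicator {0<..<pi} \<omega> *\<^sub>R (pi * C (j + 2) * ?q (j + 2) \<omega>)" for j \<omega>
  have Ti: "integrable lborel (T j)" for j
    unfolding T_def set_integrable_def[symmetric] by (intro set_integrable_mult_right qi) simp
  have Tb: "norm (T j \<omega>) \<le> (2 * pi * B) * (((real (j + 2))\<^sup>2 - 1)\<^sup>2 * C (j + 2)) * indicator {0<..<pi} \<omega>" for j \<omega>
  proof (cases "\<omega> \<in> {0<..<pi}")
    case True
    have "pi * C (j + 2) * \<bar>?q (j + 2) \<omega>\<bar> \<le> pi * C (j + 2) * (2 * ((real (j + 2))\<^sup>2 - 1)\<^sup>2 * B)"
      using True C0 by (intro mult_left_mono qb) auto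
    with True C0[of "j + 2"] show ?thesis unfolding T_def by (simp add: abs_mult mult_ac)
  qed (simp add: T_def)
  have Ts: "summable (\<lambda>j. norm (T j \<omega>))" for \<omega>
    by (rule summable_comparison_test'[OF summable_mult2[OF summable_mult[OF sC, of "2 * pi * B"], of "indicator {0<..<pi} \<omega>"], of 0])
      (use Tb in \<open>simp add: mult_ac\<close>)
  have TI: "summable (\<lambda>j. \<integral>\<omega>. norm (T j \<omega>) \<partial>lborel)"
  proof (rule summable_comparison_test'[OF summable_mult[OF sC, of "2 * pi * B * pi"], of 0])
    fix j
    have "(\<integral>\<omega>. norm (T j \<omega>) \<partial>lborel) \<le> (\<integral>\<omega>. (2 * pi * B) * (((real (j + 2))\<^sup>2 - 1)\<^sup>2 * C (j + 2)) * indicator {0<..<pi} \<omega> \<partial>lborel)"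
      using Tb by (intro integral_mono integrable_norm Ti) auto
    also have "\<dots> = (2 * pi * B * pi) * (((real (j + 2))\<^sup>2 - 1)\<^sup>2 * C (j + 2))" by simp
    finally show "norm (\<integral>\<omega>. norm (T j \<omega>) \<partial>lborel) \<le> (2 * pi * B * pi) * (((real (j + 2))\<^sup>2 - 1)\<^sup>2 * C (j + 2))"
      by simp
  qed
  have "(\<lambda>j. integral\<^sup>L lborel (T j)) sums (\<integral>\<omega>. (\<Sum>j. T j \<omega>) \<partial>lborel)"
    by (rule sums_integral[OF Ti AE_I2[OF Ts] TI])
  moreover have "integral\<^sup>L lborel (T j) = pi * C (j + 2) * J (j + 2)" for j
    unfolding T_def J_def set_lebesgue_integral_def integral_mult_right_zero[symmetric] by (simp add: mult_ac)
  moreover have "(\<integral>\<omega>. (\<Sum>j. T j \<omega>) \<partial>lborel) =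
      (LBINT \<omega>:{0<..<pi}. f \<omega> / sin \<omega> ^ 3 * integral {0..2*pi} (\<lambda>\<phi>. seg1 \<phi> \<omega> * seg2 \<phi> \<omega>))
        - (LBINT \<omega>:{0<..<pi}. ?w \<omega>) * (L\<^sup>2 / (2*pi))"
  proof -
    let ?I = "\<lambda>\<omega>. integral {0..2*pi} (\<lambda>\<phi>. seg1 \<phi> \<omega> * seg2 \<phi> \<omega>)"
    have e: "(\<Sum>j. T j \<omega>) = indicator {0<..<pi} \<omega> *\<^sub>R (f \<omega> / sin \<omega> ^ 3 * ?I \<omega>) - (indicator {0<..<pi} \<omega> *\<^sub>R ?w \<omega>) * (L\<^sup>2 / (2*pi))" for \<omega>
    proof -
      have "(\<lambda>j. (indicator {0<..<pi} \<omega> * f \<omega> / sin \<omega> ^ 3) * (pi * C (j + 2) * h_fun (j + 2) \<omega>)) sums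
         ((indicator {0<..<pi} \<omega> * f \<omega> / sin \<omega> ^ 3) * (?I \<omega> - L\<^sup>2 / (2*pi) * (1 + cos \<omega>)\<^sup>2))"
        unfolding C_def L_def by (intro sums_mult seg_product_integral_sums)
      also have "(\<lambda>j. (indicator {0<..<pi} \<omega> * f \<omega> / sin \<omega> ^ 3) * (pi * C (j + 2) * h_fun (j + 2) \<omega>)) = (\<lambda>j. T j \<omega>)"
        by (simp add: T_def fun_eq_iff)
      finally show ?thesis by (simp add: sums_iff algebra_simps)
    qed
    have wi': "integrable lborel (\<lambda>\<omega>. (indicator {0<..<pi} \<omega> *\<^sub>R ?w \<omega>) * (L\<^sup>2 / (2*pi)))"
      using wi unfolding set_integrable_def by (rule integrable_mult_left)
    have "integrable lborel (\<lambda>\<omega>. \<Sum>j. T j \<omega>)"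
      by (rule integrable_suminf[OF Ti AE_I2[OF Ts] TI])
    from Bochner_Integration.integrable_add[OF this wi']
    have "integrable lborel (\<lambda>\<omega>. indicator {0<..<pi} \<omega> *\<^sub>R (f \<omega> / sin \<omega> ^ 3 * ?I \<omega>))" unfolding e by simp
    then show ?thesis
      unfolding e set_lebesgue_integral_def
      by (subst Bochner_Integration.integral_diff[OF _ wi']) (simp_all only: integral_mult_left_zero)
  qed
  ultimately show "(\<lambda>j. pi * C (j + 2) * J (j + 2)) sums
      ((LBINT \<omega>:{0<..<pi}. f \<omega> / sin \<omega> ^ 3 * integral {0..2*pi} (\<lambda>\<phi>. seg1 \<phi> \<omega> * seg2 \<phi> \<omega>))
        - (LBINT \<omega>:{0<..<pi}. ?w \<omega>) * (L\<^sup>2 / (2*pi)))" by simp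
qed

end

theorem theorem3p1:
  fixes K :: "(real^2) set" and \<gamma> :: "real \<Rightarrow> real^2" and p f :: "real \<Rightarrow> real"
    and L :: real and c :: "nat \<Rightarrow> real"
  assumes "compact K" and "convex K"
    and "C2_boundary_parametrization \<gamma> K"
    and "p = support_function K" and "C2_function p"
    and "L = closed_curve_length \<gamma>"
    and "\<And>k. (c k)\<^sup>2 = (fourier_cos_coeff p k)\<^sup>2 + (fourier_sin_coeff p k)\<^sup>2"
    and "continuous_on {0..pi} f"
    and "f \<in> O[at_right 0](\<lambda>\<omega>. \<omega> ^ 3)"
  shows "set_integrable lborel (- K) (\<lambda>P. f (visual_angle \<gamma> P))
    \<and> set_integrable lborel {0<..<pi} (\<lambda>\<omega>. f \<omega> * (1 + cos \<omega>)\<^sup>2 / (sin \<omega>) ^ 3)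
    \<and> (\<forall>k\<ge>2. set_integrable lborel {0<..<pi} (\<lambda>\<omega>. f \<omega> * h_fun k \<omega> / (sin \<omega>) ^ 3))
    \<and> summable (\<lambda>j. (LBINT \<omega>:{0<..<pi}. f \<omega> * h_fun (j + 2) \<omega> / (sin \<omega>) ^ 3) * (c (j + 2))\<^sup>2)
    \<and> (LBINT P:(- K). f (visual_angle \<gamma> P)) =
        (LBINT \<omega>:{0<..<pi}. f \<omega> * (1 + cos \<omega>)\<^sup>2 / (sin \<omega>) ^ 3) * (L\<^sup>2 / (2 * pi))
        + pi * (\<Sum>j. (LBINT \<omega>:{0<..<pi}. f \<omega> * h_fun (j + 2) \<omega> / (sin \<omega>) ^ 3) * (c (j + 2))\<^sup>2)"
proof -
  obtain p1 p2 \<theta> where S: "smooth_support p p1 p2" and K: "K = smooth_support.body p"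
    and con: "\<And>t. \<gamma> t = smooth_support.contact p p1 (\<theta> t)"
    and tl: "\<And>t. tangent_line \<gamma> t = {x. smooth_support.gap p x (\<theta> t) = 0}"
    and surj: "\<And>\<phi>. \<exists>t. \<exists>n::int. \<theta> t = \<phi> + 2*pi * of_int n"
    and len: "closed_curve_length \<gamma> = integral {0..2*pi} p"
    using boundary_support_parametrization[OF assms(1,2,3,4,5)] by blast
  interpret S: smooth_support p p1 p2 by (rule S)
  have ang: "visual_angle \<gamma> (S.crossing \<phi> \<omega>) = \<omega>" if "0 < \<omega>" "\<omega> < pi" for \<phi> \<omega>
    using S.visual_angle_crossing[OF con tl surj that] .
  obtain B where B: "\<And>\<omega>. 0 < \<omega> \<Longrightarrow> \<omega> < pi \<Longrightarrow> \<bar>f \<omega> * (1 + cos \<omega>)\<^sup>2 / sin \<omega> ^ 3\<bar> \<le> B"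
    using weight_bounded[OF assms(8,9)] by blast
  have fc: "continuous_on {0<..<pi} f" by (rule continuous_on_subset[OF assms(8)]) auto
  let ?J = "\<lambda>k. (LBINT \<omega>:{0<..<pi}. f \<omega> * h_fun k \<omega> / sin \<omega> ^ 3)"
  have L: "integral {0..2*pi} p = L" using len assms(6) by simp
  have area: "set_integrable lborel (- K) (\<lambda>P. f (visual_angle \<gamma> P))"
    and area_eq: "(LBINT P:(- K). f (visual_angle \<gamma> P)) =
       (LBINT \<omega>:{0<..<pi}. f \<omega> / sin \<omega> ^ 3 * integral {0..2*pi} (\<lambda>\<phi>. S.seg1 \<phi> \<omega> * S.seg2 \<phi> \<omega>))"
    using S.area_integral[OF ang fc B] by (simp_all add: K)
  have "(\<lambda>j. pi * (?J (j + 2) * (c (j + 2))\<^sup>2)) sums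
      ((LBINT P:(- K). f (visual_angle \<gamma> P))
        - (LBINT \<omega>:{0<..<pi}. f \<omega> * (1 + cos \<omega>)\<^sup>2 / sin \<omega> ^ 3) * (L\<^sup>2 / (2*pi)))"
    using S.weighted_series(3)[OF fc B] unfolding area_eq L assms(7) by (simp add: mult_ac)
  from sums_mult[OF this, of "1 / pi"]
  have "(\<lambda>j. ?J (j + 2) * (c (j + 2))\<^sup>2) sums
      (1 / pi * ((LBINT P:(- K). f (visual_angle \<gamma> P))
        - (LBINT \<omega>:{0<..<pi}. f \<omega> * (1 + cos \<omega>)\<^sup>2 / sin \<omega> ^ 3) * (L\<^sup>2 / (2*pi))))"
    by simp
  then have "summable (\<lambda>j. ?J (j + 2) * (c (j + 2))\<^sup>2)"
    and "(\<Sum>j. ?J (j + 2) * (c (j + 2))\<^sup>2) = 1 / pi * ((LBINT P:(- K). f (visual_angle \<gamma> P))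
        - (LBINT \<omega>:{0<..<pi}. f \<omega> * (1 + cos \<omega>)\<^sup>2 / sin \<omega> ^ 3) * (L\<^sup>2 / (2*pi)))"
    unfolding sums_iff by blast+
  then show ?thesis
    using area S.weighted_series(1)[OF fc B] S.weighted_series(2)[OF fc B] by simp
qed

end
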